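(* Let $(\mathfrak{H},[\cdot,\cdot])$ be a Krein space with fundamental symmetry $J$, let $\mathcal{F}=\{f_n\}_{n\in\mathbb{N}}\subset\mathfrak{H}$ be a $J$-frame with frame bounds $0<A\le B$ and associated subspaces $\mathcal{M}_\pm$, and suppose that $\mathcal{M}_+$ and $\mathcal{M}_-$ are $J$-orthogonal. Then there exists a self-adjoint operator $Q$ in the Hilbert space $(\mathfrak{H},(\cdot,\cdot))$ which anticommutes with $J$ and is such that the sequence $\{e^{Q/2}f_n\}$ is a (conventional) frame in $(\mathfrak{H},(\cdot,\cdot))$ with the same frame bounds $A\le B$, i.e. every $f_n$ lies in the domain of $e^{Q/2}$ and $A\|f\|^2\le\sum_{n\in\mathbb{N}}|(f,e^{Q/2}f_n)|^2\le B\|f\|^2$ for all $f\in\mathfrak{H}$.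
   Context: A Krein space $(\mathfrak{H},[\cdot,\cdot])$ is a complex (infinite-dimensional) linear space with an indefinite inner product admitting a fundamental decomposition $\mathfrak{H}=\mathfrak{H}_+[\dot{+}]\mathfrak{H}_-$, a $[\cdot,\cdot]$-orthogonal direct sum of Hilbert spaces $(\mathfrak{H}_+,[\cdot,\cdot])$ and $(\mathfrak{H}_-,-[\cdot,\cdot])$. A fundamental decomposition is fixed; its fundamental symmetry is $J(f_++f_-)=f_+-f_-$ ($f_\pm\in\mathfrak{H}_\pm$), and $(\cdot,\cdot)=[J\cdot,\cdot]$, $\|\cdot\|=\sqrt{(\cdot,\cdot)}$ is the associated Hilbert space inner product and norm. Subspaces are closed and topological notions refer to $\|\cdot\|$. A subspace $\mathcal{L}$ is positive (negative) if $[f,f]>0$ ($[f,f]<0$) for all nonzero $f\in\mathcal{L}$, and maximal positive (negative) if it is not a proper subspace of another positive (negative) subspace. $\mathcal{L}_1,\mathcal{L}_2$ are $J$-orthogonal if $[f,g]=0$ for all $f\in\mathcal{L}_1$, $g\in\mathcal{L}_2$. For $\mathcal{F}=\{f_n\}$ put $\mathbb{N}_+=\{n:[f_n,f_n]\ge0\}$, $\mathbb{N}_-=\{n:[f_n,f_n]<0\}$, $\mathcal{F}_\pm=\{f_n\}_{n\in\mathbb{N}_\pm}$, $\mathcal{M}_\pm=\overline{\mathrm{span}\,\mathcal{F}_\pm}$. $\mathcal{F}$ is a $J$-frame with frame bounds $0<A\le B$ if $\mathcal{M}_+$ is maximal positive, $\mathcal{M}_-$ is maximal negative, and $A|[f,f]|\le\sum_{n\in\mathbb{N}_+}|[f,f_n]|^2\le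 B|[f,f]|$ for all $f\in\mathrm{span}\,\mathcal{F}_+$, and $A|[f,f]|\le\sum_{n\in\mathbb{N}_-}|[f,f_n]|^2\le B|[f,f]|$ for all $f\in\mathrm{span}\,\mathcal{F}_-$. A (possibly unbounded) self-adjoint $Q$ anticommutes with $J$ if $J\mathcal{D}(Q)=\mathcal{D}(Q)$ and $JQf=-QJf$ for $f\in\mathcal{D}(Q)$. $e^{Q/2}$ is defined by the functional calculus. *)

theory Defs
  imports "HOL-Analysis.Analysis"
begin

class complex_normed_space = real_normed_vector +
  fixes scaleC :: "complex \<Rightarrow> 'a \<Rightarrow> 'a" (infixr "*\<^sub>C" 75)
  assumes scaleC_add_right: "c *\<^sub>C (x + y) = c *\<^sub>C x + c *\<^sub>C y"
    and scaleC_add_left: "(c + d) *\<^sub>C x = c *\<^sub>C x + d *\<^sub>C x"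
    and scaleC_scaleC: "c *\<^sub>C d *\<^sub>C x = (c * d) *\<^sub>C x"
    and scaleR_scaleC: "scaleR r x = complex_of_real r *\<^sub>C x"
    and norm_scaleC: "norm (c *\<^sub>C x) = cmod c * norm x"

text \<open>
  A Krein space on the whole type, with a fixed fundamental decomposition into
  \<open>krein_pos\<close> and \<open>krein_neg\<close>. The indefinite inner product \<open>kip\<close> is linear in its first
  argument. By \<open>norm_krein\<close> the norm of the type, hence its topology, is the one induced
  by the decomposition (see \<open>norm_eq_sqrt_hip\<close> below), so that completeness of the
  summands is completeness with respect to \<open>\<surd>[f,f]\<close> and \<open>\<surd>(-[f,f])\<close>.

  Class axioms cannot mention \<^const>\<open>module.subspace\<close>, \<^const>\<open>module.span\<close>,
  \<^const>\<open>Cauchy\<close> or \<^const>\<open>complete\<close> on the class type, so these appear unfolded; the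
  lemmas after the class state them in library form.
\<close>

class krein_space = complex_normed_space +
  fixes kip :: "'a \<Rightarrow> 'a \<Rightarrow> complex"
    and krein_pos :: "'a set"
    and krein_neg :: "'a set"
  assumes infinite_dimensional: "finite S \<Longrightarrow> \<exists>x. \<forall>c. x \<noteq> (\<Sum>v\<in>S. c v *\<^sub>C v)"
    and kip_add_left: "kip (x + y) z = kip x z + kip y z"
    and kip_scaleC_left: "kip (c *\<^sub>C x) y = c * kip x y"
    and kip_commute: "kip y x = cnj (kip x y)"
    and krein_pos_zero: "0 \<in> krein_pos"
    and krein_pos_add: "p \<in> krein_pos \<Longrightarrow> p' \<in> krein_pos \<Longrightarrow> p + p' \<in> krein_pos"
    and krein_pos_scaleC: "p \<in> krein_pos \<Longrightarrow> c *\<^sub>C p \<in> krein_pos"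
    and krein_neg_zero: "0 \<in> krein_neg"
    and krein_neg_add: "m \<in> krein_neg \<Longrightarrow> m' \<in> krein_neg \<Longrightarrow> m + m' \<in> krein_neg"
    and krein_neg_scaleC: "m \<in> krein_neg \<Longrightarrow> c *\<^sub>C m \<in> krein_neg"
    and krein_orthogonal: "p \<in> krein_pos \<Longrightarrow> m \<in> krein_neg \<Longrightarrow> kip p m = 0"
    and krein_direct: "krein_pos \<inter> krein_neg = {0}"
    and krein_sum: "\<exists>p\<in>krein_pos. \<exists>m\<in>krein_neg. x = p + m"
    and kip_krein_pos: "p \<in> krein_pos \<Longrightarrow> p \<noteq> 0 \<Longrightarrow> 0 < Re (kip p p)"
    and kip_krein_neg: "m \<in> krein_neg \<Longrightarrow> m \<noteq> 0 \<Longrightarrow> Re (kip m m) < 0"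
    and norm_krein:
      "p \<in> krein_pos \<Longrightarrow> m \<in> krein_neg \<Longrightarrow> (norm (p + m))\<^sup>2 = Re (kip p p) - Re (kip m m)"
    and krein_pos_Cauchy:
      "(\<And>n. X n \<in> krein_pos) \<Longrightarrow>
       (\<And>e. 0 < e \<Longrightarrow> \<exists>M. \<forall>m\<ge>M. \<forall>n\<ge>M. dist (X m) (X n) < e) \<Longrightarrow> \<exists>l\<in>krein_pos. X \<longlonglongrightarrow> l"
    and krein_neg_Cauchy:
      "(\<And>n. X n \<in> krein_neg) \<Longrightarrow>
       (\<And>e. 0 < e \<Longrightarrow> \<exists>M. \<forall>m\<ge>M. \<forall>n\<ge>M. dist (X m) (X n) < e) \<Longrightarrow> \<exists>l\<in>krein_neg. X \<longlonglongrightarrow> l"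

lemma vector_space_scaleC: "vector_space (scaleC :: complex \<Rightarrow> 'a \<Rightarrow> 'a::complex_normed_space)"
proof
  fix x :: 'a
  show "1 *\<^sub>C x = x"
    by (metis of_real_1 scaleR_one scaleR_scaleC)
qed (simp_all add: scaleC_add_right scaleC_add_left scaleC_scaleC)

abbreviation csubspace :: "'a::complex_normed_space set \<Rightarrow> bool"
  where "csubspace \<equiv> module.subspace scaleC"

abbreviation cspan :: "'a::complex_normed_space set \<Rightarrow> 'a set"
  where "cspan \<equiv> module.span scaleC"

lemma csubspace_krein_pos: "csubspace (krein_pos :: 'a::krein_space set)"
  and csubspace_krein_neg: "csubspace (krein_neg :: 'a set)"
proof -
  interpret vector_space "scaleC :: complex \<Rightarrow> 'a \<Rightarrow> 'a"
    by (rule vector_space_scaleC)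
  show "csubspace (krein_pos :: 'a set)" "csubspace (krein_neg :: 'a set)"
    by (simp_all add: subspace_def krein_pos_zero krein_pos_add krein_pos_scaleC
        krein_neg_zero krein_neg_add krein_neg_scaleC)
qed

lemma complete_krein_pos: "complete (krein_pos :: 'a::krein_space set)"
  and complete_krein_neg: "complete (krein_neg :: 'a set)"
proof -
  show "complete (krein_pos :: 'a set)"
    unfolding complete_def
  proof (intro allI impI)
    fix X :: "nat \<Rightarrow> 'a"
    assume X: "(\<forall>n. X n \<in> krein_pos) \<and> Cauchy X"
    show "\<exists>l\<in>krein_pos. X \<longlonglongrightarrow> l"
      by (rule krein_pos_Cauchy) (use X metric_CauchyD in blast)+
  qed
  show "complete (krein_neg :: 'a set)"
    unfolding complete_def
  proof (intro allI impI)
    fix X :: "nat \<Rightarrow> 'a"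
    assume X: "(\<forall>n. X n \<in> krein_neg) \<and> Cauchy X"
    show "\<exists>l\<in>krein_neg. X \<longlonglongrightarrow> l"
      by (rule krein_neg_Cauchy) (use X metric_CauchyD in blast)+
  qed
qed

lemma cspan_finite_ne_UNIV:
  fixes S :: "'a::krein_space set"
  assumes "finite S"
  shows "cspan S \<noteq> UNIV"
proof -
  interpret vector_space "scaleC :: complex \<Rightarrow> 'a \<Rightarrow> 'a"
    by (rule vector_space_scaleC)
  show ?thesis
  proof
    assume "cspan S = UNIV"
    then have "x \<in> range (\<lambda>c. \<Sum>v\<in>S. c v *\<^sub>C v)" for x
      using span_finite[OF assms] by simp
    then show False
      using infinite_dimensional[OF assms] by blast
  qed
qed

definition fund_sym :: "'a::krein_space \<Rightarrow> 'a"
  where "fund_sym x = (THE y. \<exists>p\<in>krein_pos. \<exists>m\<in>krein_neg. x = p + m \<and> y = p - m)"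

definition hip :: "'a::krein_space \<Rightarrow> 'a \<Rightarrow> complex"
  where "hip x y = kip (fund_sym x) y"

lemma krein_decomp_unique:
  fixes p m p' m' :: "'a::krein_space"
  assumes "p \<in> krein_pos" "m \<in> krein_neg" "p' \<in> krein_pos" "m' \<in> krein_neg"
    and eq: "p + m = p' + m'"
  shows "p = p'" "m = m'"
proof -
  interpret vector_space "scaleC :: complex \<Rightarrow> 'a \<Rightarrow> 'a"
    by (rule vector_space_scaleC)
  have "p - p' = m' - m"
    using eq by (simp add: algebra_simps)
  moreover have "p - p' \<in> krein_pos" "m' - m \<in> krein_neg"
    using assms subspace_diff csubspace_krein_pos csubspace_krein_neg by blast+
  ultimately have "p - p' = 0"
    using krein_direct by (metis IntI singletonD)
  then show "p = p'" "m = m'"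
    using eq by auto
qed

lemma fund_sym_add:
  assumes "p \<in> krein_pos" "m \<in> krein_neg"
  shows "fund_sym (p + m) = p - m"
  unfolding fund_sym_def
proof (rule the_equality)
  show "\<exists>p'\<in>krein_pos. \<exists>m'\<in>krein_neg. p + m = p' + m' \<and> p - m = p' - m'"
    using assms by blast
next
  fix y
  assume "\<exists>p'\<in>krein_pos. \<exists>m'\<in>krein_neg. p + m = p' + m' \<and> y = p' - m'"
  then obtain p' m' where *: "p' \<in> krein_pos" "m' \<in> krein_neg" "p + m = p' + m'" "y = p' - m'"
    by blast
  show "y = p - m"
    using krein_decomp_unique[OF assms *(1-3)] *(4) by simp
qed

lemma norm_eq_sqrt_hip: "norm x = sqrt (Re (hip x x))"
proof -
  obtain p m where pm: "p \<in> krein_pos" "m \<in> krein_neg" "x = p + m"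
    using krein_sum by blast
  have add_right: "kip z (p + m) = kip z p + kip z m" for z
    by (metis kip_add_left kip_commute complex_cnj_add)
  have "kip (p - m) z = kip p z - kip m z" for z
    by (metis add_diff_cancel_right' diff_add_cancel kip_add_left)
  moreover have "kip p m = 0" "kip m p = 0"
    using pm krein_orthogonal kip_commute by (metis complex_cnj_zero)+
  ultimately have "hip x x = kip p p - kip m m"
    using pm by (simp add: hip_def fund_sym_add add_right)
  then have "(norm x)\<^sup>2 = Re (hip x x)"
    using norm_krein pm by simp
  then show ?thesis
    by (metis norm_ge_zero real_sqrt_unique)
qed


text \<open>Subspaces of a Krein space are understood to be closed.\<close>

definition positive_subspace :: "'a::krein_space set \<Rightarrow> bool"
  where "positive_subspace L \<longleftrightarrow>
    csubspace L \<and> closed L \<and> (\<forall>x\<in>L. x \<noteq> 0 \<longrightarrow> 0 < Re (kip x x))"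

definition negative_subspace :: "'a::krein_space set \<Rightarrow> bool"
  where "negative_subspace L \<longleftrightarrow>
    csubspace L \<and> closed L \<and> (\<forall>x\<in>L. x \<noteq> 0 \<longrightarrow> Re (kip x x) < 0)"

definition maximal_positive :: "'a::krein_space set \<Rightarrow> bool"
  where "maximal_positive L \<longleftrightarrow>
    positive_subspace L \<and> \<not> (\<exists>L'. positive_subspace L' \<and> L \<subset> L')"

definition maximal_negative :: "'a::krein_space set \<Rightarrow> bool"
  where "maximal_negative L \<longleftrightarrow>
    negative_subspace L \<and> \<not> (\<exists>L'. negative_subspace L' \<and> L \<subset> L')"

definition J_orthogonal :: "'a::krein_space set \<Rightarrow> 'a set \<Rightarrow> bool"
  where "J_orthogonal L1 L2 \<longleftrightarrow> (\<forall>x\<in>L1. \<forall>y\<in>L2. kip x y = 0)"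

definition N_plus :: "(nat \<Rightarrow> 'a::krein_space) \<Rightarrow> nat set"
  where "N_plus f = {n. 0 \<le> Re (kip (f n) (f n))}"

definition N_minus :: "(nat \<Rightarrow> 'a::krein_space) \<Rightarrow> nat set"
  where "N_minus f = {n. Re (kip (f n) (f n)) < 0}"

definition M_plus :: "(nat \<Rightarrow> 'a::krein_space) \<Rightarrow> 'a set"
  where "M_plus f = closure (cspan (f ` N_plus f))"

definition M_minus :: "(nat \<Rightarrow> 'a::krein_space) \<Rightarrow> 'a set"
  where "M_minus f = closure (cspan (f ` N_minus f))"

text \<open>
  Summability is stated separately because \<^const>\<open>infsum\<close> is \<open>0\<close> for divergent sums.
\<close>

definition J_frame :: "(nat \<Rightarrow> 'a::krein_space) \<Rightarrow> real \<Rightarrow> real \<Rightarrow> bool"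
  where "J_frame f A B \<longleftrightarrow>
    0 < A \<and> A \<le> B \<and>
    maximal_positive (M_plus f) \<and> maximal_negative (M_minus f) \<and>
    (\<forall>x\<in>cspan (f ` N_plus f).
      (\<lambda>n. (cmod (kip x (f n)))\<^sup>2) summable_on N_plus f \<and>
      A * cmod (kip x x) \<le> (\<Sum>\<^sub>\<infinity>n\<in>N_plus f. (cmod (kip x (f n)))\<^sup>2) \<and>
      (\<Sum>\<^sub>\<infinity>n\<in>N_plus f. (cmod (kip x (f n)))\<^sup>2) \<le> B * cmod (kip x x)) \<and>
    (\<forall>x\<in>cspan (f ` N_minus f).
      (\<lambda>n. (cmod (kip x (f n)))\<^sup>2) summable_on N_minus f \<and>
      A * cmod (kip x x) \<le> (\<Sum>\<^sub>\<infinity>n\<in>N_minus f. (cmod (kip x (f n)))\<^sup>2) \<and>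
      (\<Sum>\<^sub>\<infinity>n\<in>N_minus f. (cmod (kip x (f n)))\<^sup>2) \<le> B * cmod (kip x x))"

definition hilbert_frame :: "(nat \<Rightarrow> 'a::krein_space) \<Rightarrow> real \<Rightarrow> real \<Rightarrow> bool"
  where "hilbert_frame g A B \<longleftrightarrow>
    0 < A \<and> A \<le> B \<and>
    (\<forall>x. (\<lambda>n. (cmod (hip x (g n)))\<^sup>2) summable_on UNIV \<and>
      A * (norm x)\<^sup>2 \<le> (\<Sum>\<^sub>\<infinity>n. (cmod (hip x (g n)))\<^sup>2) \<and>
      (\<Sum>\<^sub>\<infinity>n. (cmod (hip x (g n)))\<^sup>2) \<le> B * (norm x)\<^sup>2)"


text \<open>A possibly unbounded operator is a partial map, \<^const>\<open>dom\<close> being its domain.\<close>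

definition linear_operator :: "('a::krein_space \<rightharpoonup> 'a) \<Rightarrow> bool"
  where "linear_operator Q \<longleftrightarrow>
    csubspace (dom Q) \<and>
    (\<forall>x\<in>dom Q. \<forall>y\<in>dom Q. the (Q (x + y)) = the (Q x) + the (Q y)) \<and>
    (\<forall>c. \<forall>x\<in>dom Q. the (Q (c *\<^sub>C x)) = c *\<^sub>C the (Q x))"

text \<open>For densely defined \<open>Q\<close> the vector \<open>z\<close> below is unique.\<close>

definition adjoint_operator :: "('a::krein_space \<rightharpoonup> 'a) \<Rightarrow> ('a \<rightharpoonup> 'a)"
  where "adjoint_operator Q = (\<lambda>y.
    if \<exists>z. \<forall>x\<in>dom Q. hip (the (Q x)) y = hip x z
    then Some (THE z. \<forall>x\<in>dom Q. hip (the (Q x)) y = hip x z)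
    else None)"

definition self_adjoint_operator :: "('a::krein_space \<rightharpoonup> 'a) \<Rightarrow> bool"
  where "self_adjoint_operator Q \<longleftrightarrow>
    linear_operator Q \<and> closure (dom Q) = UNIV \<and> adjoint_operator Q = Q"

definition anticommutes_fund_sym :: "('a::krein_space \<rightharpoonup> 'a) \<Rightarrow> bool"
  where "anticommutes_fund_sym Q \<longleftrightarrow>
    fund_sym ` dom Q = dom Q \<and>
    (\<forall>x\<in>dom Q. fund_sym (the (Q x)) = - the (Q (fund_sym x)))"


text \<open>
  Spectral measures on the real line: strongly countably additive families of orthogonal
  projections with total mass the identity. (Multiplicativity on intersections follows.)
\<close>

definition orthogonal_projection :: "('a::krein_space \<Rightarrow> 'a) \<Rightarrow> bool"
  where "orthogonal_projection P \<longleftrightarrow>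
    Vector_Spaces.linear scaleC scaleC P \<and>
    (\<forall>x. P (P x) = P x) \<and> (\<forall>x y. hip (P x) y = hip x (P y))"

definition spectral_measure :: "(real set \<Rightarrow> 'a::krein_space \<Rightarrow> 'a) \<Rightarrow> bool"
  where "spectral_measure E \<longleftrightarrow>
    (\<forall>S\<in>sets borel. orthogonal_projection (E S)) \<and>
    (\<forall>x. E UNIV x = x) \<and>
    (\<forall>S x. range S \<subseteq> sets borel \<longrightarrow> disjoint_family S \<longrightarrow>
      (\<lambda>i::nat. E (S i) x) sums E (\<Union>i. S i) x)"

definition spectral_scalar_measure ::
    "(real set \<Rightarrow> 'a::krein_space \<Rightarrow> 'a) \<Rightarrow> 'a \<Rightarrow> real measure"
  where "spectral_scalar_measure E x =
    measure_of UNIV (sets borel) (\<lambda>S. ennreal (Re (hip (E S x) x)))"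

text \<open>
  The operator \<open>\<integral> \<phi> dE\<close> has domain \<open>{x. \<integral> |\<phi>|\<^sup>2 d(E x, x) < \<infinity>}\<close> and is determined by
  \<open>(\<integral> \<phi> dE x, z) = \<integral> \<phi> d(E x, z)\<close> for \<open>z\<close> in this (dense) domain, the integral against
  the complex measure \<open>(E x, z)\<close> being written out by polarization.
\<close>

definition spectral_domain ::
    "(real set \<Rightarrow> 'a::krein_space \<Rightarrow> 'a) \<Rightarrow> (real \<Rightarrow> real) \<Rightarrow> 'a set"
  where "spectral_domain E \<phi> = {x. integrable (spectral_scalar_measure E x) (\<lambda>t. (\<phi> t)\<^sup>2)}"

definition spectral_form ::
    "(real set \<Rightarrow> 'a::krein_space \<Rightarrow> 'a) \<Rightarrow> (real \<Rightarrow> real) \<Rightarrow> 'a \<Rightarrow> 'a \<Rightarrow> complex"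
  where "spectral_form E \<phi> x z =
    (let q = (\<lambda>u. complex_of_real (LINT t|spectral_scalar_measure E u. \<phi> t))
     in (q (x + z) - q (x - z) + \<i> * q (x + \<i> *\<^sub>C z) - \<i> * q (x - \<i> *\<^sub>C z)) / 4)"

definition spectral_integral ::
    "(real set \<Rightarrow> 'a::krein_space \<Rightarrow> 'a) \<Rightarrow> (real \<Rightarrow> real) \<Rightarrow> ('a \<rightharpoonup> 'a)"
  where "spectral_integral E \<phi> = (\<lambda>x.
    if x \<in> spectral_domain E \<phi>
    then Some (THE y. \<forall>z\<in>spectral_domain E \<phi>. hip y z = spectral_form E \<phi> x z)
    else None)"

text \<open>
  \<open>functional_calculus Q \<phi> R\<close> says \<open>R = \<phi>(Q)\<close>. By the spectral theorem a self-adjoint \<open>Q\<close>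
  has exactly one spectral measure, so \<open>R\<close> is uniquely determined by \<open>Q\<close> and \<open>\<phi>\<close>.
\<close>

definition functional_calculus ::
    "('a::krein_space \<rightharpoonup> 'a) \<Rightarrow> (real \<Rightarrow> real) \<Rightarrow> ('a \<rightharpoonup> 'a) \<Rightarrow> bool"
  where "functional_calculus Q \<phi> R \<longleftrightarrow>
    (\<exists>E. spectral_measure E \<and> Q = spectral_integral E (\<lambda>t. t) \<and> R = spectral_integral E \<phi>)"

end

theory Submission
  imports
    Defs
    "HOL-Probability.Probability"
    "HOL-Computational_Algebra.Polynomial"
    "HOL-Real_Asymp.Real_Asymp"
begin

text \<open>
  A maximal positive subspace is the graph of a contraction over the whole of \<open>krein_pos\<close>,
  since otherwise it could be enlarged by a vector of \<open>krein_pos\<close> orthogonal to its projection;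
  dually for maximal negative subspaces. By \<open>J\<close>-orthogonality the two contractions are adjoint to
  each other, so that the two subspaces are the images of \<open>krein_pos\<close> and \<open>krein_neg\<close> under
  \<open>2 S = I + T\<close>, where \<open>T\<close> is self-adjoint, anticommutes with \<open>J\<close>, and
  \<open>\<parallel>T x\<parallel> < \<parallel>x\<parallel>\<close> for \<open>x \<noteq> 0\<close>. Put \<open>Q = ln ((I - S) / S)\<close>. Since
  \<open>J S = (I - S) J\<close>, this \<open>Q\<close> anticommutes with \<open>J\<close>, and
  \<open>[2 S u, 2 S v] = (W J u, W v)\<close> for \<open>W = 2 (S (I - S))\<^sup>1\<^sup>/\<^sup>2 = exp (Q / 2) 2 S\<close>,
  which commutes with \<open>J\<close> and has dense range. Hence the two halves of the \<open>J\<close>-frame inequality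
  become frame inequalities on dense subspaces of \<open>krein_pos\<close> and \<open>krein_neg\<close>.

  The functional calculus of \<open>S\<close> comes from the measures \<open>mu x\<close> with moments \<open>(S\<^sup>n x, x)\<close>:
  these exist by the Hausdorff moment problem because \<open>S\<^sup>k (I - S)\<^sup>m\<close> is positive, polynomials are
  dense in \<open>L\<^sup>2 (mu x)\<close>, and \<open>p \<mapsto> p(S) x\<close> is an isometry there.
\<close>

section \<open>The Hausdorff moment problem\<close>

text \<open>The contraction \<open>T\<close> may have norm 1, so 0 and 1 can belong to the spectrum
  of \<open>S\<close>, and \<open>Q\<close> and \<open>exp (Q / 2)\<close> can be unbounded. Two
  facts compensate. Neither endpoint is an eigenvalue, so every \<open>mu x\<close> gives both
  points mass 0; hence the logarithm is finite almost everywhere and \<open>W\<close> has dense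
  range. And \<open>exp (Q / 2)\<close> is applied only to vectors \<open>2 S u\<close>, where the
  factor t cancels the singularity of sqrt ((1 - t) / t) at 0, which is why every frame vector lies
  in its domain. The shift from \<open>T\<close> to \<open>S\<close> moves the spectrum into [0, 1]
  and turns \<open>J\<close> into the reflection of t to 1 - t, under which the logarithm is odd and
  the weight of \<open>W\<close> even. The measure \<open>mu x\<close> is obtained separately for
  each x, so linearity in x is not visible from the construction. The remedy throughout is a single
  sequence of polynomials approximating a function in finitely many measures at once; identities
  between polynomials in \<open>S\<close> then pass to the limit. Unbounded functions are reached
  through truncations with uniformly bounded norms.\<close>

definition bernstein_poly :: "nat \<Rightarrow> nat \<Rightarrow> real poly"
  where "bernstein_poly n k = of_nat (n choose k) * [:0, 1:] ^ k * [:1, -1:] ^ (n - k)"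

text \<open>Pulling \<open>n choose j\<close> out of the product of binomials leaves the binomial
  expansion of (X + (1 - X)) ^ (n - j) = 1. Thus the Bernstein weights have exact factorial moments,
  whereas their power moments are right only in the limit.\<close>

lemma sum_bernstein_poly_choose:
  assumes "j \<le> n"
  shows "(\<Sum>k\<le>n. of_nat (k choose j) * bernstein_poly n k) = of_nat (n choose j) * [:0, 1:] ^ j"
proof -
  have "(\<Sum>k\<le>n. of_nat (k choose j) * bernstein_poly n k)
      = (\<Sum>k=j..n. of_nat (k choose j) * bernstein_poly n k)"
    by (rule sum.mono_neutral_right) (auto simp: not_le)
  also have "\<dots> = (\<Sum>i\<le>n - j. of_nat ((i + j) choose j) * bernstein_poly n (i + j))"
    by (rule sum.reindex_bij_witness[where i = "\<lambda>i. i + j" and j = "\<lambda>k. k - j"]) (use assms in auto)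
  also have "\<dots> = (\<Sum>i\<le>n - j. of_nat (n choose j) * [:0, 1:] ^ j *
      (of_nat (n - j choose i) * [:0, 1:] ^ i * [:1, -1:] ^ (n - j - i)))"
  proof (rule sum.cong)
    fix i assume "i \<in> {..n - j}"
    then have i: "i + j \<le> n" using assms by auto
    have "(n choose (i + j)) * ((i + j) choose j) = (n choose j) * (n - j choose i)"
      using choose_mult[of j "i + j" n] i by simp
    then have "(of_nat (n choose (i + j)) * of_nat ((i + j) choose j) :: real poly)
        = of_nat (n choose j) * of_nat (n - j choose i)"
      by (metis of_nat_mult)
    then have "of_nat (n choose (i + j)) * of_nat ((i + j) choose j) * z
        = of_nat (n choose j) * of_nat (n - j choose i) * z" for z :: "real poly"
      by simp
    from this[of "[:0, 1:] ^ (i + j) * [:1, -1:] ^ (n - (i + j))"]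
    show "of_nat ((i + j) choose j) * bernstein_poly n (i + j) = of_nat (n choose j) * [:0, 1:] ^ j *
      (of_nat (n - j choose i) * [:0, 1:] ^ i * [:1, -1:] ^ (n - j - i))"
      by (simp add: bernstein_poly_def power_add mult_ac add.commute)
  qed simp
  also have "\<dots> = of_nat (n choose j) * [:0, 1:] ^ j * ([:0, 1:] + [:1, -1:]) ^ (n - j)"
    unfolding binomial_ring by (simp add: sum_distrib_left)
  also have "[:0, 1:] + [:1, -1:] = (1 :: real poly)"
    by simp
  finally show ?thesis by simp
qed

text \<open>The passage from factorial to power moments. In the induction the old error is
  multiplied by k / n \<le> 1 and grows by at most j / n, because the product has modulus at most 1:
  its factors lie in [0, 1], or k < j and one of them vanishes. Then j^2 + j \<le> (j +
  1)^2.\<close>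

lemma prod_diff_close_power:
  fixes k n :: nat
  assumes "k \<le> n" "0 < n"
  shows "\<bar>(k / n) ^ j - (\<Prod>i<j. (real k - real i) / n)\<bar> \<le> (real j)\<^sup>2 / n"
proof (induction j)
  case (Suc j)
  define b where "b = (\<Prod>i<j. (real k - real i) / n)"
  have b: "\<bar>b\<bar> \<le> 1"
  proof (cases "j \<le> k")
    case True
    have "\<bar>b\<bar> = (\<Prod>i<j. \<bar>(real k - real i) / n\<bar>)"
      by (simp add: b_def abs_prod)
    also have "\<dots> \<le> (\<Prod>i<j. 1)"
      using True assms by (intro prod_mono) (auto simp: field_simps abs_if)
    finally show ?thesis by simp
  next
    case False
    then have "b = 0" unfolding b_def by (intro prod_zero) auto
    then show ?thesis by simp
  qed
  have "\<bar>(k / n) ^ Suc j - (\<Prod>i<Suc j. (real k - real i) / n)\<bar>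
      = \<bar>(k / n) * ((k / n) ^ j - b) + j / n * b\<bar>"
    by (simp add: b_def algebra_simps diff_divide_distrib)
  also have "\<dots> \<le> (k / n) * \<bar>(k / n) ^ j - b\<bar> + j / n * \<bar>b\<bar>"
    by (rule order.trans[OF abs_triangle_ineq]) (simp add: abs_mult)
  also have "\<dots> \<le> 1 * ((real j)\<^sup>2 / n) + j / n * 1"
    using Suc.IH b assms by (intro add_mono mult_mono) (auto simp: b_def)
  also have "\<dots> \<le> (real (Suc j))\<^sup>2 / n"
    using assms by (simp add: add_divide_distrib[symmetric] divide_right_mono power2_eq_square algebra_simps)
  finally show ?case .
qed simp

lemma prod_diff_eq_choose:
  "(\<Prod>i<j. (real k - real i) / n) = real (k choose j) * (fact j / real n ^ j)"
proof -
  have "(\<Prod>i<j. real k - real i) = fact j * real (k choose j)"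
    by (simp add: binomial_gbinomial gbinomial_mult_fact atLeast0LessThan)
  then show ?thesis
    by (simp add: prod_dividef)
qed

text \<open>
  The measures on \<open>{k / n | k \<le> n}\<close> with weights \<open>L (bernstein_poly n k)\<close> have the moments of
  \<open>L\<close> in the limit; Helly's theorem provides a limit measure.
\<close>

theorem hausdorff_moment_problem:
  fixes L :: "real poly \<Rightarrow> real"
  assumes add: "\<And>p q. L (p + q) = L p + L q"
    and smult: "\<And>c p. L (smult c p) = c * L p"
    and one: "L 1 = 1"
    and pos: "\<And>k m. 0 \<le> L ([:0, 1:] ^ k * [:1, -1:] ^ m)"
  obtains M :: "real measure" where "prob_space M" "sets M = sets borel" "AE t in M. 0 \<le> t \<and> t \<le> 1"
    "\<And>p. (LINT t|M. poly p t) = L p"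
proof -
  have zero: "L 0 = 0" using smult[of 0 0] by simp
  have L_sum: "L (sum p S) = (\<Sum>i\<in>S. L (p i))" if "finite S" for p and S :: "nat set"
    using that by (induction S) (auto simp: zero add)
  have L_of_nat: "L (of_nat m * p) = real m * L p" for m p
    using smult[of "real m" p] by (simp add: of_nat_poly)
  define w where "w n k = (if k \<le> n then L (bernstein_poly n k) else 0)" for n k
  have w_nonneg: "0 \<le> w n k" for n k
    using pos[of k "n - k"] by (simp add: w_def bernstein_poly_def mult.assoc L_of_nat)
  have w_choose: "(\<Sum>k\<le>n. real (k choose j) * w n k) = real (n choose j) * L ([:0, 1:] ^ j)"
    if "j \<le> n" for n j
    using arg_cong[OF sum_bernstein_poly_choose[OF that], of L]
    by (simp add: L_sum L_of_nat w_def)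
  have w_sum: "(\<Sum>k\<le>n. w n k) = 1" for n
    using w_choose[of 0 n] by (simp add: one)
  have w_total: "(\<integral>\<^sup>+k. ennreal (w n k) \<partial>count_space UNIV) = 1" for n
  proof -
    have "(\<integral>\<^sup>+k. ennreal (w n k) \<partial>count_space UNIV) = (\<Sum>k\<le>n. ennreal (w n k))"
      by (rule nn_integral_count_space') (auto simp: w_def)
    also have "\<dots> = 1" using w_nonneg by (simp add: sum_ennreal w_sum)
    finally show ?thesis .
  qed
  define P where "P n = embed_pmf (w n)" for n
  have pmf_P: "pmf (P n) k = w n k" for n k
    unfolding P_def using w_nonneg w_total by (intro pmf_embed_pmf) auto
  define N where "N n = distr (measure_pmf (P n)) borel (\<lambda>k. real k / real n)" for n
  interpret N: real_distribution "N n" for n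
    unfolding N_def real_distribution_def real_distribution_axioms_def
    by (auto intro!: measure_pmf.prob_space_distr)
  have int_N: "(LINT t|N n. h t) = (\<Sum>k\<le>n. h (k / n) * w n k)"
    if [measurable]: "h \<in> borel_measurable borel" for h :: "real \<Rightarrow> real" and n
  proof -
    have "(LINT t|N n. h t) = (LINT k|measure_pmf (P n). h (k / n))"
      unfolding N_def by (subst integral_distr) auto
    also have "\<dots> = (\<Sum>k\<le>n. h (k / n) * pmf (P n) k)"
      by (rule integral_measure_pmf_real) (auto simp: set_pmf_iff pmf_P w_def split: if_splits)
    finally show ?thesis by (simp add: pmf_P)
  qed
  have supp: "AE t in N n. t \<in> {0..1}" for n
    unfolding N_def by (subst AE_distr_iff)
      (auto simp: AE_measure_pmf_iff set_pmf_iff pmf_P w_def divide_le_eq_1 split: if_splits)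
  \<comment> \<open>All mass lies in [0, 1], so one half-open interval reaching to the left of 0
    serves every \<open>e\<close>.\<close>
  have "tight N"
    unfolding tight_def
  proof (intro conjI allI impI)
    fix e :: real assume "e > 0"
    have "measure (N n) {-1<..1} > 1 - e" for n
    proof -
      have "AE t in N n. t \<in> {-1<..1}" using supp[of n] by eventually_elim auto
      then have "measure (N n) {-1<..1} = 1" by (subst N.prob_eq_1) auto
      then show ?thesis using \<open>e > 0\<close> by simp
    qed
    then show "\<exists>a b. a < b \<and> (\<forall>n. measure (N n) {a<..b} > 1 - e)"
      by (intro exI[of _ "-1"] exI[of _ 1]) auto
  qed (rule N.real_distribution_axioms)
  from tight_imp_convergent_subsubsequence[OF this strict_mono_id] obtain r M
    where r: "strict_mono r" and M: "real_distribution M" and conv: "weak_conv_m (N \<circ> id \<circ> r) M"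
    by blast
  interpret M: real_distribution M by (rule M)
  \<comment> \<open>Clamping to [0, 1] makes powers bounded and continuous on the whole line, as
    weak convergence demands, and fixes all points k / n. The measure finally returned is the image
    of the limit under \<open>c\<close>, so it lives on [0, 1] by construction.\<close>
  define c :: "real \<Rightarrow> real" where "c t = max 0 (min 1 t)" for t
  have c_meas [measurable]: "c \<in> borel_measurable borel" unfolding c_def by measurable
  have moment: "(LINT t|M. c t ^ j) = L ([:0, 1:] ^ j)" for j
  proof -
    have "(\<lambda>n. LINT t|(N \<circ> id \<circ> r) n. c t ^ j) \<longlonglongrightarrow> (LINT t|M. c t ^ j)"
    proof (rule weak_conv_imp_integral_bdd_continuous_conv[OF _ _ conv, where B = 1])
      show "real_distribution ((N \<circ> id \<circ> r) n)" for n by (simp add: N.real_distribution_axioms)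
      show "norm (c x ^ j) \<le> 1" for x
        by (auto simp: c_def power_le_one)
      show "isCont (\<lambda>t. c t ^ j) x" for x
        unfolding c_def by (intro continuous_intros)
    qed (rule M)
    then have 1: "(\<lambda>n. LINT t|N (r n). c t ^ j) \<longlonglongrightarrow> (LINT t|M. c t ^ j)"
      by (simp add: comp_def)
    have 2: "(\<lambda>n. LINT t|N n. c t ^ j) \<longlonglongrightarrow> L ([:0, 1:] ^ j)"
    proof -
      \<comment> \<open>The j-th moment of \<open>N n\<close> with falling factorials in place of
        powers; its factor in front of \<open>L\<close> tends to 1.\<close>
      define F where "F n = (real (n choose j) * (fact j / real n ^ j)) * L ([:0, 1:] ^ j)" for n
      have F: "F n = (\<Sum>k\<le>n. (\<Prod>i<j. (real k - real i) / n) * w n k)" if "j \<le> n" for n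
      proof -
        have "(\<Sum>k\<le>n. (\<Prod>i<j. (real k - real i) / n) * w n k)
            = (fact j / real n ^ j) * (\<Sum>k\<le>n. real (k choose j) * w n k)"
          unfolding prod_diff_eq_choose sum_distrib_left by (intro sum.cong) auto
        then show ?thesis by (simp add: w_choose[OF that] F_def)
      qed
      \<comment> \<open>\<open>Suc j \<le> n\<close> provides both \<open>j \<le> n\<close>, for the
        formula for \<open>F\<close>, and \<open>0 < n\<close>, for the division.\<close>
      have diff: "\<bar>(LINT t|N n. c t ^ j) - F n\<bar> \<le> (real j)\<^sup>2 / n" if "Suc j \<le> n" for n
      proof -
        have "(LINT t|N n. c t ^ j) - F n
            = (\<Sum>k\<le>n. ((k / n) ^ j - (\<Prod>i<j. (real k - real i) / n)) * w n k)"
          using that by (subst int_N)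
            (auto simp: F sum_subtractf[symmetric] algebra_simps c_def intro!: sum.cong)
        also have "\<bar>\<dots>\<bar> \<le> (\<Sum>k\<le>n. \<bar>((k / n) ^ j - (\<Prod>i<j. (real k - real i) / n))\<bar> * w n k)"
          using w_nonneg by (intro order.trans[OF sum_abs]) (simp add: abs_mult)
        also have "\<dots> \<le> (\<Sum>k\<le>n. (real j)\<^sup>2 / n * w n k)"
          using that w_nonneg by (intro sum_mono mult_right_mono prod_diff_close_power) auto
        also have "\<dots> = (real j)\<^sup>2 / n"
          by (simp only: sum_distrib_left[symmetric] w_sum)
        finally show ?thesis .
      qed
      have F_lim: "F \<longlonglongrightarrow> L ([:0, 1:] ^ j)"
      proof -
        have "(\<lambda>n. (\<Prod>i<j. (real n - real i) / n)) \<longlonglongrightarrow> (\<Prod>i<j. 1)"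
          by (intro tendsto_prod) real_asymp
        from tendsto_mult_right[OF this, of "L ([:0, 1:] ^ j)"]
        show ?thesis by (simp add: F_def[abs_def] prod_diff_eq_choose)
      qed
      have "(\<lambda>n. (LINT t|N n. c t ^ j) - F n) \<longlonglongrightarrow> 0"
      proof (rule tendsto_rabs_zero_cancel, rule tendsto_sandwich[of "\<lambda>_. 0" _ _ "\<lambda>n. (real j)\<^sup>2 / real n"])
        show "\<forall>\<^sub>F n in sequentially. \<bar>(LINT t|N n. c t ^ j) - F n\<bar> \<le> (real j)\<^sup>2 / n"
          using eventually_ge_at_top[of "Suc j"] by eventually_elim (rule diff)
        show "(\<lambda>n. (real j)\<^sup>2 / real n) \<longlonglongrightarrow> 0" by real_asymp
      qed auto
      from tendsto_add[OF this F_lim] show ?thesis by simp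
    qed
    show ?thesis
      using LIMSEQ_unique[OF 1 LIMSEQ_subseq_LIMSEQ[OF 2 r, unfolded comp_def]] .
  qed
  have int_pow: "integrable M (\<lambda>t. c t ^ j)" for j
    by (rule M.integrable_const_bound[where B = 1]) (auto simp: c_def power_le_one)
  have poly: "integrable M (\<lambda>t. poly p (c t)) \<and> (LINT t|M. poly p (c t)) = L p" for p
  proof -
    have "p = (\<Sum>i\<le>degree p. smult (coeff p i) ([:0, 1:] ^ i))"
      by (subst poly_as_sum_of_monoms[symmetric]) (simp add: monom_altdef)
    then have "L p = (\<Sum>i\<le>degree p. coeff p i * L ([:0, 1:] ^ i))"
      using L_sum[of "{..degree p}"] smult by (metis (no_types, lifting) finite_atMost sum.cong)
    moreover have "(LINT t|M. poly p (c t)) = (\<Sum>i\<le>degree p. coeff p i * (LINT t|M. c t ^ i))"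
      unfolding poly_altdef by (subst Bochner_Integration.integral_sum) (auto intro: int_pow)
    moreover have "integrable M (\<lambda>t. poly p (c t))"
      unfolding poly_altdef
      by (intro Bochner_Integration.integrable_sum integrable_mult_right int_pow)
    ultimately show ?thesis by (simp add: moment)
  qed
  show thesis
  proof (rule that[of "distr M borel c"])
    show "prob_space (distr M borel c)" by (rule M.prob_space_distr) simp
    show "AE t in distr M borel c. 0 \<le> t \<and> t \<le> 1"
      by (subst AE_distr_iff) (auto simp: c_def)
    show "(LINT t|distr M borel c. poly p t) = L p" for p
      using poly[of p] by (subst integral_distr) (auto intro!: borel_measurable_continuous_onI continuous_intros)
  qed simp
qed

section \<open>Density of polynomials in square integrable functions\<close>

locale unit_interval_measure = finite_measure M for M :: "real measure" +
  assumes sets_borel [measurable_cong, simp]: "sets M = sets borel"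
    and AE_unit: "AE t in M. 0 \<le> t \<and> t \<le> 1"

definition square_integrable :: "real measure \<Rightarrow> (real \<Rightarrow> real) \<Rightarrow> bool"
  where "square_integrable M \<psi> \<longleftrightarrow> \<psi> \<in> borel_measurable borel \<and> integrable M (\<lambda>t. (\<psi> t)\<^sup>2)"

text \<open>Large values become 0 instead of being clipped, so that the truncation is
  \<open>\<psi>\<close> times an indicator; cutting off the function is then the same as cutting off
  the vector by a spectral projection.\<close>

definition truncate :: "nat \<Rightarrow> (real \<Rightarrow> real) \<Rightarrow> real \<Rightarrow> real"
  where "truncate k \<psi> t = (if \<bar>\<psi> t\<bar> \<le> real k then \<psi> t else 0)"

lemma borel_measurable_poly [measurable]: "poly (p :: real poly) \<in> borel_measurable borel"
  by (intro borel_measurable_continuous_onI continuous_intros)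

lemma borel_measurable_truncate [measurable (raw)]:
  assumes [measurable]: "\<psi> \<in> borel_measurable borel"
  shows "truncate k \<psi> \<in> borel_measurable borel"
  unfolding truncate_def[abs_def] by measurable

lemma truncate_abs_le: "\<bar>truncate k \<psi> t\<bar> \<le> \<bar>\<psi> t\<bar>"
  by (simp add: truncate_def)

lemma poly_bounded_unit: "\<exists>C>0. \<forall>t\<in>{0..1}. \<bar>poly (p :: real poly) t\<bar> \<le> C"
proof -
  have "compact (poly p ` {0..1})"
    by (intro compact_continuous_image continuous_intros) auto
  then obtain C where "\<forall>y\<in>poly p ` {0..1}. norm y \<le> C"
    using compact_imp_bounded bounded_iff by blast
  then show ?thesis
    by (intro exI[of _ "max C 1"]) (auto intro: le_max_iff_disj[THEN iffD2])
qed

lemma square_add_le: "(a + b)\<^sup>2 \<le> 2 * a\<^sup>2 + 2 * (b :: real)\<^sup>2"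
  using sum_squares_bound[of a b] by (simp add: power2_sum)

context unit_interval_measure
begin

lemma space_eq_UNIV [simp]: "space M = UNIV"
  using sets_eq_imp_space_eq[OF sets_borel] by simp

lemma borel_measurable_eq [simp]: "borel_measurable M = borel_measurable borel"
  by (rule measurable_cong_sets) auto

lemma square_integrableD [measurable_dest]:
  "square_integrable M \<psi> \<Longrightarrow> \<psi> \<in> borel_measurable borel"
  by (simp add: square_integrable_def)

lemma square_integrable_imp_integrable_square:
  "square_integrable M \<psi> \<Longrightarrow> integrable M (\<lambda>t. (\<psi> t)\<^sup>2)"
  by (simp add: square_integrable_def)

lemma square_integrable_mono:
  assumes "square_integrable M \<phi>" "\<psi> \<in> borel_measurable borel"
    and "\<And>t. 0 \<le> t \<Longrightarrow> t \<le> 1 \<Longrightarrow> \<bar>\<psi> t\<bar> \<le> \<bar>\<phi> t\<bar>"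
  shows "square_integrable M \<psi>"
  unfolding square_integrable_def
proof
  show "integrable M (\<lambda>t. (\<psi> t)\<^sup>2)"
  proof (rule Bochner_Integration.integrable_bound)
    show "integrable M (\<lambda>t. (\<phi> t)\<^sup>2)"
      using assms(1) by (simp add: square_integrable_def)
    show "AE t in M. norm ((\<psi> t)\<^sup>2) \<le> norm ((\<phi> t)\<^sup>2)"
      using AE_unit by eventually_elim (use assms(3) in \<open>auto simp: abs_le_square_iff\<close>)
  qed (use assms(2) in simp)
qed fact

lemma square_integrable_bounded:
  assumes "\<psi> \<in> borel_measurable borel" "\<And>t. 0 \<le> t \<Longrightarrow> t \<le> 1 \<Longrightarrow> \<bar>\<psi> t\<bar> \<le> C"
  shows "square_integrable M \<psi>"
proof (rule square_integrable_mono[of "\<lambda>_. C"])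
  show "\<bar>\<psi> t\<bar> \<le> \<bar>C\<bar>" if "0 \<le> t" "t \<le> 1" for t
    using assms(2)[OF that] by linarith
qed (use assms(1) in \<open>auto simp: square_integrable_def\<close>)

lemma square_integrable_poly [simp]: "square_integrable M (poly p)"
proof -
  obtain C where "\<forall>t\<in>{0..1}. \<bar>poly p t\<bar> \<le> C" using poly_bounded_unit by blast
  then show ?thesis by (intro square_integrable_bounded[of _ C]) auto
qed

lemma square_integrable_indicator [simp]:
  "S \<in> sets borel \<Longrightarrow> square_integrable M (indicator S)"
  by (rule square_integrable_bounded[of _ 1]) (auto simp: indicator_def)

lemma square_integrable_truncate [simp]:
  "\<psi> \<in> borel_measurable borel \<Longrightarrow> square_integrable M (truncate k \<psi>)"
  by (rule square_integrable_bounded[of _ k]) (auto simp: truncate_def)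

lemma square_integrable_add [simp]:
  assumes "square_integrable M \<phi>" "square_integrable M \<psi>"
  shows "square_integrable M (\<lambda>t. \<phi> t + \<psi> t)"
proof -
  have "integrable M (\<lambda>t. (\<phi> t + \<psi> t)\<^sup>2)"
    by (rule Bochner_Integration.integrable_bound[of _ "\<lambda>t. 2 * (\<phi> t)\<^sup>2 + 2 * (\<psi> t)\<^sup>2"])
       (use assms in \<open>auto simp: square_integrable_def square_add_le\<close>)
  then show ?thesis
    using assms by (auto simp: square_integrable_def)
qed

lemma square_integrable_cmult [simp]:
  "square_integrable M \<psi> \<Longrightarrow> square_integrable M (\<lambda>t. c * \<psi> t)"
  by (auto simp: square_integrable_def power_mult_distrib)

lemma square_integrable_diff [simp]:
  "square_integrable M \<phi> \<Longrightarrow> square_integrable M \<psi> \<Longrightarrow> square_integrable M (\<lambda>t. \<phi> t - \<psi> t)"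
  using square_integrable_add[of \<phi> "\<lambda>t. -1 * \<psi> t"] square_integrable_cmult[of \<psi> "-1"] by simp

lemma square_integrable_mult_bounded:
  assumes "square_integrable M \<phi>" "\<psi> \<in> borel_measurable borel"
    and "\<And>t. 0 \<le> t \<Longrightarrow> t \<le> 1 \<Longrightarrow> \<bar>\<psi> t\<bar> \<le> C"
  shows "square_integrable M (\<lambda>t. \<psi> t * \<phi> t)"
proof (rule square_integrable_mono)
  show "square_integrable M (\<lambda>t. C * \<phi> t)" using assms(1) by simp
  show "(\<lambda>t. \<psi> t * \<phi> t) \<in> borel_measurable borel" using assms by auto
  show "\<bar>\<psi> t * \<phi> t\<bar> \<le> \<bar>C * \<phi> t\<bar>" if "0 \<le> t" "t \<le> 1" for t
    using assms(3)[OF that] by (auto simp: abs_mult intro: mult_right_mono)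
qed

lemma square_integrable_poly_mult [simp]:
  assumes "square_integrable M \<phi>"
  shows "square_integrable M (\<lambda>t. poly p t * \<phi> t)"
proof -
  obtain C where "\<forall>t\<in>{0..1}. \<bar>poly p t\<bar> \<le> C" using poly_bounded_unit by blast
  then show ?thesis using assms by (intro square_integrable_mult_bounded[of _ _ C]) auto
qed

lemma integral_square_diff_triangle:
  assumes "square_integrable M \<phi>" "square_integrable M \<psi>" "square_integrable M \<eta>"
  shows "(LINT t|M. (\<phi> t - \<eta> t)\<^sup>2) \<le> 2 * (LINT t|M. (\<phi> t - \<psi> t)\<^sup>2) + 2 * (LINT t|M. (\<psi> t - \<eta> t)\<^sup>2)"
proof -
  note [simp] = square_integrable_imp_integrable_square square_integrable_diff
  have "(LINT t|M. (\<phi> t - \<eta> t)\<^sup>2) \<le> (LINT t|M. 2 * (\<phi> t - \<psi> t)\<^sup>2 + 2 * (\<psi> t - \<eta> t)\<^sup>2)"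
    using assms square_add_le[of "\<phi> t - \<psi> t" "\<psi> t - \<eta> t" for t]
    by (intro integral_mono) simp_all
  then show ?thesis using assms by simp
qed

text \<open>Monotone convergence of the squared truncations. This is how unbounded functions are
  shown to be square integrable, since only bounded functions can be treated directly.\<close>

lemma square_integrable_truncate_limit:
  assumes [measurable]: "\<psi> \<in> borel_measurable borel"
    and bound: "\<And>k. (LINT t|M. (truncate k \<psi> t)\<^sup>2) \<le> C"
  shows "square_integrable M \<psi>"
proof -
  have int: "integrable M (\<lambda>t. (truncate k \<psi> t)\<^sup>2)" for k
    by (simp add: square_integrable_imp_integrable_square)
  have mono: "(truncate k \<psi> t)\<^sup>2 \<le> (truncate l \<psi> t)\<^sup>2" if "k \<le> l" for k l t
    using that by (auto simp: truncate_def)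
  have "incseq (\<lambda>k. LINT t|M. (truncate k \<psi> t)\<^sup>2)"
    using mono by (auto intro!: incseq_SucI integral_mono int)
  then obtain L where "(\<lambda>k. LINT t|M. (truncate k \<psi> t)\<^sup>2) \<longlonglongrightarrow> L"
    using incseq_convergent[of "\<lambda>k. LINT t|M. (truncate k \<psi> t)\<^sup>2" C] bound by metis
  moreover have "(\<lambda>k. (truncate k \<psi> t)\<^sup>2) \<longlonglongrightarrow> (\<psi> t)\<^sup>2" for t
  proof (rule tendsto_eventually)
    obtain N where N: "\<bar>\<psi> t\<bar> \<le> real N" using real_arch_simple by blast
    show "\<forall>\<^sub>F k in sequentially. (truncate k \<psi> t)\<^sup>2 = (\<psi> t)\<^sup>2"
      using eventually_ge_at_top[of N] by eventually_elim (use N in \<open>auto simp: truncate_def\<close>)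
  qed
  ultimately have "integrable M (\<lambda>t. (\<psi> t)\<^sup>2)"
    using mono by (intro integral_monotone_convergence_nonneg(1)[of M "\<lambda>k t. (truncate k \<psi> t)\<^sup>2", OF int])
      (auto simp: mono_def)
  then show ?thesis by (simp add: square_integrable_def)
qed

text \<open>Dominated convergence: the limit inherits the bound \<open>w\<close>, so the differences
  are at most \<open>2 * w\<close>.\<close>

lemma integral_square_diff_tendsto_0:
  assumes [measurable]: "\<psi> \<in> borel_measurable borel" "\<And>n. \<phi> n \<in> borel_measurable borel"
    and w: "square_integrable M w" and le: "\<And>n t. \<bar>\<phi> n t\<bar> \<le> w t"
    and lim: "\<And>t. 0 \<le> t \<Longrightarrow> t \<le> 1 \<Longrightarrow> (\<lambda>n. \<phi> n t) \<longlonglongrightarrow> \<psi> t"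
  shows "(\<lambda>n. LINT t|M. (\<phi> n t - \<psi> t)\<^sup>2) \<longlonglongrightarrow> 0"
proof -
  have [measurable]: "w \<in> borel_measurable borel" using w by (simp add: square_integrable_def)
  have "(\<lambda>n. LINT t|M. (\<phi> n t - \<psi> t)\<^sup>2) \<longlonglongrightarrow> (LINT t|M. 0)"
  proof (rule integral_dominated_convergence[where w = "\<lambda>t. (2 * w t)\<^sup>2"])
    show "integrable M (\<lambda>t. (2 * w t)\<^sup>2)"
      using w by (simp add: power_mult_distrib square_integrable_imp_integrable_square)
    show "AE t in M. (\<lambda>n. (\<phi> n t - \<psi> t)\<^sup>2) \<longlonglongrightarrow> 0"
      using AE_unit
    proof eventually_elim
      case (elim t)
      then have "(\<lambda>n. (\<phi> n t - \<psi> t)\<^sup>2) \<longlonglongrightarrow> (\<psi> t - \<psi> t)\<^sup>2"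
        by (intro tendsto_intros lim) auto
      then show ?case by simp
    qed
    show "AE t in M. norm ((\<phi> n t - \<psi> t)\<^sup>2) \<le> (2 * w t)\<^sup>2" for n
      using AE_unit
    proof eventually_elim
      case (elim t)
      have "(\<lambda>n. \<bar>\<phi> n t\<bar>) \<longlonglongrightarrow> \<bar>\<psi> t\<bar>"
        using elim by (intro tendsto_rabs lim) auto
      then have "\<bar>\<psi> t\<bar> \<le> w t" by (rule LIMSEQ_le_const2) (use le in auto)
      then have "\<bar>\<phi> n t - \<psi> t\<bar> \<le> \<bar>2 * w t\<bar>" using le[of n t] by linarith
      then show ?case by (simp add: abs_le_square_iff del: abs_mult)
    qed
  qed simp_all
  then show ?thesis by simp
qed

end

text \<open>One polynomial has to serve several measures at once, because the calculus will compare
  the measures of x, y and x + y, or of a vector and its image. The class of approximable functions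
  is closed under sums, multiples and dominated limits. It contains continuous functions with values
  in [-1, 1] by Stone-Weierstrass, half-lines as limits of ramps, Borel sets by Dynkin's argument,
  nonnegative functions by monotone limits, and finally differences of those.\<close>

theorem poly_dense_square_integrable:
  fixes M :: "'i \<Rightarrow> real measure"
  assumes fin: "finite X" and meas: "\<And>i. i \<in> X \<Longrightarrow> unit_interval_measure (M i)"
    and sq: "\<And>i. i \<in> X \<Longrightarrow> square_integrable (M i) \<psi>"
    and \<psi>_meas: "\<psi> \<in> borel_measurable borel" and "0 < e"
  shows "\<exists>p. \<forall>i\<in>X. (LINT t|M i. (poly p t - \<psi> t)\<^sup>2) < e"
proof -
  define sqi where "sqi \<phi> \<longleftrightarrow> \<phi> \<in> borel_measurable borel \<and> (\<forall>i\<in>X. square_integrable (M i) \<phi>)" for \<phi>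
  define apx where
    "apx \<phi> \<longleftrightarrow> sqi \<phi> \<and> (\<forall>e>0. \<exists>p. \<forall>i\<in>X. (LINT t|M i. (poly p t - \<phi> t)\<^sup>2) < e)" for \<phi>
  note M = unit_interval_measure.square_integrable_poly[OF meas]
    unit_interval_measure.square_integrable_add[OF meas]
    unit_interval_measure.square_integrable_diff[OF meas]
    unit_interval_measure.square_integrable_cmult[OF meas]
  have apx_lim: "apx \<phi>" if \<phi>: "sqi \<phi>"
    and lim: "\<And>e. e > 0 \<Longrightarrow> \<exists>\<eta>. apx \<eta> \<and> (\<forall>i\<in>X. (LINT t|M i. (\<eta> t - \<phi> t)\<^sup>2) < e)" for \<phi>
    unfolding apx_def
  proof (intro conjI allI impI)
    fix e :: real assume "e > 0"
    then obtain \<eta> where \<eta>: "apx \<eta>" "\<forall>i\<in>X. (LINT t|M i. (\<eta> t - \<phi> t)\<^sup>2) < e / 4"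
      using lim[of "e / 4"] by auto
    obtain p where p: "\<forall>i\<in>X. (LINT t|M i. (poly p t - \<eta> t)\<^sup>2) < e / 4"
      using \<eta>(1) \<open>e > 0\<close> unfolding apx_def by (metis zero_less_divide_iff zero_less_numeral)
    have "(LINT t|M i. (poly p t - \<phi> t)\<^sup>2) < e" if "i \<in> X" for i
      using unit_interval_measure.integral_square_diff_triangle[OF meas[OF that], of "poly p" \<eta> \<phi>]
        \<phi> \<eta> p that M(1)[OF that, of p] unfolding apx_def sqi_def by fastforce
    then show "\<exists>p. \<forall>i\<in>X. (LINT t|M i. (poly p t - \<phi> t)\<^sup>2) < e" by blast
  qed fact
  have apx_seq: "apx \<phi>" if \<phi>: "sqi \<phi>" and w: "sqi w"
    and \<eta>: "\<And>n. apx (\<eta> n)" "\<And>n t. \<bar>\<eta> n t\<bar> \<le> w t" "\<And>t. (\<lambda>n. \<eta> n t) \<longlonglongrightarrow> \<phi> t" for \<phi> w \<eta>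
  proof (rule apx_lim[OF \<phi>])
    fix e :: real assume "e > 0"
    have "\<forall>\<^sub>F n in sequentially. \<forall>i\<in>X. (LINT t|M i. (\<eta> n t - \<phi> t)\<^sup>2) < e"
    proof (intro eventually_ball_finite fin ballI)
      fix i assume "i \<in> X"
      have "(\<lambda>n. LINT t|M i. (\<eta> n t - \<phi> t)\<^sup>2) \<longlonglongrightarrow> 0"
        by (rule unit_interval_measure.integral_square_diff_tendsto_0[OF meas[OF \<open>i \<in> X\<close>], of _ _ w])
           (use \<phi> w \<eta> \<open>i \<in> X\<close> in \<open>auto simp: sqi_def apx_def\<close>)
      then show "\<forall>\<^sub>F n in sequentially. (LINT t|M i. (\<eta> n t - \<phi> t)\<^sup>2) < e"
        using \<open>e > 0\<close> by (rule order_tendstoD)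
    qed
    then obtain n where "\<forall>i\<in>X. (LINT t|M i. (\<eta> n t - \<phi> t)\<^sup>2) < e"
      using eventually_happens trivial_limit_sequentially by blast
    then show "\<exists>\<eta>. apx \<eta> \<and> (\<forall>i\<in>X. (LINT t|M i. (\<eta> t - \<phi> t)\<^sup>2) < e)"
      using \<eta>(1) by blast
  qed
  have apx_add: "apx (\<lambda>t. \<phi> t + \<eta> t)" if "apx \<phi>" "apx \<eta>" for \<phi> \<eta>
    unfolding apx_def
  proof (intro conjI allI impI)
    show "sqi (\<lambda>t. \<phi> t + \<eta> t)" using that by (auto simp: apx_def sqi_def M)
    fix e :: real assume "e > 0"
    then have "e / 4 > 0" by simp
    with that obtain p q where pq: "\<forall>i\<in>X. (LINT t|M i. (poly p t - \<phi> t)\<^sup>2) < e / 4"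
      "\<forall>i\<in>X. (LINT t|M i. (poly q t - \<eta> t)\<^sup>2) < e / 4"
      unfolding apx_def by metis
    have "(LINT t|M i. (poly (p + q) t - (\<phi> t + \<eta> t))\<^sup>2) < e" if "i \<in> X" for i
    proof -
      interpret unit_interval_measure "M i" by (rule meas[OF that])
      have "(LINT t|M i. ((poly p t + poly q t) - (\<phi> t + \<eta> t))\<^sup>2)
          \<le> 2 * (LINT t|M i. ((poly p t + poly q t) - (\<phi> t + poly q t))\<^sup>2)
            + 2 * (LINT t|M i. ((\<phi> t + poly q t) - (\<phi> t + \<eta> t))\<^sup>2)"
        by (rule integral_square_diff_triangle)
           (use \<open>apx \<phi>\<close> \<open>apx \<eta>\<close> that in \<open>auto simp: apx_def sqi_def\<close>)
      then show ?thesis using pq that by fastforce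
    qed
    then show "\<exists>p. \<forall>i\<in>X. (LINT t|M i. (poly p t - (\<phi> t + \<eta> t))\<^sup>2) < e" by blast
  qed
  have apx_cmult: "apx (\<lambda>t. c * \<phi> t)" if "apx \<phi>" for c \<phi>
    unfolding apx_def
  proof (intro conjI allI impI)
    show "sqi (\<lambda>t. c * \<phi> t)" using that by (auto simp: apx_def sqi_def M)
    fix e :: real assume "e > 0"
    \<comment> \<open>The summand 1 keeps the tolerance meaningful for \<open>c = 0\<close>.\<close>
    then have "e / (c\<^sup>2 + 1) > 0" by (simp add: add_nonneg_pos)
    with that obtain p where p: "\<forall>i\<in>X. (LINT t|M i. (poly p t - \<phi> t)\<^sup>2) < e / (c\<^sup>2 + 1)"
      unfolding apx_def by metis
    have "(LINT t|M i. (poly (smult c p) t - c * \<phi> t)\<^sup>2) < e" if "i \<in> X" for i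
    proof -
      have "(LINT t|M i. (poly (smult c p) t - c * \<phi> t)\<^sup>2)
          = c\<^sup>2 * (LINT t|M i. (poly p t - \<phi> t)\<^sup>2)"
        by (simp add: right_diff_distrib[symmetric] power_mult_distrib)
      also have "\<dots> \<le> c\<^sup>2 * (e / (c\<^sup>2 + 1))"
        using p that by (intro mult_left_mono) (auto intro: less_imp_le)
      also have "\<dots> < e"
      proof -
        have "0 < c\<^sup>2 + 1" by (simp add: add_nonneg_pos)
        moreover have "c\<^sup>2 * e < e * (c\<^sup>2 + 1)" using \<open>e > 0\<close> by (simp add: algebra_simps)
        ultimately show ?thesis using pos_divide_less_eq[of "c\<^sup>2 + 1" "c\<^sup>2 * e" e] by simp
      qed
      finally show ?thesis .
    qed
    then show "\<exists>p. \<forall>i\<in>X. (LINT t|M i. (poly p t - c * \<phi> t)\<^sup>2) < e" by blast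
  qed
  have sqi_bounded: "sqi \<phi>" if "\<phi> \<in> borel_measurable borel" "\<And>t. \<bar>\<phi> t\<bar> \<le> 1" for \<phi>
    unfolding sqi_def using that
    by (auto intro: unit_interval_measure.square_integrable_bounded[OF meas, of _ _ 1])
  have apx_cont: "apx \<phi>" if cont: "continuous_on UNIV \<phi>" and "\<And>t. \<bar>\<phi> t\<bar> \<le> 1" for \<phi>
    unfolding apx_def
  proof (intro conjI allI impI)
    show "sqi \<phi>" using that by (intro sqi_bounded borel_measurable_continuous_onI)
    fix e :: real assume "e > 0"
    \<comment> \<open>\<open>C\<close> exceeds the total mass of each measure, so a uniform error of
      sqrt (e / C) on [0, 1] gives a squared error below \<open>e\<close> in all of them.\<close>
    define C where "C = (\<Sum>i\<in>X. measure (M i) UNIV) + 1"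
    have C: "measure (M i) UNIV < C" if "i \<in> X" for i
      using member_le_sum[OF that, of "\<lambda>i. measure (M i) UNIV"] fin unfolding C_def by auto
    have "C > 0" unfolding C_def by (intro add_nonneg_pos sum_nonneg) auto
    then have "sqrt (e / C) > 0" using \<open>e > 0\<close> by simp
    moreover have "continuous_on {0..1} \<phi>" using cont continuous_on_subset by blast
    ultimately obtain g where g: "real_polynomial_function g"
      "\<And>t. t \<in> {0..1} \<Longrightarrow> \<bar>\<phi> t - g t\<bar> < sqrt (e / C)"
      using Stone_Weierstrass_real_polynomial_function[of "{0..1::real}" \<phi>] by (metis compact_Icc)
    obtain a n where a: "g = (\<lambda>x. \<Sum>i\<le>n. a i * x ^ i)"
      using g(1) real_polynomial_function_iff_sum by blast
    define p where "p = (\<Sum>i\<le>n. monom (a i) i)"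
    have p: "poly p = g" by (simp add: p_def a poly_sum poly_monom fun_eq_iff)
    have "(LINT t|M i. (poly p t - \<phi> t)\<^sup>2) < e" if "i \<in> X" for i
    proof -
      interpret unit_interval_measure "M i" by (rule meas[OF that])
      have "(LINT t|M i. (poly p t - \<phi> t)\<^sup>2) \<le> (LINT t|M i. e / C)"
      proof (rule integral_mono_AE)
        show "integrable (M i) (\<lambda>t. (poly p t - \<phi> t)\<^sup>2)"
          using \<open>sqi \<phi>\<close> that by (intro square_integrable_imp_integrable_square) (auto simp: sqi_def)
        show "AE t in M i. (poly p t - \<phi> t)\<^sup>2 \<le> e / C"
          using AE_unit
        proof eventually_elim
          case (elim t)
          then have "\<bar>poly p t - \<phi> t\<bar> \<le> sqrt (e / C)" using g(2)[of t] p by (auto simp: abs_minus_commute)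
          then show ?case
            using \<open>e > 0\<close> \<open>C > 0\<close> by (metis abs_ge_zero divide_nonneg_nonneg less_imp_le power2_abs power_mono real_sqrt_pow2)
        qed
      qed simp
      also have "\<dots> = measure (M i) UNIV * (e / C)"
        by simp
      also have "\<dots> < C * (e / C)"
        using C[OF that] \<open>e > 0\<close> \<open>C > 0\<close> by (intro mult_strict_right_mono) auto
      finally show ?thesis using \<open>C > 0\<close> by simp
    qed
    then show "\<exists>p. \<forall>i\<in>X. (LINT t|M i. (poly p t - \<phi> t)\<^sup>2) < e" by blast
  qed
  have borel_atMost: "sigma_sets UNIV (range (\<lambda>a::real. {..a})) = sets borel"
    by (metis borel_eq_atMost sets_measure_of subset_UNIV Pow_UNIV)
  have stable: "Int_stable (range (\<lambda>a::real. {..a}))"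
    by (auto simp: Int_stable_def)
  have sub: "range (\<lambda>a::real. {..a}) \<subseteq> Pow UNIV" by simp
  have apx_indicator: "apx (indicator S)" if "S \<in> sets borel" for S
    using stable sub that[folded borel_atMost]
  proof (induction rule: sigma_sets_induct_disjoint)
    case (basic A)
    then obtain a where A: "A = {..a}" by auto
    have one: "sqi (\<lambda>_. 1)" by (rule sqi_bounded) auto
    have ind: "sqi (indicator A)" by (rule sqi_bounded) (auto simp: A indicator_def)
    show ?case
    proof (rule apx_seq[OF ind one])
      fix n t
      \<comment> \<open>For n > 0 a continuous ramp equal to 1 up to \<open>a\<close> and falling to
        0 over the length 1 / n.\<close>
      show "apx (\<lambda>t. max 0 (min 1 (1 - real n * (t - a))))"
        by (rule apx_cont) (auto intro!: continuous_intros)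
      show "\<bar>max 0 (min 1 (1 - real n * (t - a)))\<bar> \<le> 1" by auto
      show "(\<lambda>n. max 0 (min 1 (1 - real n * (t - a)))) \<longlonglongrightarrow> indicator A t"
      proof (cases "t \<le> a")
        case True
        then have "max 0 (min 1 (1 - real n * (t - a))) = 1" for n
          using mult_nonneg_nonpos[of "real n" "t - a"] by auto
        then show ?thesis using True by (simp add: A)
      next
        case False
        obtain N where N: "1 / (t - a) \<le> real N" using real_arch_simple by blast
        have "\<forall>\<^sub>F n in sequentially. max 0 (min 1 (1 - real n * (t - a))) = 0"
          using eventually_ge_at_top[of N]
        proof eventually_elim
          case (elim n)
          then have "1 / (t - a) \<le> real n" using N by linarith
          then have "1 \<le> real n * (t - a)" using False by (simp add: divide_le_eq)
          then show ?case by auto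
        qed
        then show ?thesis using False by (simp add: A tendsto_eventually)
      qed
    qed
  next
    case empty
    show ?case using apx_cont[of "\<lambda>_. 0"] by (simp add: indicator_def[abs_def])
  next
    case (compl A)
    have "apx (\<lambda>_. 1)" by (rule apx_cont) auto
    from apx_add[OF this apx_cmult[OF compl(2), of "-1"]]
    show ?case by (simp add: indicator_compl[abs_def] indicator_diff[abs_def])
  next
    case (union A)
    have A: "A i \<in> sets borel" for i using union(2) borel_atMost by auto
    have one: "sqi (\<lambda>_. 1)" by (rule sqi_bounded) auto
    have ind: "sqi (indicator (\<Union>i. A i))"
      by (rule sqi_bounded) (use A in \<open>auto simp: indicator_def\<close>)
    have part: "indicator (\<Union>i<n. A i) = (\<lambda>t. \<Sum>i<n. indicator (A i) t :: real)" for n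
      using indicator_UN_disjoint[of "{..<n}" A] union(1)
      by (auto simp: disjoint_family_on_def fun_eq_iff)
    show ?case
    proof (rule apx_seq[OF ind one])
      fix n t
      have "apx (\<lambda>t. \<Sum>i<n. indicator (A i) t)"
      proof (induction n)
        case 0 show ?case using apx_cont[of "\<lambda>_. 0"] by simp
      next
        case (Suc n) then show ?case using apx_add[OF Suc union(3)[of n]] by simp
      qed
      then show "apx (indicator (\<Union>i<n. A i))" by (simp add: part)
      show "\<bar>indicator (\<Union>i<n. A i) t\<bar> \<le> (1::real)" by (auto simp: indicator_def)
      show "(\<lambda>n. indicator (\<Union>i<n. A i) t :: real) \<longlonglongrightarrow> indicator (\<Union>i. A i) t"
        by (rule LIMSEQ_indicator_UN)
    qed
  qed
  have apx_nonneg: "apx \<phi>" if "\<phi> \<in> borel_measurable borel" "\<And>t. 0 \<le> \<phi> t" "sqi \<phi>" for \<phi>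
    using that
  proof (induction rule: borel_measurable_induct_real)
    case (set A)
    then show ?case using apx_indicator by simp
  next
    case (mult u c)
    \<comment> \<open>Square integrability of \<open>u\<close> can be recovered from that of
      \<open>c * u\<close> only when c is nonzero; otherwise the product is the zero
      function.\<close>
    have "apx u" if "c \<noteq> 0"
    proof (rule mult.IH)
      have "square_integrable (M i) (\<lambda>t. (1 / c) * (c * u t))" if "i \<in> X" for i
        using M(4)[OF that, of "\<lambda>t. c * u t" "1 / c"] mult.prems that by (auto simp: sqi_def)
      then show "sqi u" using \<open>c \<noteq> 0\<close> mult.hyps by (simp add: sqi_def)
    qed
    then show ?case using apx_cmult apx_cont[of "\<lambda>_. 0"] by (cases "c = 0") auto
  next
    case (add u v)
    have "square_integrable (M i) u \<and> square_integrable (M i) v" if "i \<in> X" for i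
      using unit_interval_measure.square_integrable_mono[OF meas[OF that], of "\<lambda>x. v x + u x"]
        add.prems add.hyps that by (auto simp: sqi_def)
    then have "apx u" "apx v" using add by (auto simp: sqi_def)
    then show ?case using apx_add by simp
  next
    case (seq U)
    have le: "U i t \<le> \<phi> t" for i t
      using seq.hyps(3,4) by (intro incseq_le) (auto simp: incseq_def le_fun_def)
    have "sqi (U n)" for n
    proof -
      have "\<bar>U n t\<bar> \<le> \<bar>\<phi> t\<bar>" for t using le[of n t] seq.hyps(2)[of n t] by linarith
      then show ?thesis
        using unit_interval_measure.square_integrable_mono[OF meas, of _ \<phi> "U n"]
          seq.prems seq.hyps(1) by (auto simp: sqi_def)
    qed
    then have "apx (U n)" for n using seq.IH by simp
    then show ?case
      by (rule apx_seq[OF seq.prems seq.prems]) (use seq.hyps le in auto)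
  qed
  have sqi: "sqi \<psi>" using sq \<psi>_meas by (simp add: sqi_def)
  have "sqi (\<lambda>t. max 0 (\<psi> t))" "sqi (\<lambda>t. max 0 (- \<psi> t))"
    using sqi unfolding sqi_def
    by (auto intro: unit_interval_measure.square_integrable_mono[OF meas, of _ \<psi>])
  then have "apx (\<lambda>t. max 0 (\<psi> t))" "apx (\<lambda>t. max 0 (- \<psi> t))"
    by (auto intro!: apx_nonneg simp: sqi_def)
  then have "apx (\<lambda>t. max 0 (\<psi> t) + (-1) * max 0 (- \<psi> t))"
    by (intro apx_add apx_cmult)
  moreover have "(\<lambda>t. max 0 (\<psi> t) + (-1) * max 0 (- \<psi> t)) = \<psi>" by auto
  ultimately have "apx \<psi>" by simp
  then show ?thesis using \<open>0 < e\<close> by (auto simp: apx_def)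
qed

section \<open>Hilbert space geometry of a Krein space\<close>

interpretation cvec: vector_space "scaleC :: complex \<Rightarrow> 'a \<Rightarrow> 'a::complex_normed_space"
  by (rule vector_space_scaleC)

lemma kip_zero_left [simp]: "kip 0 (y :: 'a::krein_space) = 0"
  using kip_scaleC_left[of 0 0 y] by simp

lemma kip_minus_left [simp]: "kip (- x) (y :: 'a::krein_space) = - kip x y"
  using kip_add_left[of x "- x" y] by (simp add: add_eq_0_iff)

lemma kip_diff_left: "kip (x - y) (z :: 'a::krein_space) = kip x z - kip y z"
  using kip_add_left[of x "- y" z] by simp

lemma kip_add_right: "kip x (y + z) = kip x y + kip x (z :: 'a::krein_space)"
  by (metis kip_add_left kip_commute complex_cnj_add)

lemma kip_scaleC_right: "kip x (c *\<^sub>C y) = cnj c * kip x (y :: 'a::krein_space)"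
  by (metis kip_scaleC_left kip_commute complex_cnj_mult)

lemma kip_minus_right [simp]: "kip x (- y) = - kip x (y :: 'a::krein_space)"
  by (metis kip_minus_left kip_commute complex_cnj_minus)

lemma kip_diff_right: "kip x (y - z) = kip x y - kip x (z :: 'a::krein_space)"
  using kip_add_right[of x y "- z"] by simp

lemma krein_decomp: obtains p m where "p \<in> krein_pos" "m \<in> krein_neg" "(x :: 'a::krein_space) = p + m"
  using krein_sum by blast

lemma fund_sym_additive: "fund_sym (x + y) = fund_sym x + fund_sym (y :: 'a::krein_space)"
proof -
  obtain p m where x: "p \<in> krein_pos" "m \<in> krein_neg" "x = p + m" by (rule krein_decomp)
  obtain q n where y: "q \<in> krein_pos" "n \<in> krein_neg" "y = q + n" by (rule krein_decomp)
  have "x + y = (p + q) + (m + n)" using x y by (simp add: algebra_simps)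
  then have "fund_sym (x + y) = (p + q) - (m + n)"
    using fund_sym_add[OF krein_pos_add[OF x(1) y(1)] krein_neg_add[OF x(2) y(2)]] by simp
  then show ?thesis using x y by (simp add: fund_sym_add)
qed

lemma fund_sym_scaleC: "fund_sym (c *\<^sub>C x) = c *\<^sub>C fund_sym (x :: 'a::krein_space)"
proof -
  obtain p m where x: "p \<in> krein_pos" "m \<in> krein_neg" "x = p + m" by (rule krein_decomp)
  show ?thesis
    using fund_sym_add[OF krein_pos_scaleC[OF x(1)] krein_neg_scaleC[OF x(2)], of c c] x
    by (simp add: fund_sym_add scaleC_add_right cvec.scale_right_diff_distrib)
qed

lemma fund_sym_idem [simp]: "fund_sym (fund_sym x) = (x :: 'a::krein_space)"
proof -
  obtain p m where x: "p \<in> krein_pos" "m \<in> krein_neg" "x = p + m" by (rule krein_decomp)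
  have "- m \<in> krein_neg" using krein_neg_scaleC[OF x(2), of "-1"] by simp
  from fund_sym_add[OF x(1) this] show ?thesis using x by (simp add: fund_sym_add)
qed

lemma fund_sym_zero [simp]: "fund_sym 0 = (0 :: 'a::krein_space)"
  using fund_sym_scaleC[of 0 0] by simp

lemma fund_sym_minus [simp]: "fund_sym (- x) = - fund_sym (x :: 'a::krein_space)"
  using fund_sym_scaleC[of "-1" x] by simp

lemma fund_sym_diff: "fund_sym (x - y) = fund_sym x - fund_sym (y :: 'a::krein_space)"
  using fund_sym_additive[of x "- y"] by simp

lemma kip_fund_sym: "kip (fund_sym x) y = kip x (fund_sym (y :: 'a::krein_space))"
proof -
  obtain p m where x: "p \<in> krein_pos" "m \<in> krein_neg" "x = p + m" by (rule krein_decomp)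
  obtain q n where y: "q \<in> krein_pos" "n \<in> krein_neg" "y = q + n" by (rule krein_decomp)
  have "kip p n = 0" "kip m q = 0"
    using krein_orthogonal[OF x(1) y(2)] krein_orthogonal[OF y(1) x(2)] kip_commute[of q m] by auto
  then show ?thesis
    using x y by (simp add: fund_sym_add kip_add_left kip_add_right kip_diff_left kip_diff_right)
qed

lemma kip_eq_hip: "kip x y = hip (fund_sym x) (y :: 'a::krein_space)"
  by (simp add: hip_def)

lemma hip_fund_sym: "hip (fund_sym x) y = hip x (fund_sym (y :: 'a::krein_space))"
  by (simp add: hip_def kip_fund_sym)

lemma hip_add_left: "hip (x + y) z = hip x z + hip y (z :: 'a::krein_space)"
  by (simp add: hip_def fund_sym_additive kip_add_left)

lemma hip_scaleC_left: "hip (c *\<^sub>C x) y = c * hip x (y :: 'a::krein_space)"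
  by (simp add: hip_def fund_sym_scaleC kip_scaleC_left)

lemma hip_add_right: "hip x (y + z) = hip x y + hip x (z :: 'a::krein_space)"
  by (simp add: hip_def kip_add_right)

lemma hip_scaleC_right: "hip x (c *\<^sub>C y) = cnj c * hip x (y :: 'a::krein_space)"
  by (simp add: hip_def kip_scaleC_right)

lemma hip_commute: "hip y x = cnj (hip x (y :: 'a::krein_space))"
  by (metis hip_def kip_commute kip_fund_sym)

lemma hip_zero [simp]: "hip 0 (y :: 'a::krein_space) = 0" "hip (y :: 'a::krein_space) 0 = 0"
  using hip_scaleC_left[of 0 0 y] hip_scaleC_right[of y 0 0] by simp_all

lemma hip_minus [simp]: "hip (- x) (y :: 'a::krein_space) = - hip x y" "hip x (- y) = - hip x (y :: 'a::krein_space)"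
  by (simp_all add: hip_def)

lemma hip_diff_left: "hip (x - y) z = hip x z - hip y (z :: 'a::krein_space)"
  by (simp add: hip_def fund_sym_diff kip_diff_left)

lemma hip_diff_right: "hip x (y - z) = hip x y - hip x (z :: 'a::krein_space)"
  by (simp add: hip_def kip_diff_right)

lemma hip_scaleR_left: "hip (r *\<^sub>R x) y = r * hip x (y :: 'a::krein_space)"
  by (simp add: scaleR_scaleC hip_scaleC_left)

lemma hip_scaleR_right: "hip x (r *\<^sub>R y) = r * hip x (y :: 'a::krein_space)"
  by (simp add: scaleR_scaleC hip_scaleC_right)

lemma norm_sq_eq_hip: "(norm (x :: 'a::krein_space))\<^sup>2 = Re (hip x x)"
  by (metis norm_eq_sqrt_hip norm_ge_zero real_sqrt_ge_0_iff real_sqrt_pow2)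

lemma hip_self: "hip x x = complex_of_real ((norm (x :: 'a::krein_space))\<^sup>2)"
  using hip_commute[of x x] by (simp add: norm_sq_eq_hip complex_eq_iff)

lemma norm_add_sq:
  "(norm (x + y))\<^sup>2 = (norm x)\<^sup>2 + (norm (y :: 'a::krein_space))\<^sup>2 + 2 * Re (hip x y)"
  using hip_commute[of x y] by (simp add: norm_sq_eq_hip hip_add_left hip_add_right)

lemma norm_diff_sq:
  "(norm (x - y))\<^sup>2 = (norm x)\<^sup>2 + (norm (y :: 'a::krein_space))\<^sup>2 - 2 * Re (hip x y)"
  using norm_add_sq[of x "- y"] by simp

lemma norm_add_sq_le: "(norm (x + y))\<^sup>2 \<le> 2 * (norm x)\<^sup>2 + 2 * (norm (y :: 'a::krein_space))\<^sup>2"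
  using norm_add_sq[of x y] norm_diff_sq[of x y] zero_le_power2[of "norm (x - y)"] by linarith

text \<open>Nonnegativity of the left side is the Cauchy-Schwarz inequality; the exact value also
  shows that a best approximation leaves an orthogonal remainder.\<close>

lemma norm_diff_component_sq:
  fixes x y :: "'a::krein_space"
  assumes "y \<noteq> 0"
  shows "(norm (x - (hip x y / (norm y)\<^sup>2) *\<^sub>C y))\<^sup>2 = (norm x)\<^sup>2 - (cmod (hip x y))\<^sup>2 / (norm y)\<^sup>2"
proof -
  define c where "c = hip x y / (norm y)\<^sup>2"
  have "cnj c * hip x y = of_real ((cmod (hip x y))\<^sup>2 / (norm y)\<^sup>2)"
    using complex_norm_square[of "hip x y"] by (simp add: c_def mult.commute)
  then have "Re (hip x (c *\<^sub>C y)) = (cmod (hip x y))\<^sup>2 / (norm y)\<^sup>2"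
    by (simp add: hip_scaleC_right del: of_real_divide)
  moreover have "(norm (c *\<^sub>C y))\<^sup>2 = (cmod (hip x y))\<^sup>2 / (norm y)\<^sup>2"
  proof -
    have "cmod c = cmod (hip x y) / (norm y)\<^sup>2" by (simp add: c_def norm_divide norm_power)
    then show ?thesis using assms by (simp add: norm_scaleC power2_eq_square)
  qed
  ultimately show ?thesis
    unfolding c_def[symmetric] norm_diff_sq by simp
qed

lemma hip_Cauchy_Schwarz: "cmod (hip x y) \<le> norm x * norm (y :: 'a::krein_space)"
proof (cases "y = 0")
  case False
  have "(cmod (hip x y))\<^sup>2 / (norm y)\<^sup>2 \<le> (norm x)\<^sup>2"
    using norm_diff_component_sq[OF False, of x]
      zero_le_power2[of "norm (x - (hip x y / (norm y)\<^sup>2) *\<^sub>C y)"] by linarith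
  then have "(cmod (hip x y))\<^sup>2 \<le> (norm x * norm y)\<^sup>2"
    using False by (simp add: divide_le_eq power_mult_distrib)
  then show ?thesis by (rule power2_le_imp_le) simp
qed simp

lemma tendsto_norm_diff: "(X \<longlongrightarrow> x) F \<Longrightarrow> ((\<lambda>n. norm (X n - x)) \<longlongrightarrow> 0) F"
  for x :: "'a::real_normed_vector"
  by (simp add: tendsto_norm_zero_iff LIM_zero)

lemma tendsto_hip:
  fixes x y :: "'a::krein_space"
  assumes X: "(X \<longlongrightarrow> x) F" and Y: "(Y \<longlongrightarrow> y) F"
  shows "((\<lambda>n. hip (X n) (Y n)) \<longlongrightarrow> hip x y) F"
proof -
  have left: "((\<lambda>n. norm (X n - x) * norm (Y n)) \<longlongrightarrow> 0 * norm y) F"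
    by (rule tendsto_mult[OF tendsto_norm_diff[OF X] tendsto_norm[OF Y]])
  have right: "((\<lambda>n. norm x * norm (Y n - y)) \<longlongrightarrow> norm x * 0) F"
    by (rule tendsto_mult[OF tendsto_const tendsto_norm_diff[OF Y]])
  have "((\<lambda>n. hip (X n) (Y n) - hip x y) \<longlongrightarrow> 0) F"
  proof (rule Lim_null_comparison)
    show "((\<lambda>n. norm (X n - x) * norm (Y n) + norm x * norm (Y n - y)) \<longlongrightarrow> 0) F"
      using tendsto_add[OF left right] by simp
    have "hip (X n) (Y n) - hip x y = hip (X n - x) (Y n) + hip x (Y n - y)" for n
      by (simp add: hip_diff_left hip_diff_right)
    then have "norm (hip (X n) (Y n) - hip x y) \<le> norm (X n - x) * norm (Y n) + norm x * norm (Y n - y)" for n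
      using norm_triangle_ineq[of "hip (X n - x) (Y n)" "hip x (Y n - y)"]
        hip_Cauchy_Schwarz[of "X n - x" "Y n"] hip_Cauchy_Schwarz[of x "Y n - y"] by simp
    then show "\<forall>\<^sub>F n in F. norm (hip (X n) (Y n) - hip x y) \<le> norm (X n - x) * norm (Y n) + norm x * norm (Y n - y)"
      by simp
  qed
  then show ?thesis by (rule Lim_null[THEN iffD2])
qed

lemma tendsto_of_norm_diff_sq:
  fixes x :: "'b::real_normed_vector"
  assumes "((\<lambda>n. (norm (X n - x))\<^sup>2) \<longlongrightarrow> 0) F"
  shows "(X \<longlongrightarrow> x) F"
proof -
  have "((\<lambda>n. sqrt ((norm (X n - x))\<^sup>2)) \<longlongrightarrow> sqrt 0) F"
    by (rule tendsto_real_sqrt[OF assms])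
  then show ?thesis by (simp add: tendsto_norm_zero_iff LIM_zero_iff)
qed

lemma hip_eqI:
  fixes x y :: "'a::krein_space"
  assumes dense: "closure D = UNIV" and eq: "\<And>z. z \<in> D \<Longrightarrow> hip x z = hip y z"
  shows "x = y"
proof -
  have "x - y \<in> closure D" using dense by simp
  then obtain Z where Z: "\<And>n. Z n \<in> D" "Z \<longlonglongrightarrow> x - y"
    unfolding closure_sequential by blast
  have "(\<lambda>n. hip (x - y) (Z n)) \<longlonglongrightarrow> hip (x - y) (x - y)"
    by (rule tendsto_hip[OF tendsto_const Z(2)])
  moreover have "hip (x - y) (Z n) = 0" for n
    using eq[OF Z(1)] by (simp add: hip_diff_left)
  ultimately have "hip (x - y) (x - y) = 0"
    by (simp add: LIMSEQ_const_iff)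
  then show ?thesis by (simp add: hip_self)
qed

lemma norm_fund_sym [simp]: "norm (fund_sym x) = norm (x :: 'a::krein_space)"
  by (simp add: norm_eq_sqrt_hip hip_fund_sym)

lemma tendsto_fund_sym: "(X \<longlongrightarrow> x) F \<Longrightarrow> ((\<lambda>n. fund_sym (X n)) \<longlongrightarrow> fund_sym (x :: 'a::krein_space)) F"
proof -
  assume "(X \<longlongrightarrow> x) F"
  from tendsto_norm_diff[OF this] have "((\<lambda>n. norm (fund_sym (X n) - fund_sym x)) \<longlongrightarrow> 0) F"
    by (simp add: fund_sym_diff[symmetric])
  then show ?thesis by (simp add: tendsto_norm_zero_iff LIM_zero_iff)
qed

section \<open>Orthogonal projections and the fundamental decomposition\<close>

definition krein_proj_pos :: "'a::krein_space \<Rightarrow> 'a"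
  where "krein_proj_pos x = (1 / 2) *\<^sub>R (x + fund_sym x)"

definition krein_proj_neg :: "'a::krein_space \<Rightarrow> 'a"
  where "krein_proj_neg x = (1 / 2) *\<^sub>R (x - fund_sym x)"

lemma krein_proj_add: "krein_proj_pos x + krein_proj_neg x = (x :: 'a::krein_space)"
  by (simp add: krein_proj_pos_def krein_proj_neg_def scaleR_add_right[symmetric] del: scaleR_add_right)

lemma krein_proj_decomp:
  assumes "p \<in> krein_pos" "m \<in> krein_neg"
  shows "krein_proj_pos (p + m) = p" "krein_proj_neg (p + m) = (m :: 'a::krein_space)"
  using assms by (simp_all add: krein_proj_pos_def krein_proj_neg_def fund_sym_add scaleR_2[symmetric])

lemma krein_proj_in [simp]: "krein_proj_pos x \<in> krein_pos" "krein_proj_neg (x :: 'a::krein_space) \<in> krein_neg"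
  using krein_proj_decomp by (metis krein_decomp)+

lemma fund_sym_eq_proj: "fund_sym x = krein_proj_pos x - krein_proj_neg (x :: 'a::krein_space)"
  using fund_sym_add[of "krein_proj_pos x" "krein_proj_neg x"] by (simp add: krein_proj_add)

lemma fund_sym_krein_pos: "x \<in> krein_pos \<Longrightarrow> fund_sym x = (x :: 'a::krein_space)"
  using fund_sym_add[of x 0] krein_neg_zero by simp

lemma fund_sym_krein_neg: "x \<in> krein_neg \<Longrightarrow> fund_sym x = - (x :: 'a::krein_space)"
  using fund_sym_add[of 0 x] krein_pos_zero by simp

lemma krein_proj_eq_iff: "krein_proj_pos x = x \<longleftrightarrow> x \<in> krein_pos" "krein_proj_neg x = x \<longleftrightarrow> (x :: 'a::krein_space) \<in> krein_neg"
  using krein_proj_in krein_proj_decomp[of x 0] krein_proj_decomp[of 0 x] krein_pos_zero krein_neg_zero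
  by (metis add_0 add_0_right)+

lemma linear_krein_proj:
  "Vector_Spaces.linear scaleC scaleC (krein_proj_pos :: 'a::krein_space \<Rightarrow> 'a)"
  "Vector_Spaces.linear scaleC scaleC (krein_proj_neg :: 'a::krein_space \<Rightarrow> 'a)"
proof -
  have comm: "r *\<^sub>R c *\<^sub>C x = c *\<^sub>C r *\<^sub>R x" for r c and x :: 'a
    by (simp add: scaleR_scaleC scaleC_scaleC mult.commute)
  show "Vector_Spaces.linear scaleC scaleC (krein_proj_pos :: 'a \<Rightarrow> 'a)"
    "Vector_Spaces.linear scaleC scaleC (krein_proj_neg :: 'a \<Rightarrow> 'a)"
    by unfold_locales (simp_all add: krein_proj_pos_def krein_proj_neg_def fund_sym_additive
        fund_sym_scaleC comm[symmetric] scaleR_add_right[symmetric] scaleC_add_right[symmetric]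
        scaleR_diff_right[symmetric] cvec.scale_right_diff_distrib[symmetric]
        del: scaleR_add_right scaleR_diff_right cvec.scale_right_diff_distrib)
qed

lemma orthogonal_projection_krein_proj:
  "orthogonal_projection (krein_proj_pos :: 'a::krein_space \<Rightarrow> 'a)"
  "orthogonal_projection (krein_proj_neg :: 'a::krein_space \<Rightarrow> 'a)"
proof -
  have "hip (krein_proj_pos x) y = hip x (krein_proj_pos y)"
    "hip (krein_proj_neg x) y = hip x (krein_proj_neg y)" for x y :: 'a
    by (simp_all add: krein_proj_pos_def krein_proj_neg_def hip_scaleR_left hip_scaleR_right
        hip_add_left hip_add_right hip_diff_left hip_diff_right hip_fund_sym)
  then show "orthogonal_projection (krein_proj_pos :: 'a \<Rightarrow> 'a)"
    "orthogonal_projection (krein_proj_neg :: 'a \<Rightarrow> 'a)"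
    by (simp_all add: orthogonal_projection_def linear_krein_proj krein_proj_eq_iff)
qed

lemma krein_proj_neg_eq: "krein_proj_neg x = x - krein_proj_pos (x :: 'a::krein_space)"
  and krein_proj_pos_eq: "krein_proj_pos x = x - krein_proj_neg (x :: 'a::krein_space)"
  using krein_proj_add[of x] by (simp_all add: eq_diff_eq add.commute)

locale orth_proj =
  fixes P :: "'a::krein_space \<Rightarrow> 'a"
  assumes orthogonal_projection: "orthogonal_projection P"
begin

lemma idem [simp]: "P (P x) = P x"
  and self_adjoint: "hip (P x) y = hip x (P y)"
  using orthogonal_projection by (auto simp: orthogonal_projection_def)

sublocale Vector_Spaces.linear scaleC scaleC P
  using orthogonal_projection by (simp add: orthogonal_projection_def)

lemma hip_proj_compl: "hip (P x) (y - P y) = 0"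
  by (simp add: hip_diff_right self_adjoint)

lemma pythagoras: "(norm x)\<^sup>2 = (norm (P x))\<^sup>2 + (norm (x - P x))\<^sup>2"
  using norm_add_sq[of "P x" "x - P x"] by (simp add: hip_proj_compl)

lemma norm_proj_le: "norm (P x) \<le> norm x"
  using pythagoras[of x] by (metis le_add_same_cancel1 norm_ge_zero power2_le_imp_le zero_le_power2)

lemma tendsto_proj:
  assumes "(X \<longlongrightarrow> x) F"
  shows "((\<lambda>n. P (X n)) \<longlongrightarrow> P x) F"
proof -
  have "((\<lambda>n. P (X n) - P x) \<longlongrightarrow> 0) F"
  proof (rule Lim_null_comparison)
    show "((\<lambda>n. norm (X n - x)) \<longlongrightarrow> 0) F" using assms by (rule tendsto_norm_diff)
    show "\<forall>\<^sub>F n in F. norm (P (X n) - P x) \<le> norm (X n - x)"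
      by (simp add: norm_proj_le flip: diff)
  qed
  then show ?thesis by (rule Lim_null[THEN iffD2])
qed

end

interpretation pos: orth_proj "krein_proj_pos :: 'a::krein_space \<Rightarrow> 'a"
  by unfold_locales (rule orthogonal_projection_krein_proj)

interpretation neg: orth_proj "krein_proj_neg :: 'a::krein_space \<Rightarrow> 'a"
  by unfold_locales (rule orthogonal_projection_krein_proj)

lemma norm_contraction_Cauchy:
  assumes "Cauchy X" and "\<And>m n. norm (Y m - Y n) \<le> C * norm (X m - X n)"
  shows "Cauchy (Y :: nat \<Rightarrow> 'b::real_normed_vector)"
proof (rule metric_CauchyI)
  fix e :: real assume "e > 0"
  then have "e / (\<bar>C\<bar> + 1) > 0" by simp
  with assms(1) obtain M where M: "\<And>m n. m \<ge> M \<Longrightarrow> n \<ge> M \<Longrightarrow> norm (X m - X n) < e / (\<bar>C\<bar> + 1)"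
    unfolding Cauchy_def dist_norm by metis
  have "dist (Y m) (Y n) < e" if "m \<ge> M" "n \<ge> M" for m n
  proof -
    have "norm (Y m - Y n) \<le> (\<bar>C\<bar> + 1) * norm (X m - X n)"
      using assms(2)[of m n] by (rule order.trans) (auto intro: mult_right_mono)
    also have "\<dots> < e" using M[OF that] by (simp add: field_simps)
    finally show ?thesis by (simp add: dist_norm)
  qed
  then show "\<exists>M. \<forall>m\<ge>M. \<forall>n\<ge>M. dist (Y m) (Y n) < e" by blast
qed

text \<open>Completeness is given for the two summands only. The projections do not increase norms,
  so both components of a Cauchy sequence are Cauchy.\<close>

lemma krein_complete: "Cauchy X \<Longrightarrow> convergent (X :: nat \<Rightarrow> 'a::krein_space)"
proof -
  assume X: "Cauchy X"
  have "Cauchy (\<lambda>n. krein_proj_pos (X n))" "Cauchy (\<lambda>n. krein_proj_neg (X n))"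
    by (rule norm_contraction_Cauchy[OF X, of _ 1];
        simp add: pos.diff[symmetric] neg.diff[symmetric] pos.norm_proj_le neg.norm_proj_le)+
  then obtain p m where "(\<lambda>n. krein_proj_pos (X n)) \<longlonglongrightarrow> p" "(\<lambda>n. krein_proj_neg (X n)) \<longlonglongrightarrow> m"
    using complete_krein_pos complete_krein_neg unfolding complete_def by (metis krein_proj_in)
  from tendsto_add[OF this] show ?thesis
    by (auto simp: krein_proj_add convergent_def)
qed

section \<open>Best approximation in closed subspaces and maximal graphs\<close>

lemma orthogonal_decomposition:
  fixes D :: "'a::krein_space set"
  assumes sub: "csubspace D" and "closed D"
  obtains d where "d \<in> D" "\<And>e. e \<in> D \<Longrightarrow> hip (x - d) e = 0"
proof -
  define \<delta> where "\<delta> = infdist x D"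
  have "0 \<in> D" using sub by (rule cvec.subspace_0)
  then have ne: "D \<noteq> {}" by auto
  have \<delta>_le: "\<delta> \<le> norm (x - y)" if "y \<in> D" for y
    using infdist_le[OF that, of x] by (simp add: \<delta>_def dist_norm)
  have \<delta>_nonneg: "\<delta> \<ge> 0" by (simp add: \<delta>_def infdist_nonneg)
  have "\<exists>y\<in>D. norm (x - y) < \<delta> + 1 / real (Suc n)" for n
  proof (rule ccontr)
    assume "\<not> ?thesis"
    then have "\<delta> + 1 / real (Suc n) \<le> dist x y" if "y \<in> D" for y
      using that by (force simp: dist_norm)
    then have "\<delta> + 1 / real (Suc n) \<le> infdist x D"
      using ne by (auto simp: infdist_def intro: cINF_greatest)
    then show False by (simp add: \<delta>_def)
  qed
  then obtain Y where Y: "\<And>n. Y n \<in> D" "\<And>n. norm (x - Y n) < \<delta> + 1 / real (Suc n)" by metis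
  define q where "q k = (\<delta> + 1 / real (Suc k))\<^sup>2" for k
  \<comment> \<open>Parallelogram identity: the midpoint of \<open>Y m\<close> and
    \<open>Y n\<close> lies in \<open>D\<close>, hence has distance at least \<open>\<delta>\<close>
    from \<open>x\<close>, which forces the two points together.\<close>
  have bound: "(norm (Y m - Y n))\<^sup>2
      \<le> 2 * (q m - \<delta>\<^sup>2) + 2 * (q n - \<delta>\<^sup>2)" for m n
  proof -
    have "(1 / 2) *\<^sub>R (Y m + Y n) \<in> D"
      unfolding scaleR_scaleC using Y sub cvec.subspace_add cvec.subspace_scale by blast
    then have "\<delta> \<le> norm (x - (1 / 2) *\<^sub>R (Y m + Y n))" by (rule \<delta>_le)
    also have "x - (1 / 2) *\<^sub>R (Y m + Y n) = (1 / 2) *\<^sub>R ((x - Y m) + (x - Y n))"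
      by (simp add: algebra_simps scaleR_2[symmetric])
    finally have "2 * \<delta> \<le> norm ((x - Y m) + (x - Y n))" by simp
    then have "4 * \<delta>\<^sup>2 \<le> (norm ((x - Y m) + (x - Y n)))\<^sup>2"
      using \<delta>_nonneg power_mono[of "2 * \<delta>" _ 2] by simp
    moreover have "(norm (Y m - Y n))\<^sup>2 = 2 * (norm (x - Y m))\<^sup>2 + 2 * (norm (x - Y n))\<^sup>2
        - (norm ((x - Y m) + (x - Y n)))\<^sup>2"
      using norm_add_sq[of "x - Y m" "x - Y n"] norm_diff_sq[of "x - Y m" "x - Y n"]
      by (simp add: norm_minus_commute)
    moreover have "(norm (x - Y k))\<^sup>2 \<le> q k" for k
      unfolding q_def using Y(2)[of k] by (intro power_mono) auto
    from this[of m] this[of n] have "(norm (x - Y m))\<^sup>2 + (norm (x - Y n))\<^sup>2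
        \<le> q m + q n" by linarith
    ultimately show ?thesis by argo
  qed
  have "Cauchy Y"
  proof (rule metric_CauchyI)
    fix e :: real assume "e > 0"
    have "(\<lambda>n. q n - \<delta>\<^sup>2) \<longlonglongrightarrow> (\<delta> + 0)\<^sup>2 - \<delta>\<^sup>2"
      unfolding q_def by (intro tendsto_intros LIMSEQ_Suc[OF lim_1_over_n])
    then have "\<forall>\<^sub>F n in sequentially. q n - \<delta>\<^sup>2 < e\<^sup>2 / 4"
      using \<open>e > 0\<close> by (intro order_tendstoD(2)) auto
    then obtain M where M: "\<And>n. n \<ge> M \<Longrightarrow> q n - \<delta>\<^sup>2 < e\<^sup>2 / 4"
      unfolding eventually_sequentially by blast
    have "dist (Y m) (Y n) < e" if "m \<ge> M" "n \<ge> M" for m n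
    proof -
      have "(norm (Y m - Y n))\<^sup>2 < e\<^sup>2"
        using bound[of m n] M[OF that(1)] M[OF that(2)] by argo
      then show ?thesis using \<open>e > 0\<close> by (simp add: dist_norm power2_less_imp_less)
    qed
    then show "\<exists>M. \<forall>m\<ge>M. \<forall>n\<ge>M. dist (Y m) (Y n) < e" by blast
  qed
  then obtain d where d: "Y \<longlonglongrightarrow> d" using krein_complete convergent_def by blast
  have "d \<in> D" using \<open>closed D\<close> Y(1) d by (rule closed_sequentially[of D Y])
  have "norm (x - d) \<le> \<delta> + 0"
  proof (rule LIMSEQ_le)
    show "(\<lambda>n. norm (x - Y n)) \<longlonglongrightarrow> norm (x - d)" by (intro tendsto_intros d)
    show "(\<lambda>n. \<delta> + 1 / real (Suc n)) \<longlonglongrightarrow> \<delta> + 0" by (intro tendsto_intros LIMSEQ_Suc[OF lim_1_over_n])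
  qed (use Y(2) less_imp_le in blast)
  then have d_le: "norm (x - d) \<le> norm (x - y)" if "y \<in> D" for y
    using \<delta>_le[OF that] by simp
  show thesis
  proof
    fix e assume "e \<in> D"
    show "hip (x - d) e = 0"
    proof (cases "e = 0")
      case False
      \<comment> \<open>Were the inner product nonzero, moving \<open>d\<close> by this multiple of
        \<open>e\<close> would bring it strictly closer to \<open>x\<close>.\<close>
      define c where "c = hip (x - d) e / (norm e)\<^sup>2"
      have "d + c *\<^sub>C e \<in> D"
        using \<open>d \<in> D\<close> \<open>e \<in> D\<close> sub cvec.subspace_add cvec.subspace_scale by blast
      then have "(norm (x - d))\<^sup>2 \<le> (norm (x - d - c *\<^sub>C e))\<^sup>2"
        using d_le[of "d + c *\<^sub>C e"] by (intro power_mono) (auto simp: diff_diff_add)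
      then have "(cmod (hip (x - d) e))\<^sup>2 / (norm e)\<^sup>2 \<le> 0"
        using norm_diff_component_sq[OF False, of "x - d"] unfolding c_def by linarith
      then show ?thesis using False by (simp add: divide_le_0_iff)
    qed simp
  qed fact
qed

lemma (in orth_proj) maximal_graph_proj_surj:
  assumes sub: "csubspace L" and closed: "closed L"
    and dom: "\<And>x. x \<in> L \<Longrightarrow> x \<noteq> 0 \<Longrightarrow> norm (x - P x) < norm (P x)"
    and max: "\<And>L'. csubspace L' \<Longrightarrow> closed L' \<Longrightarrow> L \<subseteq> L' \<Longrightarrow>
      (\<And>x. x \<in> L' \<Longrightarrow> x \<noteq> 0 \<Longrightarrow> norm (x - P x) < norm (P x)) \<Longrightarrow> L' = L"
  shows "P ` L = range P"
proof -
  have norm_le: "norm x \<le> 2 * norm (P x)" if "x \<in> L" for x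
  proof (cases "x = 0")
    case False
    then show ?thesis
      using dom[OF that] norm_triangle_ineq[of "P x" "x - P x"] by simp
  qed simp
  have subD: "csubspace (P ` L)" using sub by (rule subspace_image)
  have closedD: "closed (P ` L)"
    unfolding closed_sequential_limits
  proof (intro allI impI)
    fix Y y assume Y': "(\<forall>n. Y n \<in> P ` L) \<and> Y \<longlonglongrightarrow> y"
    then have Y: "Y \<longlonglongrightarrow> y" by blast
    from Y' have "\<forall>n. \<exists>x\<in>L. Y n = P x" by blast
    then obtain X where X: "\<And>n. X n \<in> L" "\<And>n. Y n = P (X n)" by metis
    have "Cauchy X"
    proof (rule norm_contraction_Cauchy[of Y _ 2])
      show "Cauchy Y" using Y LIMSEQ_imp_Cauchy by blast
      show "norm (X m - X n) \<le> 2 * norm (Y m - Y n)" for m n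
        using norm_le[of "X m - X n"] X cvec.subspace_diff[OF sub] by (simp add: diff)
    qed
    then obtain x where x: "X \<longlonglongrightarrow> x" using krein_complete convergent_def by blast
    have "x \<in> L" using closed X(1) x by (rule closed_sequentially[of L X])
    have "Y \<longlonglongrightarrow> P x"
      using tendsto_proj[OF x] unfolding X(2)[symmetric] .
    then have "P x = y" using Y by (rule LIMSEQ_unique)
    with \<open>x \<in> L\<close> show "y \<in> P ` L" by (metis imageI)
  qed
  show ?thesis
  proof (rule ccontr)
    assume "P ` L \<noteq> range P"
    then obtain u where u: "P u \<notin> P ` L" by blast
    obtain d where d: "d \<in> P ` L" "\<And>e. e \<in> P ` L \<Longrightarrow> hip (P u - d) e = 0"
      using orthogonal_decomposition[OF subD closedD] by blast
    define v where "v = P u - d"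
    have "v \<noteq> 0" using u d(1) by (auto simp: v_def)
    have Pv: "P v = v" using d(1) by (auto simp: v_def diff)
    have vL: "hip l v = 0" if "l \<in> L" for l
      using d(2)[of "P l"] that hip_commute[of v "P l"] self_adjoint[of l v] Pv by (simp add: v_def[symmetric])
    \<comment> \<open>The coefficient along \<open>v\<close>; it vanishes on \<open>L\<close>, since
      there the inner product with \<open>v\<close> only sees \<open>P l\<close>.\<close>
    define c where "c y = hip y v / (norm v)\<^sup>2" for y
    have c_add: "c (x + y) = c x + c y" and c_scale: "c (a *\<^sub>C y) = a * c y" for x y a
      by (simp_all add: c_def hip_add_left hip_scaleC_left add_divide_distrib)
    have cL: "c l = 0" if "l \<in> L" for l using vL[OF that] by (simp add: c_def)
    have cv: "c v = 1" using \<open>v \<noteq> 0\<close> by (simp add: c_def hip_self)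
    \<comment> \<open>This is the sum of \<open>L\<close> and the line through \<open>v\<close>,
      written as a preimage of \<open>L\<close> so that closedness follows from continuity of
      \<open>c\<close>.\<close>
    define L' where "L' = {y. y - c y *\<^sub>C v \<in> L}"
    have subL': "csubspace L'"
    proof (rule cvec.subspaceI)
      show "0 \<in> L'" using cvec.subspace_0[OF sub] by (simp add: L'_def c_def)
      fix x y assume "x \<in> L'" "y \<in> L'"
      then have "(x - c x *\<^sub>C v) + (y - c y *\<^sub>C v) \<in> L"
        using cvec.subspace_add[OF sub] by (simp add: L'_def)
      then show "x + y \<in> L'" by (simp add: L'_def c_add scaleC_add_left algebra_simps)
    next
      fix a x assume "x \<in> L'"
      then have "a *\<^sub>C (x - c x *\<^sub>C v) \<in> L"
        using cvec.subspace_scale[OF sub] by (simp add: L'_def)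
      then show "a *\<^sub>C x \<in> L'" by (simp add: L'_def c_scale cvec.scale_right_diff_distrib scaleC_scaleC)
    qed
    have closedL': "closed L'"
      unfolding closed_sequential_limits
    proof (intro allI impI)
      fix Y y assume Y: "(\<forall>n. Y n \<in> L') \<and> Y \<longlonglongrightarrow> y"
      have "(\<lambda>n. hip (Y n - y) v) \<longlonglongrightarrow> hip 0 v"
        using Y by (intro tendsto_hip tendsto_const) (simp add: LIM_zero)
      then have "(\<lambda>n. cmod (c (Y n - y)) * norm v) \<longlonglongrightarrow> cmod (hip 0 v / (norm v)\<^sup>2) * norm v"
        unfolding c_def by (intro tendsto_intros) (use \<open>v \<noteq> 0\<close> in auto)
      then have "(\<lambda>n. norm (c (Y n - y) *\<^sub>C v)) \<longlonglongrightarrow> 0" by (simp add: norm_scaleC)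
      then have "(\<lambda>n. (Y n - y) - c (Y n - y) *\<^sub>C v) \<longlonglongrightarrow> 0 - 0"
        using Y by (intro tendsto_diff) (auto simp: LIM_zero tendsto_norm_zero_iff)
      moreover have "(Y n - y) - c (Y n - y) *\<^sub>C v = (Y n - c (Y n) *\<^sub>C v) - (y - c y *\<^sub>C v)" for n
        by (simp add: c_def hip_diff_left diff_divide_distrib cvec.scale_left_diff_distrib)
      ultimately have "(\<lambda>n. Y n - c (Y n) *\<^sub>C v) \<longlonglongrightarrow> y - c y *\<^sub>C v"
        by (simp add: Lim_null[symmetric])
      moreover have "Y n - c (Y n) *\<^sub>C v \<in> L" for n using Y by (simp add: L'_def)
      ultimately have "y - c y *\<^sub>C v \<in> L"
        using closed_sequentially[OF closed, of "\<lambda>n. Y n - c (Y n) *\<^sub>C v"] by blast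
      then show "y \<in> L'" by (simp add: L'_def)
    qed
    have domL': "norm (y - P y) < norm (P y)" if "y \<in> L'" "y \<noteq> 0" for y
    proof -
      define l where "l = y - c y *\<^sub>C v"
      have l: "l \<in> L" using that by (simp add: L'_def l_def)
      have y: "y = l + c y *\<^sub>C v" by (simp add: l_def)
      have Py: "P y = P l + c y *\<^sub>C v" unfolding l_def by (simp add: diff scale Pv)
      have "hip (P l) (c y *\<^sub>C v) = 0"
        using vL[OF l] self_adjoint[of l v] Pv by (simp add: hip_scaleC_right)
      then have norm_Py: "(norm (P y))\<^sup>2 = (norm (P l))\<^sup>2 + (norm (c y *\<^sub>C v))\<^sup>2"
        unfolding Py by (subst norm_add_sq) simp
      have "y - P y = l - P l" unfolding Py by (simp add: l_def)
      moreover have "(norm (l - P l))\<^sup>2 < (norm (P y))\<^sup>2"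
      proof (cases "l = 0")
        case True
        then have "c y *\<^sub>C v \<noteq> 0" using y that(2) by auto
        then show ?thesis using True norm_Py by simp
      next
        case False
        then have "(norm (l - P l))\<^sup>2 < (norm (P l))\<^sup>2"
          using dom[OF l] by (intro power_strict_mono) auto
        then show ?thesis using norm_Py zero_le_power2[of "norm (c y *\<^sub>C v)"] by linarith
      qed
      ultimately show ?thesis by (metis norm_ge_zero power2_less_imp_less)
    qed
    have "L \<subseteq> L'" using cL by (auto simp: L'_def)
    then have "L' = L" using max[OF subL' closedL' _ domL'] by blast
    moreover have "v \<in> L'" using cvec.subspace_0[OF sub] by (simp add: L'_def cv)
    ultimately have "v \<in> L" by simp
    then have "c v = 0" by (rule cL)
    then show False using cv by simp
  qed
qed

section \<open>Borel functional calculus of a positive contraction\<close>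

context unit_interval_measure
begin

text \<open>The mixed term in the difference of squares is absorbed by Young's inequality with a
  free weight \<open>e\<close>: a small multiple of the limit plus a large multiple of the error,
  which tends to 0.\<close>

lemma integral_square_tendsto:
  assumes \<phi>: "\<And>n. square_integrable M (\<phi> n)" and \<psi>: "square_integrable M \<psi>"
    and lim: "(\<lambda>n. LINT t|M. (\<phi> n t - \<psi> t)\<^sup>2) \<longlonglongrightarrow> 0"
  shows "(\<lambda>n. LINT t|M. (\<phi> n t)\<^sup>2) \<longlonglongrightarrow> (LINT t|M. (\<psi> t)\<^sup>2)"
proof (rule LIMSEQ_I)
  fix r :: real assume "r > 0"
  define I where "I = (LINT t|M. (\<psi> t)\<^sup>2)"
  have "I \<ge> 0" unfolding I_def by simp
  \<comment> \<open>Chosen to make \<open>e * I\<close> at most \<open>r / 2\<close>; the added 1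
    covers \<open>I = 0\<close>.\<close>
  define e where "e = r / (2 * (I + 1))"
  have "e > 0" using \<open>r > 0\<close> \<open>I \<ge> 0\<close> by (simp add: e_def)
  have eI: "e * I \<le> r / 2"
  proof -
    have "e * I \<le> e * (I + 1)" using \<open>e > 0\<close> by simp
    also have "\<dots> = r / 2" using \<open>I \<ge> 0\<close> by (simp add: e_def field_simps)
    finally show ?thesis .
  qed
  have pointwise: "\<bar>a\<^sup>2 - b\<^sup>2\<bar> \<le> (1 + 1 / e) * (a - b)\<^sup>2 + e * b\<^sup>2" for a b :: real
  proof -
    have "\<bar>2 * (b * (a - b))\<bar> \<le> (1 / e) * (a - b)\<^sup>2 + e * b\<^sup>2"
    proof -
      have "0 \<le> e * ((a - b) / e + b)\<^sup>2" "0 \<le> e * ((a - b) / e - b)\<^sup>2"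
        using \<open>e > 0\<close> by simp_all
      moreover have "e * ((a - b) / e + b)\<^sup>2 = (1 / e) * (a - b)\<^sup>2 + e * b\<^sup>2 + 2 * (b * (a - b))"
        "e * ((a - b) / e - b)\<^sup>2 = (1 / e) * (a - b)\<^sup>2 + e * b\<^sup>2 - 2 * (b * (a - b))"
        using \<open>e > 0\<close> by (simp_all add: power2_eq_square field_simps)
      ultimately show ?thesis by linarith
    qed
    moreover have "a\<^sup>2 - b\<^sup>2 = (a - b)\<^sup>2 + 2 * (b * (a - b))"
      by (simp add: power2_eq_square algebra_simps)
    moreover have "(1 + 1 / e) * (a - b)\<^sup>2 = (a - b)\<^sup>2 + (1 / e) * (a - b)\<^sup>2"
      by (simp add: algebra_simps)
    ultimately show ?thesis using zero_le_power2[of "a - b"] by linarith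
  qed
  have "(\<lambda>n. (1 + 1 / e) * (LINT t|M. (\<phi> n t - \<psi> t)\<^sup>2)) \<longlonglongrightarrow> (1 + 1 / e) * 0"
    by (rule tendsto_mult_left[OF lim])
  then have "\<forall>\<^sub>F n in sequentially. (1 + 1 / e) * (LINT t|M. (\<phi> n t - \<psi> t)\<^sup>2) < r / 2"
    using \<open>r > 0\<close> by (intro order_tendstoD(2)) auto
  then obtain N where N: "\<And>n. n \<ge> N \<Longrightarrow> (1 + 1 / e) * (LINT t|M. (\<phi> n t - \<psi> t)\<^sup>2) < r / 2"
    unfolding eventually_sequentially by blast
  have "norm ((LINT t|M. (\<phi> n t)\<^sup>2) - I) < r" if "n \<ge> N" for n
  proof -
    note [simp] = square_integrable_imp_integrable_square
    have "(LINT t|M. (\<phi> n t)\<^sup>2) - I = (LINT t|M. (\<phi> n t)\<^sup>2 - (\<psi> t)\<^sup>2)"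
      using \<phi> \<psi> by (simp add: I_def)
    also have "norm \<dots> \<le> (LINT t|M. norm ((\<phi> n t)\<^sup>2 - (\<psi> t)\<^sup>2))"
      by (rule integral_norm_bound)
    also have "\<dots> \<le> (LINT t|M. (1 + 1 / e) * (\<phi> n t - \<psi> t)\<^sup>2 + e * (\<psi> t)\<^sup>2)"
      by (rule integral_mono) (use \<phi> \<psi> pointwise in \<open>simp_all del: distrib_right\<close>)
    also have "\<dots> = (1 + 1 / e) * (LINT t|M. (\<phi> n t - \<psi> t)\<^sup>2) + e * I"
      using \<phi> \<psi> by (simp add: I_def)
    also have "\<dots> < r" using N[OF that] eI by linarith
    finally show ?thesis .
  qed
  then show "\<exists>no. \<forall>n\<ge>no. norm ((LINT t|M. (\<phi> n t)\<^sup>2) - (LINT t|M. (\<psi> t)\<^sup>2)) < r"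
    unfolding I_def by blast
qed

text \<open>Four times a function is the difference of the squares of the function plus 1 and minus
  1, and constants are square integrable on a finite measure; so convergence of squared norms
  suffices.\<close>

lemma integral_tendsto_square_integrable:
  assumes \<phi>: "\<And>n. square_integrable M (\<phi> n)" and \<psi>: "square_integrable M \<psi>"
    and lim: "(\<lambda>n. LINT t|M. (\<phi> n t - \<psi> t)\<^sup>2) \<longlonglongrightarrow> 0"
  shows "(\<lambda>n. LINT t|M. \<phi> n t) \<longlonglongrightarrow> (LINT t|M. \<psi> t)"
proof -
  have const: "square_integrable M (\<lambda>_. c)" for c
    by (rule square_integrable_bounded[of _ "\<bar>c\<bar>"]) auto
  have eq: "(LINT t|M. \<eta> t) = ((LINT t|M. (\<eta> t + 1)\<^sup>2) - (LINT t|M. (\<eta> t - 1)\<^sup>2)) / 4"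
    if "square_integrable M \<eta>" for \<eta>
  proof -
    have "(LINT t|M. (\<eta> t + 1)\<^sup>2) - (LINT t|M. (\<eta> t - 1)\<^sup>2) = (LINT t|M. (\<eta> t + 1)\<^sup>2 - (\<eta> t - 1)\<^sup>2)"
      using that const
      by (intro Bochner_Integration.integral_diff[symmetric] square_integrable_imp_integrable_square
          square_integrable_add square_integrable_diff)
    also have "(\<lambda>t. (\<eta> t + 1)\<^sup>2 - (\<eta> t - 1)\<^sup>2) = (\<lambda>t. 4 * \<eta> t)"
      by (auto simp: power2_eq_square algebra_simps)
    finally show ?thesis by simp
  qed
  have "(\<lambda>n. LINT t|M. (\<phi> n t + 1)\<^sup>2) \<longlonglongrightarrow> (LINT t|M. (\<psi> t + 1)\<^sup>2)"
    "(\<lambda>n. LINT t|M. (\<phi> n t - 1)\<^sup>2) \<longlonglongrightarrow> (LINT t|M. (\<psi> t - 1)\<^sup>2)"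
    using \<phi> \<psi> lim const by (auto intro!: integral_square_tendsto)
  from tendsto_divide[OF tendsto_diff[OF this] tendsto_const[of 4]] show ?thesis
    by (simp add: eq \<phi> \<psi>)
qed

end

lemma poly_dense_sequence:
  assumes "finite \<M>" "\<And>M. M \<in> \<M> \<Longrightarrow> unit_interval_measure M \<and> square_integrable M \<psi>"
    and "\<psi> \<in> borel_measurable borel"
  obtains p where "\<And>M. M \<in> \<M> \<Longrightarrow> (\<lambda>n. LINT t|M. (poly (p n) t - \<psi> t)\<^sup>2) \<longlonglongrightarrow> 0"
proof -
  have "\<exists>p. \<forall>M\<in>\<M>. (LINT t|M. (poly p t - \<psi> t)\<^sup>2) < 1 / real (Suc n)" for n
    using poly_dense_square_integrable[of \<M> "\<lambda>M. M" \<psi> "1 / real (Suc n)"] assms by auto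
  then obtain p where p: "\<And>n. \<forall>M\<in>\<M>. (LINT t|M. (poly (p n) t - \<psi> t)\<^sup>2) < 1 / real (Suc n)"
    by metis
  show thesis
  proof
    fix M assume "M \<in> \<M>"
    show "(\<lambda>n. LINT t|M. (poly (p n) t - \<psi> t)\<^sup>2) \<longlonglongrightarrow> 0"
    proof (rule tendsto_sandwich[of "\<lambda>_. 0" _ _ "\<lambda>n. 1 / real (Suc n)"])
      show "\<forall>\<^sub>F n in sequentially. (LINT t|M. (poly (p n) t - \<psi> t)\<^sup>2) \<le> 1 / real (Suc n)"
        using p \<open>M \<in> \<M>\<close> less_imp_le by (intro always_eventually) blast
      show "(\<lambda>n. 1 / real (Suc n)) \<longlonglongrightarrow> 0" by (rule LIMSEQ_Suc[OF lim_1_over_n])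
    qed (auto intro!: always_eventually)
  qed
qed

section \<open>Real polynomials in a positive contraction and their moment measures\<close>

locale positive_contraction =
  fixes S :: "'a::krein_space \<Rightarrow> 'a"
  assumes S_add: "S (x + y) = S x + S y"
    and S_scaleC: "S (c *\<^sub>C x) = c *\<^sub>C S x"
    and S_self_adjoint: "hip (S x) y = hip x (S y)"
    and S_nonneg: "0 \<le> Re (hip (S x) x)"
    and S_le: "Re (hip (S x) x) \<le> (norm x)\<^sup>2"
begin

lemma S_zero [simp]: "S 0 = 0"
  using S_scaleC[of 0 0] by simp

lemma S_scaleR: "S (r *\<^sub>R x) = r *\<^sub>R S x"
  by (simp add: scaleR_scaleC S_scaleC)

lemma S_diff: "S (x - y) = S x - S y"
  using S_add[of "x - y" y] by simp

lemma S_minus [simp]: "S (- x) = - S x"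
  using S_diff[of 0 x] by simp

text \<open>Horner evaluation, so that induction over \<open>pCons\<close> unfolds it one
  application of \<open>S\<close> at a time.\<close>

definition op_poly :: "real poly \<Rightarrow> 'a \<Rightarrow> 'a"
  where "op_poly p x = fold_coeffs (\<lambda>a y. a *\<^sub>R x + S y) p 0"

lemma op_poly_0 [simp]: "op_poly 0 x = 0"
  by (simp add: op_poly_def)

lemma op_poly_pCons [simp]: "op_poly (pCons a p) x = a *\<^sub>R x + S (op_poly p x)"
  by (cases "p = 0 \<and> a = 0") (auto simp: op_poly_def)

lemma op_poly_1 [simp]: "op_poly 1 x = x"
  by (simp add: one_pCons)

lemma op_poly_add: "op_poly (p + q) x = op_poly p x + op_poly q x"
  by (induction p q rule: poly_induct2) (simp_all add: S_add algebra_simps)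

lemma op_poly_smult: "op_poly (smult c p) x = c *\<^sub>R op_poly p x"
  by (induction p) (simp_all add: S_scaleR scaleR_add_right)

lemma op_poly_minus: "op_poly (- p) x = - op_poly p x"
  using op_poly_smult[of "-1" p x] by simp

lemma op_poly_diff: "op_poly (p - q) x = op_poly p x - op_poly q x"
  using op_poly_add[of p "- q" x] by (simp add: op_poly_minus)

lemma op_poly_mult: "op_poly (p * q) x = op_poly p (op_poly q x)"
  by (induction p) (simp_all add: op_poly_add op_poly_smult mult_pCons_left)

lemma op_poly_vec_add: "op_poly p (x + y) = op_poly p x + op_poly p y"
  by (induction p) (simp_all add: S_add algebra_simps)

lemma op_poly_vec_scaleC: "op_poly p (c *\<^sub>C x) = c *\<^sub>C op_poly p x"
  by (induction p) (simp_all add: S_scaleC scaleC_add_right scaleR_scaleC scaleC_scaleC mult.commute)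

lemma op_poly_vec_diff: "op_poly p (x - y) = op_poly p x - op_poly p y"
  using op_poly_vec_add[of p "x - y" y] by simp

lemma op_poly_self_adjoint: "hip (op_poly p x) y = hip x (op_poly p y)"
proof (induction p arbitrary: x y)
  case (pCons a p)
  have "op_poly p (S y) = S (op_poly p y)"
    using op_poly_mult[of p "[:0, 1:]" y] op_poly_mult[of "[:0, 1:]" p y]
    by (simp add: mult.commute)
  then show ?case
    by (simp add: hip_add_left hip_add_right hip_scaleR_left hip_scaleR_right S_self_adjoint pCons.IH)
qed simp

text \<open>The positivity condition of the moment problem, obtained without square roots. Even
  parts of the exponents are collected in a square and moved to both sides of the form, leaving 1,
  X, 1 - X or X (1 - X). The last equals (1 - X)^2 X + X^2 (1 - X) and so reduces to the
  first-degree cases.\<close>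

lemma op_poly_form_nonneg:
  "0 \<le> Re (hip (op_poly ([:0, 1:] ^ k * [:1, -1:] ^ m) x) x)"
proof -
  let ?X = "[:0, 1:] :: real poly" and ?Y = "[:1, -1:] :: real poly"
  have sq: "hip (op_poly (q * q * r) z) z = hip (op_poly r (op_poly q z)) (op_poly q z)" for q r z
  proof -
    have "q * q * r = q * (r * q)" by (simp add: mult_ac)
    then show ?thesis by (simp only: op_poly_mult op_poly_self_adjoint)
  qed
  have X: "0 \<le> Re (hip (op_poly ?X z) z)" for z using S_nonneg by simp
  have Y: "0 \<le> Re (hip (op_poly ?Y z) z)" for z
    using S_le[of z] by (simp add: hip_add_left hip_diff_left hip_scaleR_left norm_sq_eq_hip S_scaleR)
  have XY: "0 \<le> Re (hip (op_poly (?X * ?Y) z) z)" for z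
  proof -
    have "?X * ?Y = ?Y * ?Y * ?X + ?X * ?X * ?Y" by simp
    then have "hip (op_poly (?X * ?Y) z) z
        = hip (op_poly ?X (op_poly ?Y z)) (op_poly ?Y z) + hip (op_poly ?Y (op_poly ?X z)) (op_poly ?X z)"
      by (simp only: op_poly_add hip_add_left sq)
    then show ?thesis using X[of "op_poly ?Y z"] Y[of "op_poly ?X z"] by (simp only: plus_complex.simps)
  qed
  define q where "q = ?X ^ (k div 2) * ?Y ^ (m div 2)"
  define r where "r = ?X ^ (k mod 2) * ?Y ^ (m mod 2)"
  have split: "P ^ n = P ^ (n div 2) * P ^ (n div 2) * P ^ (n mod 2)" for P :: "real poly" and n
    by (simp add: power_add[symmetric] flip: mult_2)
  have "?X ^ k * ?Y ^ m = q * q * r"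
    unfolding q_def r_def by (subst split[of _ k], subst split[of _ m]) (simp only: mult_ac)
  moreover have "0 \<le> Re (hip (op_poly r z) z)" for z
  proof -
    have "k mod 2 = 0 \<or> k mod 2 = 1" "m mod 2 = 0 \<or> m mod 2 = 1" by presburger+
    then show ?thesis
      using X[of z] Y[of z] XY[of z] norm_sq_eq_hip[of z] zero_le_power2[of "norm z"]
      unfolding r_def by (elim disjE) (simp_all only: power_0 power_one_right mult_1_left mult_1_right op_poly_1)
  qed
  ultimately show ?thesis by (simp only: sq)
qed

definition mu :: "'a \<Rightarrow> real measure"
  where "mu x = (SOME M. unit_interval_measure M \<and> (\<forall>p. (LINT t|M. poly p t) = Re (hip (op_poly p x) x)))"

text \<open>The moment theorem yields probability measures, so the functional is divided by the
  squared norm of x and a constant density restores the factor. For x = 0 a point mass is scaled to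
  the null measure.\<close>

lemma mu_ex: "\<exists>M. unit_interval_measure M \<and> (\<forall>p. (LINT t|M. poly p t) = Re (hip (op_poly p x) x))"
proof -
  obtain M where M: "prob_space M" "sets M = sets borel" "AE t in M. 0 \<le> t \<and> t \<le> 1"
    "x \<noteq> 0 \<Longrightarrow> (LINT t|M. poly p t) = Re (hip (op_poly p x) x) / (norm x)\<^sup>2" for p
  proof (cases "x = 0")
    case True
    have "prob_space (return borel (0::real))" by (rule prob_space_return) simp
    then show ?thesis using that[of "return borel 0"] True by (simp add: AE_return)
  next
    case False
    let ?L = "\<lambda>p. Re (hip (op_poly p x) x) / (norm x)\<^sup>2"
    obtain M where "prob_space M" "sets M = sets borel" "AE t in M. 0 \<le> t \<and> t \<le> 1"
      "\<And>p. (LINT t|M. poly p t) = ?L p"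
    proof (rule hausdorff_moment_problem[of ?L])
      show "0 \<le> ?L ([:0, 1:] ^ k * [:1, -1:] ^ m)" for k m
        using op_poly_form_nonneg by simp
    qed (use False in \<open>auto simp: op_poly_add op_poly_smult hip_add_left hip_scaleR_left add_divide_distrib norm_sq_eq_hip[symmetric]\<close>)
    then show ?thesis using that by blast
  qed
  interpret prob_space M by fact
  define N where "N = density M (\<lambda>_. ennreal ((norm x)\<^sup>2))"
  have [simp]: "borel_measurable M = borel_measurable borel"
    using M(2) by (rule measurable_cong_sets) simp
  have "unit_interval_measure N"
  proof (intro unit_interval_measure.intro finite_measureI unit_interval_measure_axioms.intro)
    show "emeasure N (space N) \<noteq> \<infinity>"
      by (simp add: N_def emeasure_density emeasure_space_1 nn_integral_cmult)
    show "sets N = sets borel" by (simp add: N_def M)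
    show "AE t in N. 0 \<le> t \<and> t \<le> 1"
      unfolding N_def by (subst AE_density) (use M(3) in \<open>auto elim: eventually_mono\<close>)
  qed
  moreover have "(LINT t|N. poly p t) = Re (hip (op_poly p x) x)" for p
  proof -
    have "(LINT t|N. poly p t) = (norm x)\<^sup>2 * (LINT t|M. poly p t)"
      unfolding N_def by (subst integral_density) auto
    also have "\<dots> = Re (hip (op_poly p x) x)"
      using M(4)[of p] by (cases "x = 0") auto
    finally show ?thesis .
  qed
  ultimately show ?thesis by blast
qed

lemma unit_interval_measure_mu: "unit_interval_measure (mu x)"
  and integral_poly_mu: "(LINT t|mu x. poly p t) = Re (hip (op_poly p x) x)"
  using someI_ex[OF mu_ex[of x]] unfolding mu_def by auto

sublocale mu: unit_interval_measure "mu x" for x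
  by (rule unit_interval_measure_mu)

lemma norm_op_poly_sq: "(norm (op_poly p x))\<^sup>2 = (LINT t|mu x. (poly p t)\<^sup>2)"
proof -
  have "(norm (op_poly p x))\<^sup>2 = Re (hip (op_poly (p * p) x) x)"
    by (simp only: norm_sq_eq_hip op_poly_mult op_poly_self_adjoint)
  also have "\<dots> = (LINT t|mu x. poly (p * p) t)" by (simp only: integral_poly_mu)
  finally show ?thesis by (simp add: power2_eq_square)
qed

lemma norm_op_poly_diff_sq:
  "(norm (op_poly p x - op_poly q x))\<^sup>2 = (LINT t|mu x. (poly p t - poly q t)\<^sup>2)"
  using norm_op_poly_sq[of "p - q" x] by (simp add: op_poly_diff)

text \<open>The bound is read off the measure: the squared norm is the integral of p^2 against
  \<open>mu x\<close>, whose total mass is the squared norm of x, and p is bounded on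
  [0, 1].\<close>

lemma op_poly_bounded: "\<exists>C. \<forall>x. norm (op_poly p x) \<le> C * norm x"
proof -
  obtain C where C: "C > 0" "\<forall>t\<in>{0..1}. \<bar>poly p t\<bar> \<le> C" using poly_bounded_unit by blast
  have "(norm (op_poly p x))\<^sup>2 \<le> (C * norm x)\<^sup>2" for x
  proof -
    have "(LINT t|mu x. (poly p t)\<^sup>2) \<le> (LINT t|mu x. C\<^sup>2)"
    proof (rule integral_mono_AE)
      show "AE t in mu x. (poly p t)\<^sup>2 \<le> C\<^sup>2"
        using mu.AE_unit by eventually_elim (use C in \<open>auto simp: abs_le_square_iff[symmetric]\<close>)
    qed (auto intro: mu.square_integrable_imp_integrable_square)
    also have "\<dots> = C\<^sup>2 * (norm x)\<^sup>2"
      using integral_poly_mu[of x 1] by (simp add: norm_sq_eq_hip)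
    finally show ?thesis by (simp add: norm_op_poly_sq power_mult_distrib)
  qed
  then show ?thesis using C(1) by (metis mult_nonneg_nonneg norm_ge_zero less_imp_le power2_le_imp_le)
qed

lemma tendsto_op_poly:
  assumes "(X \<longlongrightarrow> x) F"
  shows "((\<lambda>n. op_poly p (X n)) \<longlongrightarrow> op_poly p x) F"
proof -
  obtain C where C: "\<And>x. norm (op_poly p x) \<le> C * norm x" using op_poly_bounded by blast
  have "((\<lambda>n. op_poly p (X n) - op_poly p x) \<longlongrightarrow> 0) F"
  proof (rule Lim_null_comparison)
    show "((\<lambda>n. C * norm (X n - x)) \<longlongrightarrow> 0) F"
      using tendsto_mult_left[OF tendsto_norm_diff[OF assms], of C] by simp
    show "\<forall>\<^sub>F n in F. norm (op_poly p (X n) - op_poly p x) \<le> C * norm (X n - x)"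
      using C by (simp add: op_poly_vec_diff[symmetric])
  qed
  then show ?thesis by (rule Lim_null[THEN iffD2])
qed

text \<open>
  The map \<open>p \<mapsto> op_poly p x\<close> is isometric for the norm of \<open>L\<^sup>2 (mu x)\<close>, and \<open>sop \<psi> x\<close>
  is the value of its extension at \<open>\<psi>\<close>; it is \<open>\<psi>(S) x\<close> of the Borel functional calculus.
\<close>

definition sop :: "(real \<Rightarrow> real) \<Rightarrow> 'a \<Rightarrow> 'a"
  where "sop \<psi> x = (THE y. \<forall>p. (norm (op_poly p x - y))\<^sup>2 = (LINT t|mu x. (poly p t - \<psi> t)\<^sup>2))"

text \<open>Prescribing the distances to all \<open>op_poly p x\<close> pins y down because
  polynomials are dense, and makes y independent of an approximating sequence. The isometry turns an
  approximating sequence into a Cauchy sequence of vectors, whose limit has these distances.\<close>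

lemma sop_ex1:
  assumes \<psi>: "square_integrable (mu x) \<psi>"
  shows "\<exists>!y. \<forall>p. (norm (op_poly p x - y))\<^sup>2 = (LINT t|mu x. (poly p t - \<psi> t)\<^sup>2)"
proof -
  obtain q where q: "(\<lambda>n. LINT t|mu x. (poly (q n) t - \<psi> t)\<^sup>2) \<longlonglongrightarrow> 0"
    by (rule poly_dense_sequence[of "{mu x}" \<psi>])
       (use \<psi> in \<open>auto simp: unit_interval_measure_mu square_integrable_def\<close>)
  have "Cauchy (\<lambda>n. op_poly (q n) x)"
  proof (rule metric_CauchyI)
    fix e :: real assume "e > 0"
    then have "\<forall>\<^sub>F n in sequentially. (LINT t|mu x. (poly (q n) t - \<psi> t)\<^sup>2) < e\<^sup>2 / 4"
      by (intro order_tendstoD(2)[OF q]) auto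
    then obtain N where N: "\<And>n. n \<ge> N \<Longrightarrow> (LINT t|mu x. (poly (q n) t - \<psi> t)\<^sup>2) < e\<^sup>2 / 4"
      unfolding eventually_sequentially by blast
    have "dist (op_poly (q m) x) (op_poly (q n) x) < e" if "m \<ge> N" "n \<ge> N" for m n
    proof -
      have "(norm (op_poly (q m) x - op_poly (q n) x))\<^sup>2
          \<le> 2 * (LINT t|mu x. (poly (q m) t - \<psi> t)\<^sup>2) + 2 * (LINT t|mu x. (\<psi> t - poly (q n) t)\<^sup>2)"
        unfolding norm_op_poly_diff_sq by (rule mu.integral_square_diff_triangle) (use \<psi> in auto)
      also have "\<dots> < e\<^sup>2" using N[OF that(1)] N[OF that(2)] by (simp add: power2_commute[of "\<psi> _"])
      finally show ?thesis using \<open>e > 0\<close> by (simp add: dist_norm power2_less_imp_less)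
    qed
    then show "\<exists>M. \<forall>m\<ge>M. \<forall>n\<ge>M. dist (op_poly (q m) x) (op_poly (q n) x) < e" by blast
  qed
  then obtain y where y: "(\<lambda>n. op_poly (q n) x) \<longlonglongrightarrow> y"
    using krein_complete convergent_def by blast
  show ?thesis
  proof (rule ex1I)
    show "\<forall>p. (norm (op_poly p x - y))\<^sup>2 = (LINT t|mu x. (poly p t - \<psi> t)\<^sup>2)"
    proof
      fix p
      have "(\<lambda>n. (norm (op_poly p x - op_poly (q n) x))\<^sup>2) \<longlonglongrightarrow> (norm (op_poly p x - y))\<^sup>2"
        by (rule tendsto_power[OF tendsto_norm[OF tendsto_diff[OF tendsto_const y]]])
      moreover have "(\<lambda>n. LINT t|mu x. (poly p t - poly (q n) t)\<^sup>2) \<longlonglongrightarrow> (LINT t|mu x. (poly p t - \<psi> t)\<^sup>2)"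
        by (rule mu.integral_square_tendsto) (use \<psi> q in \<open>auto simp: power2_commute\<close>)
      ultimately show "(norm (op_poly p x - y))\<^sup>2 = (LINT t|mu x. (poly p t - \<psi> t)\<^sup>2)"
        unfolding norm_op_poly_diff_sq by (rule LIMSEQ_unique)
    qed
    fix z assume "\<forall>p. (norm (op_poly p x - z))\<^sup>2 = (LINT t|mu x. (poly p t - \<psi> t)\<^sup>2)"
    then have "(\<lambda>n. (norm (op_poly (q n) x - z))\<^sup>2) \<longlonglongrightarrow> 0" using q by simp
    then have "(\<lambda>n. op_poly (q n) x) \<longlonglongrightarrow> z" by (rule tendsto_of_norm_diff_sq)
    then show "z = y" using y by (rule LIMSEQ_unique)
  qed
qed

lemma norm_op_poly_sop_sq:
  "square_integrable (mu x) \<psi> \<Longrightarrow>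
    (norm (op_poly p x - sop \<psi> x))\<^sup>2 = (LINT t|mu x. (poly p t - \<psi> t)\<^sup>2)"
  using theI'[OF sop_ex1] unfolding sop_def by blast

lemma norm_sop_sq: "square_integrable (mu x) \<psi> \<Longrightarrow> (norm (sop \<psi> x))\<^sup>2 = (LINT t|mu x. (\<psi> t)\<^sup>2)"
  using norm_op_poly_sop_sq[of x \<psi> 0] by simp

lemma op_poly_tendsto_sop:
  assumes "square_integrable (mu x) \<psi>" "(\<lambda>n. LINT t|mu x. (poly (p n) t - \<psi> t)\<^sup>2) \<longlonglongrightarrow> 0"
  shows "(\<lambda>n. op_poly (p n) x) \<longlonglongrightarrow> sop \<psi> x"
  by (rule tendsto_of_norm_diff_sq) (use assms in \<open>simp add: norm_op_poly_sop_sq\<close>)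

lemma sop_poly: "sop (poly p) x = op_poly p x"
  using norm_op_poly_sop_sq[of x "poly p" p] by simp

text \<open>A single sequence for all vectors of \<open>X\<close>: relations between the values of
  \<open>op_poly (p n)\<close> at different vectors thereby survive the limit.\<close>

lemma sop_approx:
  assumes "finite X" "\<And>x. x \<in> X \<Longrightarrow> square_integrable (mu x) \<psi>" "\<psi> \<in> borel_measurable borel"
  obtains p where "\<And>x. x \<in> X \<Longrightarrow> (\<lambda>n. LINT t|mu x. (poly (p n) t - \<psi> t)\<^sup>2) \<longlonglongrightarrow> 0"
    "\<And>x. x \<in> X \<Longrightarrow> (\<lambda>n. op_poly (p n) x) \<longlonglongrightarrow> sop \<psi> x"
proof -
  obtain p where p: "\<And>M. M \<in> mu ` X \<Longrightarrow> (\<lambda>n. LINT t|M. (poly (p n) t - \<psi> t)\<^sup>2) \<longlonglongrightarrow> 0"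
    by (rule poly_dense_sequence[of "mu ` X" \<psi>]) (use assms in \<open>auto simp: unit_interval_measure_mu\<close>)
  show thesis
    by (rule that[of p]) (use p assms op_poly_tendsto_sop in auto)
qed

lemma sop_add:
  assumes "square_integrable (mu x) \<phi>" "square_integrable (mu x) \<psi>"
  shows "sop (\<lambda>t. \<phi> t + \<psi> t) x = sop \<phi> x + sop \<psi> x"
proof -
  obtain p where p: "(\<lambda>n. LINT t|mu x. (poly (p n) t - \<phi> t)\<^sup>2) \<longlonglongrightarrow> 0" "(\<lambda>n. op_poly (p n) x) \<longlonglongrightarrow> sop \<phi> x"
    by (rule sop_approx[of "{x}" \<phi>]) (use assms in \<open>auto simp: square_integrable_def\<close>)
  obtain q where q: "(\<lambda>n. LINT t|mu x. (poly (q n) t - \<psi> t)\<^sup>2) \<longlonglongrightarrow> 0" "(\<lambda>n. op_poly (q n) x) \<longlonglongrightarrow> sop \<psi> x"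
    by (rule sop_approx[of "{x}" \<psi>]) (use assms in \<open>auto simp: square_integrable_def\<close>)
  have "(\<lambda>n. op_poly (p n + q n) x) \<longlonglongrightarrow> sop (\<lambda>t. \<phi> t + \<psi> t) x"
  proof (rule op_poly_tendsto_sop)
    show "(\<lambda>n. LINT t|mu x. (poly (p n + q n) t - (\<phi> t + \<psi> t))\<^sup>2) \<longlonglongrightarrow> 0"
    proof -
      let ?b = "\<lambda>n. 2 * (LINT t|mu x. (poly (p n) t - \<phi> t)\<^sup>2) + 2 * (LINT t|mu x. (poly (q n) t - \<psi> t)\<^sup>2)"
      have b: "?b \<longlonglongrightarrow> 0"
        using tendsto_add[OF tendsto_mult_left[OF p(1), of 2] tendsto_mult_left[OF q(1), of 2]] by simp
      have "(LINT t|mu x. (poly (p n + q n) t - (\<phi> t + \<psi> t))\<^sup>2) \<le> ?b n" for n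
        using mu.integral_square_diff_triangle[of x "poly (p n + q n)" "\<lambda>t. \<phi> t + poly (q n) t" "\<lambda>t. \<phi> t + \<psi> t"]
          assms by simp
      then show ?thesis
        by (intro tendsto_sandwich[of "\<lambda>_. 0" _ _ ?b, OF _ _ tendsto_const b] always_eventually) auto
    qed
  qed (use assms in simp)
  moreover have "(\<lambda>n. op_poly (p n + q n) x) \<longlonglongrightarrow> sop \<phi> x + sop \<psi> x"
    unfolding op_poly_add by (rule tendsto_add[OF p(2) q(2)])
  ultimately show ?thesis by (rule LIMSEQ_unique)
qed

lemma sop_cmult:
  assumes "square_integrable (mu x) \<psi>"
  shows "sop (\<lambda>t. c * \<psi> t) x = c *\<^sub>R sop \<psi> x"
proof -
  obtain p where p: "(\<lambda>n. LINT t|mu x. (poly (p n) t - \<psi> t)\<^sup>2) \<longlonglongrightarrow> 0" "(\<lambda>n. op_poly (p n) x) \<longlonglongrightarrow> sop \<psi> x"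
    by (rule sop_approx[of "{x}" \<psi>]) (use assms in \<open>auto simp: square_integrable_def\<close>)
  have "(\<lambda>n. op_poly (smult c (p n)) x) \<longlonglongrightarrow> sop (\<lambda>t. c * \<psi> t) x"
  proof (rule op_poly_tendsto_sop)
    have "(LINT t|mu x. (poly (smult c (p n)) t - c * \<psi> t)\<^sup>2) = c\<^sup>2 * (LINT t|mu x. (poly (p n) t - \<psi> t)\<^sup>2)" for n
      by (simp add: right_diff_distrib[symmetric] power_mult_distrib)
    then show "(\<lambda>n. LINT t|mu x. (poly (smult c (p n)) t - c * \<psi> t)\<^sup>2) \<longlonglongrightarrow> 0"
      using tendsto_mult_left[OF p(1), of "c\<^sup>2"] by simp
  qed (use assms in simp)
  moreover have "(\<lambda>n. op_poly (smult c (p n)) x) \<longlonglongrightarrow> c *\<^sub>R sop \<psi> x"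
    unfolding op_poly_smult by (rule tendsto_scaleR[OF tendsto_const p(2)])
  ultimately show ?thesis by (rule LIMSEQ_unique)
qed

lemma sop_diff:
  assumes "square_integrable (mu x) \<phi>" "square_integrable (mu x) \<psi>"
  shows "sop (\<lambda>t. \<phi> t - \<psi> t) x = sop \<phi> x - sop \<psi> x"
  using sop_add[OF assms(1) mu.square_integrable_cmult[OF assms(2), of "-1"]] sop_cmult[OF assms(2), of "-1"]
  by simp

lemma norm_sop_diff_sq:
  assumes "square_integrable (mu x) \<phi>" "square_integrable (mu x) \<psi>"
  shows "(norm (sop \<phi> x - sop \<psi> x))\<^sup>2 = (LINT t|mu x. (\<phi> t - \<psi> t)\<^sup>2)"
  using norm_sop_sq[of x "\<lambda>t. \<phi> t - \<psi> t"] sop_diff[OF assms] assms by simp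

lemma sop_tendsto:
  assumes "\<And>n. square_integrable (mu x) (\<phi> n)" "square_integrable (mu x) \<psi>"
    and "(\<lambda>n. LINT t|mu x. (\<phi> n t - \<psi> t)\<^sup>2) \<longlonglongrightarrow> 0"
  shows "(\<lambda>n. sop (\<phi> n) x) \<longlonglongrightarrow> sop \<psi> x"
  by (rule tendsto_of_norm_diff_sq) (use assms in \<open>simp add: norm_sop_diff_sq\<close>)

lemma sop_cong_AE:
  assumes "square_integrable (mu x) \<phi>" "square_integrable (mu x) \<psi>" "AE t in mu x. \<phi> t = \<psi> t"
  shows "sop \<phi> x = sop \<psi> x"
proof -
  have "(LINT t|mu x. (\<phi> t - \<psi> t)\<^sup>2) = (LINT t|mu x. 0)"
    by (rule integral_cong_AE) (use assms in \<open>auto simp: square_integrable_def elim: eventually_mono\<close>)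
  then show ?thesis using norm_sop_diff_sq[OF assms(1,2)] by simp
qed

lemma sop_cong:
  assumes "square_integrable (mu x) \<phi>" "\<psi> \<in> borel_measurable borel"
    and "\<And>t. 0 \<le> t \<Longrightarrow> t \<le> 1 \<Longrightarrow> \<phi> t = \<psi> t"
  shows "sop \<phi> x = sop \<psi> x"
proof (rule sop_cong_AE)
  show "square_integrable (mu x) \<psi>" by (rule mu.square_integrable_mono[OF assms(1,2)]) (simp add: assms(3))
  show "AE t in mu x. \<phi> t = \<psi> t" using mu.AE_unit by eventually_elim (use assms(3) in auto)
qed fact

end

text \<open>This density is what the measure of \<open>sop \<phi> x\<close> ought to be.
  Approximating \<open>\<psi>\<close> by polynomials p in its L2 norm means approximating
  \<open>\<psi> \<phi>\<close> by p \<open>\<phi>\<close> in that of the original measure, which is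
  what the product rule \<open>sop_sop\<close> calls for.\<close>

lemma density_square_unit_interval:
  assumes "unit_interval_measure M" "square_integrable M \<phi>"
  shows "unit_interval_measure (density M (\<lambda>t. ennreal ((\<phi> t)\<^sup>2)))"
    and "\<psi> \<in> borel_measurable borel \<Longrightarrow>
      (LINT t|density M (\<lambda>t. ennreal ((\<phi> t)\<^sup>2)). \<psi> t) = (LINT t|M. (\<phi> t)\<^sup>2 * \<psi> t)"
    and "square_integrable (density M (\<lambda>t. ennreal ((\<phi> t)\<^sup>2))) \<psi> \<longleftrightarrow>
      \<psi> \<in> borel_measurable borel \<and> square_integrable M (\<lambda>t. \<psi> t * \<phi> t)"
proof -
  interpret unit_interval_measure M by fact
  have [measurable]: "\<phi> \<in> borel_measurable borel" using assms(2) by (simp add: square_integrable_def)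
  show "unit_interval_measure (density M (\<lambda>t. ennreal ((\<phi> t)\<^sup>2)))"
  proof (intro unit_interval_measure.intro finite_measureI unit_interval_measure_axioms.intro)
    have "(\<integral>\<^sup>+ t. ennreal ((\<phi> t)\<^sup>2) \<partial>M) = ennreal (LINT t|M. (\<phi> t)\<^sup>2)"
      by (rule nn_integral_eq_integral) (use assms(2) square_integrable_imp_integrable_square in auto)
    moreover have "emeasure (density M (\<lambda>t. ennreal ((\<phi> t)\<^sup>2))) (space M) = (\<integral>\<^sup>+ t. ennreal ((\<phi> t)\<^sup>2) \<partial>M)"
      by (subst emeasure_density) (auto intro!: nn_integral_cong)
    ultimately show "emeasure (density M (\<lambda>t. ennreal ((\<phi> t)\<^sup>2))) (space (density M (\<lambda>t. ennreal ((\<phi> t)\<^sup>2)))) \<noteq> \<infinity>"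
      by simp
    show "AE t in density M (\<lambda>t. ennreal ((\<phi> t)\<^sup>2)). 0 \<le> t \<and> t \<le> 1"
      by (subst AE_density) (use AE_unit in \<open>auto elim: eventually_mono\<close>)
  qed simp
  show "(LINT t|density M (\<lambda>t. ennreal ((\<phi> t)\<^sup>2)). \<psi> t) = (LINT t|M. (\<phi> t)\<^sup>2 * \<psi> t)"
    if "\<psi> \<in> borel_measurable borel" for \<psi> :: "real \<Rightarrow> real"
    using that by (subst integral_density) auto
  show "square_integrable (density M (\<lambda>t. ennreal ((\<phi> t)\<^sup>2))) \<psi> \<longleftrightarrow>
      \<psi> \<in> borel_measurable borel \<and> square_integrable M (\<lambda>t. \<psi> t * \<phi> t)"
  proof (cases "\<psi> \<in> borel_measurable borel")
    case True
    then have "integrable (density M (\<lambda>t. ennreal ((\<phi> t)\<^sup>2))) (\<lambda>t. (\<psi> t)\<^sup>2)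
        \<longleftrightarrow> integrable M (\<lambda>t. (\<phi> t)\<^sup>2 *\<^sub>R (\<psi> t)\<^sup>2)"
      by (intro integrable_density) auto
    then show ?thesis
      using True by (simp add: square_integrable_def power_mult_distrib mult.commute)
  qed (simp add: square_integrable_def)
qed

section \<open>Domains, linearity and products in the functional calculus\<close>

context positive_contraction
begin

text \<open>The criterion for membership in the domain of an unbounded \<open>\<psi>\<close>:
  truncations are defined at every vector, and a uniform bound on their values is enough.\<close>

lemma square_integrable_mu_limit:
  assumes "\<psi> \<in> borel_measurable borel" "\<And>k. (norm (sop (truncate k \<psi>) x))\<^sup>2 \<le> C"
  shows "square_integrable (mu x) \<psi>"
  by (rule mu.square_integrable_truncate_limit[OF assms(1), of x C])
     (use assms in \<open>simp add: norm_sop_sq[symmetric]\<close>)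

lemma norm_sop_truncate_le:
  assumes "square_integrable (mu x) \<psi>"
  shows "(norm (sop (truncate k \<psi>) x))\<^sup>2 \<le> (LINT t|mu x. (\<psi> t)\<^sup>2)"
proof -
  have [measurable]: "\<psi> \<in> borel_measurable borel" using assms by (simp add: square_integrable_def)
  have "(LINT t|mu x. (truncate k \<psi> t)\<^sup>2) \<le> (LINT t|mu x. (\<psi> t)\<^sup>2)"
    by (rule integral_mono)
       (use assms truncate_abs_le in \<open>auto simp: mu.square_integrable_imp_integrable_square abs_le_square_iff[symmetric]\<close>)
  then show ?thesis by (simp add: norm_sop_sq)
qed

text \<open>Polynomials approximating in all three measures carry the additivity of
  \<open>op_poly\<close> over. The assumption on x + y holds automatically for truncations, and
  through them it is derived in general below.\<close>

lemma sop_vec_add_aux: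
  assumes "square_integrable (mu x) \<psi>" "square_integrable (mu y) \<psi>" "square_integrable (mu (x + y)) \<psi>"
  shows "sop \<psi> (x + y) = sop \<psi> x + sop \<psi> y"
proof -
  obtain p where "\<And>z. z \<in> {x, y, x + y} \<Longrightarrow> (\<lambda>n. op_poly (p n) z) \<longlonglongrightarrow> sop \<psi> z"
    by (rule sop_approx[of "{x, y, x + y}" \<psi>]) (use assms in \<open>auto simp: square_integrable_def\<close>)
  then have "(\<lambda>n. op_poly (p n) x) \<longlonglongrightarrow> sop \<psi> x" "(\<lambda>n. op_poly (p n) y) \<longlonglongrightarrow> sop \<psi> y"
    "(\<lambda>n. op_poly (p n) (x + y)) \<longlonglongrightarrow> sop \<psi> (x + y)" by auto
  from tendsto_add[OF this(1,2)] this(3) show ?thesis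
    unfolding op_poly_vec_add using LIMSEQ_unique by blast
qed

lemma sop_vec_scaleC_aux:
  assumes "square_integrable (mu x) \<psi>" "square_integrable (mu (c *\<^sub>C x)) \<psi>"
  shows "sop \<psi> (c *\<^sub>C x) = c *\<^sub>C sop \<psi> x"
proof -
  obtain p where "\<And>z. z \<in> {x, c *\<^sub>C x} \<Longrightarrow> (\<lambda>n. op_poly (p n) z) \<longlonglongrightarrow> sop \<psi> z"
    by (rule sop_approx[of "{x, c *\<^sub>C x}" \<psi>]) (use assms in \<open>auto simp: square_integrable_def\<close>)
  then have p: "(\<lambda>n. op_poly (p n) x) \<longlonglongrightarrow> sop \<psi> x"
    "(\<lambda>n. op_poly (p n) (c *\<^sub>C x)) \<longlonglongrightarrow> sop \<psi> (c *\<^sub>C x)" by auto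
  have "(\<lambda>n. c *\<^sub>C op_poly (p n) x) \<longlonglongrightarrow> c *\<^sub>C sop \<psi> x"
  proof -
    have "(\<lambda>n. norm (c *\<^sub>C op_poly (p n) x - c *\<^sub>C sop \<psi> x)) \<longlonglongrightarrow> cmod c * 0"
      unfolding cvec.scale_right_diff_distrib[symmetric] norm_scaleC
      by (rule tendsto_mult_left[OF tendsto_norm_diff[OF p(1)]])
    then show ?thesis by (simp add: tendsto_norm_zero_iff LIM_zero_iff)
  qed
  then show ?thesis
    using p(2) unfolding op_poly_vec_scaleC using LIMSEQ_unique by blast
qed

text \<open>The truncations are additive, so their values at x + y are bounded uniformly by the two
  given integrals.\<close>

lemma square_integrable_vec_add:
  assumes "square_integrable (mu x) \<psi>" "square_integrable (mu y) \<psi>"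
  shows "square_integrable (mu (x + y)) \<psi>"
proof (rule square_integrable_mu_limit)
  show meas: "\<psi> \<in> borel_measurable borel" using assms(1) by (simp add: square_integrable_def)
  fix k
  have "sop (truncate k \<psi>) (x + y) = sop (truncate k \<psi>) x + sop (truncate k \<psi>) y"
    by (rule sop_vec_add_aux) (use meas in auto)
  then show "(norm (sop (truncate k \<psi>) (x + y)))\<^sup>2 \<le> 2 * (LINT t|mu x. (\<psi> t)\<^sup>2) + 2 * (LINT t|mu y. (\<psi> t)\<^sup>2)"
    using norm_add_sq_le[of "sop (truncate k \<psi>) x" "sop (truncate k \<psi>) y"]
      norm_sop_truncate_le[OF assms(1), of k] norm_sop_truncate_le[OF assms(2), of k] by simp
qed

lemma square_integrable_vec_scaleC:
  assumes "square_integrable (mu x) \<psi>"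
  shows "square_integrable (mu (c *\<^sub>C x)) \<psi>"
proof (rule square_integrable_mu_limit)
  show meas: "\<psi> \<in> borel_measurable borel" using assms(1) by (simp add: square_integrable_def)
  fix k
  have "sop (truncate k \<psi>) (c *\<^sub>C x) = c *\<^sub>C sop (truncate k \<psi>) x"
    by (rule sop_vec_scaleC_aux) (use meas in auto)
  then show "(norm (sop (truncate k \<psi>) (c *\<^sub>C x)))\<^sup>2 \<le> (cmod c)\<^sup>2 * (LINT t|mu x. (\<psi> t)\<^sup>2)"
    using norm_sop_truncate_le[OF assms(1), of k]
    by (simp add: norm_scaleC power_mult_distrib mult_left_mono)
qed

lemma sop_vec_add:
  "square_integrable (mu x) \<psi> \<Longrightarrow> square_integrable (mu y) \<psi> \<Longrightarrow> sop \<psi> (x + y) = sop \<psi> x + sop \<psi> y"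
  by (rule sop_vec_add_aux) (auto intro: square_integrable_vec_add)

lemma sop_vec_scaleC: "square_integrable (mu x) \<psi> \<Longrightarrow> sop \<psi> (c *\<^sub>C x) = c *\<^sub>C sop \<psi> x"
  by (rule sop_vec_scaleC_aux) (auto intro: square_integrable_vec_scaleC)

lemma square_integrable_vec_diff:
  assumes "square_integrable (mu x) \<psi>" "square_integrable (mu y) \<psi>"
  shows "square_integrable (mu (x - y)) \<psi>" "sop \<psi> (x - y) = sop \<psi> x - sop \<psi> y"
proof -
  have minus: "square_integrable (mu (- y)) \<psi>" "sop \<psi> (- y) = - sop \<psi> y"
    using square_integrable_vec_scaleC[OF assms(2), of "-1"] sop_vec_scaleC[OF assms(2), of "-1"] by simp_all
  show "square_integrable (mu (x - y)) \<psi>" "sop \<psi> (x - y) = sop \<psi> x - sop \<psi> y"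
    using square_integrable_vec_add[OF assms(1) minus(1)] sop_vec_add[OF assms(1) minus(1)] minus(2)
    by simp_all
qed

lemma square_integrable_mu_zero:
  assumes meas: "\<psi> \<in> borel_measurable borel"
  shows "square_integrable (mu 0) \<psi>"
proof (rule square_integrable_mu_limit)
  fix k
  have "square_integrable (mu 0) (truncate k \<psi>)" using meas by simp
  from sop_vec_scaleC[OF this, of 0] show "(norm (sop (truncate k \<psi>) 0))\<^sup>2 \<le> 0" by simp
qed fact

lemma sop_self_adjoint:
  assumes "square_integrable (mu x) \<psi>" "square_integrable (mu y) \<psi>"
  shows "hip (sop \<psi> x) y = hip x (sop \<psi> y)"
proof -
  obtain p where "\<And>z. z \<in> {x, y} \<Longrightarrow> (\<lambda>n. op_poly (p n) z) \<longlonglongrightarrow> sop \<psi> z"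
    by (rule sop_approx[of "{x, y}" \<psi>]) (use assms in \<open>auto simp: square_integrable_def\<close>)
  then have p: "(\<lambda>n. op_poly (p n) x) \<longlonglongrightarrow> sop \<psi> x" "(\<lambda>n. op_poly (p n) y) \<longlonglongrightarrow> sop \<psi> y" by auto
  show ?thesis
    using tendsto_hip[OF p(1) tendsto_const, of y] tendsto_hip[OF tendsto_const p(2), of x]
    unfolding op_poly_self_adjoint by (rule LIMSEQ_unique)
qed

lemma hip_sop_self:
  assumes "square_integrable (mu x) \<psi>"
  shows "hip (sop \<psi> x) x = complex_of_real (LINT t|mu x. \<psi> t)"
proof -
  obtain p where p: "(\<lambda>n. LINT t|mu x. (poly (p n) t - \<psi> t)\<^sup>2) \<longlonglongrightarrow> 0" "(\<lambda>n. op_poly (p n) x) \<longlonglongrightarrow> sop \<psi> x"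
    by (rule sop_approx[of "{x}" \<psi>]) (use assms in \<open>auto simp: square_integrable_def\<close>)
  have "hip (op_poly q x) x = complex_of_real (LINT t|mu x. poly q t)" for q
    using hip_commute[of "op_poly q x" x] op_poly_self_adjoint[of q x x]
    by (simp add: integral_poly_mu complex_eq_iff)
  moreover have "(\<lambda>n. complex_of_real (LINT t|mu x. poly (p n) t)) \<longlonglongrightarrow> complex_of_real (LINT t|mu x. \<psi> t)"
    by (rule tendsto_of_real[OF mu.integral_tendsto_square_integrable[OF _ assms p(1)]]) simp
  ultimately show ?thesis
    using tendsto_hip[OF p(2) tendsto_const, of x] LIMSEQ_unique by simp
qed

lemma op_poly_sop:
  assumes "square_integrable (mu x) \<phi>"
  shows "op_poly p (sop \<phi> x) = sop (\<lambda>t. poly p t * \<phi> t) x"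
proof -
  obtain q where q: "(\<lambda>n. LINT t|mu x. (poly (q n) t - \<phi> t)\<^sup>2) \<longlonglongrightarrow> 0" "(\<lambda>n. op_poly (q n) x) \<longlonglongrightarrow> sop \<phi> x"
    by (rule sop_approx[of "{x}" \<phi>]) (use assms in \<open>auto simp: square_integrable_def\<close>)
  obtain C where C: "C > 0" "\<forall>t\<in>{0..1}. \<bar>poly p t\<bar> \<le> C" using poly_bounded_unit by blast
  have le: "(LINT t|mu x. (poly (p * q n) t - poly p t * \<phi> t)\<^sup>2) \<le> C\<^sup>2 * (LINT t|mu x. (poly (q n) t - \<phi> t)\<^sup>2)" for n
  proof -
    have "(LINT t|mu x. (poly (p * q n) t - poly p t * \<phi> t)\<^sup>2) \<le> (LINT t|mu x. C\<^sup>2 * (poly (q n) t - \<phi> t)\<^sup>2)"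
    proof (rule integral_mono_AE)
      show "integrable (mu x) (\<lambda>t. (poly (p * q n) t - poly p t * \<phi> t)\<^sup>2)"
        "integrable (mu x) (\<lambda>t. C\<^sup>2 * (poly (q n) t - \<phi> t)\<^sup>2)"
        using assms by (auto intro!: mu.square_integrable_imp_integrable_square)
      show "AE t in mu x. (poly (p * q n) t - poly p t * \<phi> t)\<^sup>2 \<le> C\<^sup>2 * (poly (q n) t - \<phi> t)\<^sup>2"
        using mu.AE_unit
      proof eventually_elim
        case (elim t)
        then have "(poly p t)\<^sup>2 \<le> C\<^sup>2" using C by (auto simp: abs_le_square_iff[symmetric])
        then show ?case
          by (simp add: right_diff_distrib[symmetric] power_mult_distrib mult_right_mono)
      qed
    qed
    then show ?thesis by simp
  qed
  have "(\<lambda>n. op_poly (p * q n) x) \<longlonglongrightarrow> sop (\<lambda>t. poly p t * \<phi> t) x"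
  proof (rule op_poly_tendsto_sop)
    let ?b = "\<lambda>n. C\<^sup>2 * (LINT t|mu x. (poly (q n) t - \<phi> t)\<^sup>2)"
    have b: "?b \<longlonglongrightarrow> 0" using tendsto_mult_left[OF q(1), of "C\<^sup>2"] by simp
    show "(\<lambda>n. LINT t|mu x. (poly (p * q n) t - poly p t * \<phi> t)\<^sup>2) \<longlonglongrightarrow> 0"
      by (rule tendsto_sandwich[of "\<lambda>_. 0" _ _ ?b, OF _ _ tendsto_const b]) (use le in auto)
  qed (use assms in simp)
  moreover have "(\<lambda>n. op_poly (p * q n) x) \<longlonglongrightarrow> op_poly p (sop \<phi> x)"
    unfolding op_poly_mult by (rule tendsto_op_poly[OF q(2)])
  ultimately show ?thesis using LIMSEQ_unique by blast
qed

text \<open>One sequence of polynomials approximates \<open>\<psi>\<close> in the measure of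
  \<open>sop \<phi> x\<close>, which yields the left side, and in the density \<open>N\<close>,
  which yields the right side.\<close>

lemma sop_sop_aux:
  assumes \<phi>: "square_integrable (mu x) \<phi>" and \<psi>\<phi>: "square_integrable (mu x) (\<lambda>t. \<psi> t * \<phi> t)"
    and \<psi>: "square_integrable (mu (sop \<phi> x)) \<psi>"
  shows "sop \<psi> (sop \<phi> x) = sop (\<lambda>t. \<psi> t * \<phi> t) x"
proof -
  define N where "N = density (mu x) (\<lambda>t. ennreal ((\<phi> t)\<^sup>2))"
  note N = density_square_unit_interval[OF unit_interval_measure_mu \<phi>, folded N_def]
  have [measurable]: "\<psi> \<in> borel_measurable borel" "\<phi> \<in> borel_measurable borel"
    using \<psi> \<phi> by (simp_all add: square_integrable_def)
  obtain p where p: "\<And>M. M \<in> {mu (sop \<phi> x), N} \<Longrightarrow> (\<lambda>n. LINT t|M. (poly (p n) t - \<psi> t)\<^sup>2) \<longlonglongrightarrow> 0"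
    by (rule poly_dense_sequence[of "{mu (sop \<phi> x), N}" \<psi>])
       (use \<psi> \<psi>\<phi> N(1,3) unit_interval_measure_mu in auto)
  have "(\<lambda>n. op_poly (p n) (sop \<phi> x)) \<longlonglongrightarrow> sop \<psi> (sop \<phi> x)"
    by (rule op_poly_tendsto_sop[OF \<psi>]) (use p in simp)
  moreover have "(\<lambda>n. sop (\<lambda>t. poly (p n) t * \<phi> t) x) \<longlonglongrightarrow> sop (\<lambda>t. \<psi> t * \<phi> t) x"
  proof (rule sop_tendsto)
    have "(LINT t|N. (poly (p n) t - \<psi> t)\<^sup>2) = (LINT t|mu x. (poly (p n) t * \<phi> t - \<psi> t * \<phi> t)\<^sup>2)" for n
      by (subst N(2)) (auto simp: power_mult_distrib[symmetric] right_diff_distrib mult.commute)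
    then show "(\<lambda>n. LINT t|mu x. (poly (p n) t * \<phi> t - \<psi> t * \<phi> t)\<^sup>2) \<longlonglongrightarrow> 0"
      using p[of N] by simp
  qed (use \<phi> \<psi>\<phi> in auto)
  ultimately show ?thesis
    unfolding op_poly_sop[OF \<phi>] by (rule LIMSEQ_unique)
qed

text \<open>The auxiliary product rule applies to the truncations of \<open>\<psi>\<close>, and
  their values at \<open>sop \<phi> x\<close> are bounded by the L2 norm of the product; this puts
  \<open>sop \<phi> x\<close> into the domain of \<open>\<psi>\<close>.\<close>

lemma sop_sop:
  assumes \<phi>: "square_integrable (mu x) \<phi>" and \<psi>\<phi>: "square_integrable (mu x) (\<lambda>t. \<psi> t * \<phi> t)"
    and [measurable]: "\<psi> \<in> borel_measurable borel"
  shows "square_integrable (mu (sop \<phi> x)) \<psi>" "sop \<psi> (sop \<phi> x) = sop (\<lambda>t. \<psi> t * \<phi> t) x"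
proof -
  have [measurable]: "\<phi> \<in> borel_measurable borel" using \<phi> by (simp add: square_integrable_def)
  show *: "square_integrable (mu (sop \<phi> x)) \<psi>"
  proof (rule square_integrable_mu_limit)
    fix k
    have sq: "square_integrable (mu x) (\<lambda>t. truncate k \<psi> t * \<phi> t)"
      by (rule mu.square_integrable_mono[OF \<psi>\<phi>])
         (use truncate_abs_le[of k \<psi>] in \<open>auto simp: abs_mult intro: mult_right_mono\<close>)
    have "sop (truncate k \<psi>) (sop \<phi> x) = sop (\<lambda>t. truncate k \<psi> t * \<phi> t) x"
      by (rule sop_sop_aux[OF \<phi> sq]) simp
    moreover have "(LINT t|mu x. (truncate k \<psi> t * \<phi> t)\<^sup>2) \<le> (LINT t|mu x. (\<psi> t * \<phi> t)\<^sup>2)"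
    proof (rule integral_mono)
      fix t
      have "(truncate k \<psi> t)\<^sup>2 \<le> (\<psi> t)\<^sup>2" using truncate_abs_le[of k \<psi> t] by (simp add: abs_le_square_iff)
      then show "(truncate k \<psi> t * \<phi> t)\<^sup>2 \<le> (\<psi> t * \<phi> t)\<^sup>2"
        by (simp add: power_mult_distrib mult_right_mono)
    qed (use sq \<psi>\<phi> in \<open>auto intro: mu.square_integrable_imp_integrable_square\<close>)
    ultimately show "(norm (sop (truncate k \<psi>) (sop \<phi> x)))\<^sup>2 \<le> (LINT t|mu x. (\<psi> t * \<phi> t)\<^sup>2)"
      by (simp add: norm_sop_sq[OF sq])
  qed simp
  show "sop \<psi> (sop \<phi> x) = sop (\<lambda>t. \<psi> t * \<phi> t) x"
    by (rule sop_sop_aux[OF \<phi> \<psi>\<phi> *])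
qed

text \<open>Spectral cut-offs to the sets where \<open>\<psi>\<close> is bounded converge strongly
  to the identity. The vectors they produce lie in the domain of \<open>\<psi>\<close>, which is
  therefore dense.\<close>

lemma sop_truncate_indicator_tendsto:
  assumes "\<psi> \<in> borel_measurable borel"
  shows "(\<lambda>k. sop (\<lambda>t. indicator {t. \<bar>\<psi> t\<bar> \<le> real k} t) x) \<longlonglongrightarrow> x"
proof -
  have [measurable]: "{t. \<bar>\<psi> t\<bar> \<le> real k} \<in> sets borel" for k
    using assms by measurable
  have "(\<lambda>k. sop (\<lambda>t. indicator {t. \<bar>\<psi> t\<bar> \<le> real k} t) x) \<longlonglongrightarrow> sop (poly 1) x"
  proof (rule sop_tendsto)
    show "(\<lambda>n. LINT t|mu x. (indicator {t. \<bar>\<psi> t\<bar> \<le> real n} t - poly 1 t)\<^sup>2) \<longlonglongrightarrow> 0"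
    proof (rule mu.integral_square_diff_tendsto_0[of _ _ _ "\<lambda>_. 1"])
      fix t
      obtain N where N: "\<bar>\<psi> t\<bar> \<le> real N" using real_arch_simple by blast
      have "\<forall>\<^sub>F n in sequentially. indicator {t. \<bar>\<psi> t\<bar> \<le> real n} t = poly 1 t"
        using eventually_ge_at_top[of N] by eventually_elim (use N in auto)
      then show "(\<lambda>n. indicator {t. \<bar>\<psi> t\<bar> \<le> real n} t) \<longlonglongrightarrow> poly 1 t"
        by (rule tendsto_eventually)
    qed (auto split: split_indicator intro: mu.square_integrable_bounded[of _ 1])
  qed auto
  then show ?thesis unfolding sop_poly by simp
qed

lemma square_integrable_sop_indicator:
  assumes [measurable]: "\<psi> \<in> borel_measurable borel"
  shows "square_integrable (mu (sop (\<lambda>t. indicator {t. \<bar>\<psi> t\<bar> \<le> real k} t) x)) \<psi>"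
    and "sop \<psi> (sop (\<lambda>t. indicator {t. \<bar>\<psi> t\<bar> \<le> real k} t) x) = sop (truncate k \<psi>) x"
proof -
  have [measurable]: "{t. \<bar>\<psi> t\<bar> \<le> real k} \<in> sets borel" by measurable
  have eq: "(\<lambda>t. \<psi> t * indicator {t. \<bar>\<psi> t\<bar> \<le> real k} t) = truncate k \<psi>"
    by (auto simp: truncate_def)
  have "square_integrable (mu x) (\<lambda>t. indicator {t. \<bar>\<psi> t\<bar> \<le> real k} t)" by simp
  from sop_sop[OF this, of \<psi>]
  show "square_integrable (mu (sop (\<lambda>t. indicator {t. \<bar>\<psi> t\<bar> \<le> real k} t) x)) \<psi>"
    "sop \<psi> (sop (\<lambda>t. indicator {t. \<bar>\<psi> t\<bar> \<le> real k} t) x) = sop (truncate k \<psi>) x"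
    by (simp_all add: eq)
qed

lemma sop_domain_dense:
  assumes "\<psi> \<in> borel_measurable borel"
  shows "closure {x. square_integrable (mu x) \<psi>} = UNIV"
proof -
  have "x \<in> closure {x. square_integrable (mu x) \<psi>}" for x
    unfolding closure_sequential
    by (rule exI[of _ "\<lambda>k. sop (\<lambda>t. indicator {t. \<bar>\<psi> t\<bar> \<le> real k} t) x"])
       (use sop_truncate_indicator_tendsto[OF assms, of x] square_integrable_sop_indicator(1)[OF assms] in auto)
  then show ?thesis by auto
qed

text \<open>The hard half of self-adjointness: the adjoint has no larger domain. Testing the adjoint
  relation on cut-off vectors identifies the truncation of \<open>\<psi>\<close> at y with a cut-off
  of z, so all truncations at y are bounded by the norm of z.\<close>

lemma sop_adjoint_domain:
  assumes [measurable]: "\<psi> \<in> borel_measurable borel"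
    and z: "\<And>x. square_integrable (mu x) \<psi> \<Longrightarrow> hip (sop \<psi> x) y = hip x z"
  shows "square_integrable (mu y) \<psi>"
proof (rule square_integrable_mu_limit)
  fix k
  have [measurable]: "{t. \<bar>\<psi> t\<bar> \<le> real k} \<in> sets borel" by measurable
  let ?\<iota> = "\<lambda>t. indicator {t. \<bar>\<psi> t\<bar> \<le> real k} t :: real"
  have "sop (truncate k \<psi>) y = sop ?\<iota> z"
  proof (rule hip_eqI[of UNIV])
    fix w
    have "hip w (sop (truncate k \<psi>) y) = hip (sop \<psi> (sop ?\<iota> w)) y"
      by (simp add: square_integrable_sop_indicator(2) sop_self_adjoint)
    also have "\<dots> = hip (sop ?\<iota> w) z" by (rule z) (rule square_integrable_sop_indicator, simp)
    also have "\<dots> = hip w (sop ?\<iota> z)" by (rule sop_self_adjoint) auto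
    finally show "hip (sop (truncate k \<psi>) y) w = hip (sop ?\<iota> z) w"
      using hip_commute by metis
  qed simp
  moreover have "(norm (sop ?\<iota> z))\<^sup>2 \<le> (LINT t|mu z. 1)"
    unfolding norm_sop_sq[OF mu.square_integrable_indicator[OF \<open>{t. \<bar>\<psi> t\<bar> \<le> real k} \<in> sets borel\<close>]]
    by (rule integral_mono) (auto intro!: mu.square_integrable_imp_integrable_square split: split_indicator)
  ultimately show "(norm (sop (truncate k \<psi>) y))\<^sup>2 \<le> (LINT t|mu z. 1)" by simp
qed simp

end

section \<open>Spectral measures\<close>

context positive_contraction
begin

definition sop_operator :: "(real \<Rightarrow> real) \<Rightarrow> ('a \<rightharpoonup> 'a)"
  where "sop_operator \<psi> = (\<lambda>x. if square_integrable (mu x) \<psi> then Some (sop \<psi> x) else None)"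

lemma dom_sop_operator: "dom (sop_operator \<psi>) = {x. square_integrable (mu x) \<psi>}"
  by (auto simp: sop_operator_def dom_def)

lemma the_sop_operator: "square_integrable (mu x) \<psi> \<Longrightarrow> the (sop_operator \<psi> x) = sop \<psi> x"
  by (simp add: sop_operator_def)

theorem self_adjoint_sop_operator:
  assumes meas: "\<psi> \<in> borel_measurable borel"
  shows "self_adjoint_operator (sop_operator \<psi>)"
proof -
  let ?D = "dom (sop_operator \<psi>)"
  have D: "x \<in> ?D \<longleftrightarrow> square_integrable (mu x) \<psi>" for x
    by (simp add: dom_sop_operator)
  have the: "the (sop_operator \<psi> x) = sop \<psi> x" if "x \<in> ?D" for x
    using that by (simp add: D the_sop_operator)
  have dense: "closure ?D = UNIV"
    unfolding dom_sop_operator by (rule sop_domain_dense[OF meas])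
  have sub: "csubspace ?D"
    by (rule cvec.subspaceI)
       (auto simp: D square_integrable_mu_zero meas square_integrable_vec_add square_integrable_vec_scaleC)
  have linear: "linear_operator (sop_operator \<psi>)"
    unfolding linear_operator_def
  proof (intro conjI ballI allI)
    fix x y assume "x \<in> ?D" "y \<in> ?D"
    then show "the (sop_operator \<psi> (x + y)) = the (sop_operator \<psi> x) + the (sop_operator \<psi> y)"
      by (simp add: D the_sop_operator square_integrable_vec_add sop_vec_add)
  next
    fix c x assume "x \<in> ?D"
    then show "the (sop_operator \<psi> (c *\<^sub>C x)) = c *\<^sub>C the (sop_operator \<psi> x)"
      by (simp add: D the_sop_operator square_integrable_vec_scaleC sop_vec_scaleC)
  qed (rule sub)
  have "adjoint_operator (sop_operator \<psi>) y = sop_operator \<psi> y" for y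
  proof (cases "square_integrable (mu y) \<psi>")
    case True
    have adj: "\<forall>x\<in>?D. hip (the (sop_operator \<psi> x)) y = hip x (sop \<psi> y)"
      using True by (auto simp: D the sop_self_adjoint)
    have "(THE z. \<forall>x\<in>?D. hip (the (sop_operator \<psi> x)) y = hip x z) = sop \<psi> y"
    proof (rule the_equality, rule adj)
      fix z assume z: "\<forall>x\<in>?D. hip (the (sop_operator \<psi> x)) y = hip x z"
      show "z = sop \<psi> y"
      proof (rule hip_eqI[OF dense])
        fix x assume "x \<in> ?D"
        then have "hip x z = hip x (sop \<psi> y)" using z adj by metis
        then show "hip z x = hip (sop \<psi> y) x" using hip_commute by metis
      qed
    qed
    then show ?thesis using adj True by (auto simp: adjoint_operator_def sop_operator_def)
  next
    case False
    have "\<not> (\<exists>z. \<forall>x\<in>?D. hip (the (sop_operator \<psi> x)) y = hip x z)"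
    proof
      assume "\<exists>z. \<forall>x\<in>?D. hip (the (sop_operator \<psi> x)) y = hip x z"
      then obtain z where "\<And>x. square_integrable (mu x) \<psi> \<Longrightarrow> hip (sop \<psi> x) y = hip x z"
        by (auto simp: D the_sop_operator)
      from sop_adjoint_domain[OF meas this] False show False by simp
    qed
    then show ?thesis using False by (simp add: adjoint_operator_def sop_operator_def)
  qed
  then show ?thesis
    unfolding self_adjoint_operator_def using linear dense by auto
qed

text \<open>The spectral measure of g(S), namely the image under g of that of \<open>S\<close>. In
  this way an unbounded operator gets its spectral measure from the calculus of the bounded
  \<open>S\<close>.\<close>

definition spectral_family :: "(real \<Rightarrow> real) \<Rightarrow> real set \<Rightarrow> 'a \<Rightarrow> 'a"
  where "spectral_family g B = sop (\<lambda>t. indicator B (g t))"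

lemma square_integrable_indicator_comp:
  assumes [measurable]: "g \<in> borel_measurable borel" "B \<in> sets borel"
  shows "square_integrable (mu x) (\<lambda>t. indicator B (g t))"
  by (rule mu.square_integrable_bounded[of _ 1]) (auto simp: indicator_def)

theorem spectral_measure_spectral_family:
  assumes g [measurable]: "g \<in> borel_measurable borel"
  shows "spectral_measure (spectral_family g)"
  unfolding spectral_measure_def
proof (intro conjI allI impI ballI)
  fix B :: "real set" assume B: "B \<in> sets borel"
  have sq: "square_integrable (mu x) (\<lambda>t. indicator B (g t))" for x
    by (rule square_integrable_indicator_comp[OF g B])
  have idem: "(\<lambda>t. indicator B (g t) * indicator B (g t)) = (\<lambda>t. indicator B (g t) :: real)"
    by (auto simp: indicator_def)
  show "orthogonal_projection (spectral_family g B)"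
    unfolding orthogonal_projection_def spectral_family_def
  proof (intro conjI allI)
    show "Vector_Spaces.linear scaleC scaleC (sop (\<lambda>t. indicator B (g t)))"
      by unfold_locales (simp_all add: sop_vec_add sop_vec_scaleC sq)
    show "sop (\<lambda>t. indicator B (g t)) (sop (\<lambda>t. indicator B (g t)) x) = sop (\<lambda>t. indicator B (g t)) x" for x
      using sop_sop(2)[OF sq[of x], of "\<lambda>t. indicator B (g t)"] sq[of x] unfolding idem
      by (simp add: square_integrable_def)
    show "hip (sop (\<lambda>t. indicator B (g t)) x) y = hip x (sop (\<lambda>t. indicator B (g t)) y)" for x y
      by (rule sop_self_adjoint[OF sq sq])
  qed
next
  fix x
  have "poly 1 = (\<lambda>t. indicator UNIV (g t) :: real)" by auto
  then show "spectral_family g UNIV x = x"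
    using sop_poly[of 1 x] by (simp add: spectral_family_def)
next
  fix A :: "nat \<Rightarrow> real set" and x
  assume A: "range A \<subseteq> sets borel" "disjoint_family A"
  have [measurable]: "A i \<in> sets borel" for i using A(1) by auto
  have sq: "square_integrable (mu x) (\<lambda>t. indicator (A i) (g t))" for i
    by (rule square_integrable_indicator_comp) simp_all
  \<comment> \<open>Disjointness collapses the partial sums to finite unions, so countable
    additivity becomes dominated convergence of indicators.\<close>
  have part: "(\<Sum>i<n. spectral_family g (A i) x) = spectral_family g (\<Union>i<n. A i) x" for n
  proof (induction n)
    case 0
    have "poly 0 = (\<lambda>t. indicator {} (g t) :: real)" by auto
    then show ?case using sop_poly[of 0 x] by (simp add: spectral_family_def)
  next
    case (Suc n)
    have "A n \<inter> A i = {}" if "i < n" for i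
      using disjoint_family_onD[OF A(2), of n i] that by simp
    then have "A n \<inter> (\<Union>i<n. A i) = {}" by blast
    then have "(\<lambda>t. indicator (\<Union>i<Suc n. A i) (g t) :: real)
        = (\<lambda>t. indicator (\<Union>i<n. A i) (g t) + indicator (A n) (g t))"
      by (auto simp: fun_eq_iff lessThan_Suc indicator_def)
    moreover have "square_integrable (mu x) (\<lambda>t. indicator (\<Union>i<n. A i) (g t))"
      by (rule square_integrable_indicator_comp) simp_all
    ultimately show ?case using Suc by (simp add: spectral_family_def sop_add sq)
  qed
  have meas: "(\<lambda>t. indicator C (g t) :: real) \<in> borel_measurable borel" if "C \<in> sets borel" for C
    using square_integrable_indicator_comp[OF g that] by (simp add: square_integrable_def)
  have "(\<lambda>n. spectral_family g (\<Union>i<n. A i) x) \<longlonglongrightarrow> spectral_family g (\<Union>i. A i) x"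
    unfolding spectral_family_def
  proof (rule sop_tendsto)
    show "(\<lambda>n. LINT t|mu x. (indicator (\<Union>i<n. A i) (g t) - (indicator (\<Union>i. A i) (g t) :: real))\<^sup>2) \<longlonglongrightarrow> 0"
      by (rule mu.integral_square_diff_tendsto_0[where w = "\<lambda>_. 1" and \<phi> = "\<lambda>n t. indicator (\<Union>i<n. A i) (g t)"
            and \<psi> = "\<lambda>t. indicator (\<Union>i. A i) (g t)"])
         (auto intro: meas mu.square_integrable_bounded[of _ 1] LIMSEQ_indicator_UN simp: indicator_le_1)
  qed (auto intro!: square_integrable_indicator_comp)
  then show "(\<lambda>i. spectral_family g (A i) x) sums spectral_family g (\<Union>i. A i) x"
    unfolding sums_def part .
qed

lemma spectral_scalar_measure_spectral_family:
  assumes [measurable]: "g \<in> borel_measurable borel"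
  shows "spectral_scalar_measure (spectral_family g) x = distr (mu x) borel g"
proof -
  have "ennreal (Re (hip (spectral_family g B x) x)) = emeasure (distr (mu x) borel g) B"
    if [measurable]: "B \<in> sets borel" for B
  proof -
    have "hip (spectral_family g B x) x = complex_of_real (LINT t|mu x. indicator B (g t))"
      unfolding spectral_family_def by (rule hip_sop_self) (rule square_integrable_indicator_comp, simp_all)
    also have "(LINT t|mu x. indicator B (g t) :: real) = (LINT t|distr (mu x) borel g. indicator B t)"
      by (subst integral_distr) auto
    also have "\<dots> = measure (distr (mu x) borel g) B" by simp
    finally have "Re (hip (spectral_family g B x) x) = measure (distr (mu x) borel g) B" by simp
    moreover have "finite_measure (distr (mu x) borel g)" by (rule mu.finite_measure_distr) simp
    ultimately show ?thesis by (simp add: finite_measure.emeasure_eq_measure)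
  qed
  then have "spectral_scalar_measure (spectral_family g) x
      = measure_of UNIV (sets borel) (emeasure (distr (mu x) borel g))"
    unfolding spectral_scalar_measure_def
    by (intro measure_of_eq) (auto simp: sets.sigma_sets_eq[of "borel :: real measure", simplified])
  also have "\<dots> = distr (mu x) borel g"
    using measure_of_of_measure[of "distr (mu x) borel g"] by simp
  finally show ?thesis .
qed

text \<open>Change of variables along g. The identity as h shows that the family represents g(S);
  any other h gives h(g(S)) through the same family.\<close>

theorem spectral_integral_spectral_family:
  assumes [measurable]: "g \<in> borel_measurable borel" "h \<in> borel_measurable borel"
  shows "spectral_integral (spectral_family g) h = sop_operator (\<lambda>t. h (g t))"
proof -
  let ?D = "spectral_domain (spectral_family g) h" and ?\<psi> = "\<lambda>t. h (g t)"
  have D: "x \<in> ?D \<longleftrightarrow> square_integrable (mu x) ?\<psi>" for x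
    by (simp add: spectral_domain_def spectral_scalar_measure_spectral_family square_integrable_def
        integrable_distr_eq)
  have form: "spectral_form (spectral_family g) h x z = hip (sop ?\<psi> x) z" if x: "x \<in> ?D" and z: "z \<in> ?D" for x z
  proof -
    \<comment> \<open>Each term of the form is thus a diagonal value of \<open>sop\<close> at the
      composed function, and the four of them recombine by polarization.\<close>
    have q: "complex_of_real (LINT t|spectral_scalar_measure (spectral_family g) u. h t) = hip (sop ?\<psi> u) u"
      if "square_integrable (mu u) ?\<psi>" for u
      unfolding spectral_scalar_measure_spectral_family[OF assms(1)] hip_sop_self[OF that]
      by (subst integral_distr) auto
    have sq: "square_integrable (mu x) ?\<psi>" "square_integrable (mu z) ?\<psi>"
      "square_integrable (mu (\<i> *\<^sub>C z)) ?\<psi>"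
      using x z D square_integrable_vec_scaleC by auto
    show ?thesis
      unfolding spectral_form_def Let_def
      by (simp add: q sq square_integrable_vec_add square_integrable_vec_diff sop_vec_add sop_vec_scaleC
          hip_add_left hip_add_right hip_diff_left hip_diff_right hip_scaleC_left hip_scaleC_right algebra_simps)
  qed
  have dense: "closure ?D = UNIV"
  proof -
    have "?D = {x. square_integrable (mu x) ?\<psi>}" using D by auto
    then show ?thesis using sop_domain_dense[of ?\<psi>] by simp
  qed
  have "(THE y. \<forall>z\<in>?D. hip y z = spectral_form (spectral_family g) h x z) = sop ?\<psi> x" if "x \<in> ?D" for x
  proof (rule the_equality)
    show "\<forall>z\<in>?D. hip (sop ?\<psi> x) z = spectral_form (spectral_family g) h x z"
      using form[OF that] by simp
    fix y assume "\<forall>z\<in>?D. hip y z = spectral_form (spectral_family g) h x z"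
    then show "y = sop ?\<psi> x"
      using form[OF that] by (intro hip_eqI[OF dense]) simp
  qed
  then show ?thesis
    by (auto simp: spectral_integral_def sop_operator_def D fun_eq_iff)
qed

end

section \<open>The fundamental symmetry as the reflection of the spectrum about 1/2\<close>

locale fund_sym_contraction = positive_contraction +
  assumes S_fund_sym: "S (fund_sym x) = fund_sym (x - S x)"
begin

lemma op_poly_fund_sym: "op_poly p (fund_sym x) = fund_sym (op_poly (pcompose p [:1, -1:]) x)"
proof (induction p)
  case (pCons a p)
  have "op_poly (pcompose (pCons a p) [:1, -1:]) x
      = a *\<^sub>R x + (op_poly (pcompose p [:1, -1:]) x - S (op_poly (pcompose p [:1, -1:]) x))"
    by (simp add: pcompose_pCons op_poly_add op_poly_smult op_poly_minus)
  then show ?case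
    using fund_sym_scaleC[of "complex_of_real a" x]
    by (simp add: pCons S_fund_sym fund_sym_additive scaleR_scaleC)
qed simp

text \<open>The reflected measure is what the measure of \<open>fund_sym x\<close> ought to be.
  \<open>sop_fund_sym_aux\<close> approximates in both of them with the same polynomials.\<close>

lemma reflected_mu:
  shows "unit_interval_measure (distr (mu x) borel (\<lambda>t. 1 - t))"
    and "\<psi> \<in> borel_measurable borel \<Longrightarrow>
      (LINT t|distr (mu x) borel (\<lambda>t. 1 - t). \<psi> t) = (LINT t|mu x. \<psi> (1 - t))"
    and "\<psi> \<in> borel_measurable borel \<Longrightarrow> square_integrable (distr (mu x) borel (\<lambda>t. 1 - t)) \<psi> \<longleftrightarrow>
      square_integrable (mu x) (\<lambda>t. \<psi> (1 - t))"
proof -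
  show "unit_interval_measure (distr (mu x) borel (\<lambda>t. 1 - t))"
  proof (intro unit_interval_measure.intro unit_interval_measure_axioms.intro)
    show "AE t in distr (mu x) borel (\<lambda>t. 1 - t). 0 \<le> t \<and> t \<le> 1"
      by (subst AE_distr_iff) (use mu.AE_unit[of x] in \<open>auto elim: eventually_mono\<close>)
  qed (auto intro: mu.finite_measure_distr)
  show "(LINT t|distr (mu x) borel (\<lambda>t. 1 - t). \<psi> t) = (LINT t|mu x. \<psi> (1 - t))"
    if "\<psi> \<in> borel_measurable borel" for \<psi> :: "real \<Rightarrow> real"
    using that by (subst integral_distr) auto
  show "square_integrable (distr (mu x) borel (\<lambda>t. 1 - t)) \<psi> \<longleftrightarrow> square_integrable (mu x) (\<lambda>t. \<psi> (1 - t))"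
    if [measurable]: "\<psi> \<in> borel_measurable borel"
    by (auto simp: square_integrable_def integrable_distr_eq)
qed

lemma sop_fund_sym_aux:
  assumes J\<psi>: "square_integrable (mu x) (\<lambda>t. \<psi> (1 - t))" and \<psi>: "square_integrable (mu (fund_sym x)) \<psi>"
  shows "sop \<psi> (fund_sym x) = fund_sym (sop (\<lambda>t. \<psi> (1 - t)) x)"
proof -
  have [measurable]: "\<psi> \<in> borel_measurable borel" using \<psi> by (simp add: square_integrable_def)
  let ?N = "distr (mu x) borel (\<lambda>t. 1 - t)"
  obtain p where p: "\<And>M. M \<in> {mu (fund_sym x), ?N} \<Longrightarrow> (\<lambda>n. LINT t|M. (poly (p n) t - \<psi> t)\<^sup>2) \<longlonglongrightarrow> 0"
    by (rule poly_dense_sequence[of "{mu (fund_sym x), ?N}" \<psi>])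
       (use \<psi> J\<psi> reflected_mu unit_interval_measure_mu in auto)
  have "(\<lambda>n. op_poly (p n) (fund_sym x)) \<longlonglongrightarrow> sop \<psi> (fund_sym x)"
    by (rule op_poly_tendsto_sop[OF \<psi>]) (use p in simp)
  moreover have "(\<lambda>n. op_poly (pcompose (p n) [:1, -1:]) x) \<longlonglongrightarrow> sop (\<lambda>t. \<psi> (1 - t)) x"
  proof (rule op_poly_tendsto_sop[OF J\<psi>])
    have "(LINT t|?N. (poly (p n) t - \<psi> t)\<^sup>2) = (LINT t|mu x. (poly (pcompose (p n) [:1, -1:]) t - \<psi> (1 - t))\<^sup>2)" for n
      by (subst reflected_mu(2)) (auto simp: poly_pcompose)
    then show "(\<lambda>n. LINT t|mu x. (poly (pcompose (p n) [:1, -1:]) t - \<psi> (1 - t))\<^sup>2) \<longlonglongrightarrow> 0"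
      using p[of ?N] by simp
  qed
  from tendsto_fund_sym[OF this]
  have "(\<lambda>n. op_poly (p n) (fund_sym x)) \<longlonglongrightarrow> fund_sym (sop (\<lambda>t. \<psi> (1 - t)) x)"
    unfolding op_poly_fund_sym .
  ultimately show ?thesis by (rule LIMSEQ_unique)
qed

lemma sop_fund_sym:
  assumes [measurable]: "\<psi> \<in> borel_measurable borel"
    and J\<psi>: "square_integrable (mu x) (\<lambda>t. \<psi> (1 - t))"
  shows "square_integrable (mu (fund_sym x)) \<psi>"
    and "sop \<psi> (fund_sym x) = fund_sym (sop (\<lambda>t. \<psi> (1 - t)) x)"
proof -
  show *: "square_integrable (mu (fund_sym x)) \<psi>"
  proof (rule square_integrable_mu_limit)
    fix k
    have trunc: "(\<lambda>t. truncate k \<psi> (1 - t)) = truncate k (\<lambda>t. \<psi> (1 - t))"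
      by (simp add: truncate_def fun_eq_iff)
    have "sop (truncate k \<psi>) (fund_sym x) = fund_sym (sop (truncate k (\<lambda>t. \<psi> (1 - t))) x)"
      using sop_fund_sym_aux[of x "truncate k \<psi>"] by (simp add: trunc)
    then show "(norm (sop (truncate k \<psi>) (fund_sym x)))\<^sup>2 \<le> (LINT t|mu x. (\<psi> (1 - t))\<^sup>2)"
      using norm_sop_truncate_le[OF J\<psi>, of k] by simp
  qed simp
  show "sop \<psi> (fund_sym x) = fund_sym (sop (\<lambda>t. \<psi> (1 - t)) x)"
    by (rule sop_fund_sym_aux[OF J\<psi> *])
qed

theorem anticommutes_sop_operator:
  assumes [measurable]: "\<psi> \<in> borel_measurable borel" and odd: "\<And>t. \<psi> (1 - t) = - \<psi> t"
  shows "anticommutes_fund_sym (sop_operator \<psi>)"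
proof -
  have J: "square_integrable (mu (fund_sym x)) \<psi>" "sop \<psi> (fund_sym x) = - fund_sym (sop \<psi> x)"
    if "square_integrable (mu x) \<psi>" for x
  proof -
    have "square_integrable (mu x) (\<lambda>t. \<psi> (1 - t))" "sop (\<lambda>t. \<psi> (1 - t)) x = - sop \<psi> x"
      using mu.square_integrable_cmult[OF that, of "-1"] sop_cmult[OF that, of "-1"] by (simp_all add: odd)
    with sop_fund_sym[of \<psi> x] show "square_integrable (mu (fund_sym x)) \<psi>"
      "sop \<psi> (fund_sym x) = - fund_sym (sop \<psi> x)" by simp_all
  qed
  have "fund_sym ` dom (sop_operator \<psi>) = dom (sop_operator \<psi>)"
  proof (intro equalityI subsetI)
    fix x assume "x \<in> dom (sop_operator \<psi>)"
    then have "fund_sym x \<in> dom (sop_operator \<psi>)" using J by (simp add: dom_sop_operator)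
    then show "x \<in> fund_sym ` dom (sop_operator \<psi>)" by (metis fund_sym_idem imageI)
  qed (use J in \<open>auto simp: dom_sop_operator\<close>)
  then show ?thesis
    unfolding anticommutes_fund_sym_def
    using J by (auto simp: dom_sop_operator the_sop_operator)
qed

end

section \<open>Pairs of maximal definite subspaces\<close>

lemma hip_krein_decomp:
  "hip x y = hip (krein_proj_pos x) (krein_proj_pos y) + hip (krein_proj_neg x) (krein_proj_neg (y :: 'a::krein_space))"
proof -
  have "hip x y = hip (krein_proj_pos x) y + hip (krein_proj_neg x) y"
    by (simp add: hip_add_left[symmetric] krein_proj_add)
  also have "hip (krein_proj_pos x) y = hip (krein_proj_pos x) (krein_proj_pos y)"
    by (metis pos.idem pos.self_adjoint)
  also have "hip (krein_proj_neg x) y = hip (krein_proj_neg x) (krein_proj_neg y)"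
    by (metis neg.idem neg.self_adjoint)
  finally show ?thesis .
qed

lemma krein_proj_cross [simp]:
  "krein_proj_pos (krein_proj_neg x) = 0" "krein_proj_neg (krein_proj_pos (x :: 'a::krein_space)) = 0"
  by (simp_all add: krein_proj_neg_eq[of x] krein_proj_neg_eq[of "krein_proj_pos x"] pos.diff)

lemma krein_proj_fund_sym:
  "krein_proj_pos (fund_sym x) = krein_proj_pos x"
  "krein_proj_neg (fund_sym x) = - krein_proj_neg (x :: 'a::krein_space)"
  by (simp_all add: krein_proj_pos_def krein_proj_neg_def add.commute flip: scaleR_minus_right)

lemma kip_krein_decomp:
  "kip x y = hip (krein_proj_pos x) (krein_proj_pos y) - hip (krein_proj_neg x) (krein_proj_neg (y :: 'a::krein_space))"
  by (simp add: kip_eq_hip hip_krein_decomp[of "fund_sym x"] krein_proj_fund_sym)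

lemma norm_krein_decomp:
  "(norm (x :: 'a::krein_space))\<^sup>2 = (norm (krein_proj_pos x))\<^sup>2 + (norm (krein_proj_neg x))\<^sup>2"
  by (simp add: norm_sq_eq_hip hip_krein_decomp[of x x])

lemma Re_kip_self:
  "Re (kip x x) = (norm (krein_proj_pos x))\<^sup>2 - (norm (krein_proj_neg (x :: 'a::krein_space)))\<^sup>2"
  by (simp add: kip_krein_decomp norm_sq_eq_hip)

lemma Re_kip_self_pos_iff:
  "0 < Re (kip x x) \<longleftrightarrow> norm (krein_proj_neg x) < norm (krein_proj_pos (x :: 'a::krein_space))"
  by (simp add: Re_kip_self power_mono_iff linorder_not_le[symmetric] del: not_le)

lemma Re_kip_self_neg_iff:
  "Re (kip x x) < 0 \<longleftrightarrow> norm (krein_proj_pos x) < norm (krein_proj_neg (x :: 'a::krein_space))"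
  by (simp add: Re_kip_self power_mono_iff linorder_not_le[symmetric] del: not_le)

lemma maximal_positive_proj:
  assumes "maximal_positive (L :: 'a::krein_space set)"
  shows "krein_proj_pos ` L = range krein_proj_pos"
proof (rule pos.maximal_graph_proj_surj)
  have pos: "positive_subspace L" and max: "\<And>L'. positive_subspace L' \<Longrightarrow> L \<subseteq> L' \<Longrightarrow> L' = L"
    using assms by (auto simp: maximal_positive_def)
  show "csubspace L" "closed L" using pos by (auto simp: positive_subspace_def)
  show "norm (x - krein_proj_pos x) < norm (krein_proj_pos x)" if "x \<in> L" "x \<noteq> 0" for x
    using pos that by (auto simp: positive_subspace_def Re_kip_self_pos_iff krein_proj_neg_eq)
  show "L' = L" if "csubspace L'" "closed L'" "L \<subseteq> L'"
    "\<And>x. x \<in> L' \<Longrightarrow> x \<noteq> 0 \<Longrightarrow> norm (x - krein_proj_pos x) < norm (krein_proj_pos x)" for L'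
    using that by (intro max) (auto simp: positive_subspace_def Re_kip_self_pos_iff krein_proj_neg_eq)
qed

lemma maximal_negative_proj:
  assumes "maximal_negative (L :: 'a::krein_space set)"
  shows "krein_proj_neg ` L = range krein_proj_neg"
proof (rule neg.maximal_graph_proj_surj)
  have neg: "negative_subspace L" and max: "\<And>L'. negative_subspace L' \<Longrightarrow> L \<subseteq> L' \<Longrightarrow> L' = L"
    using assms by (auto simp: maximal_negative_def)
  show "csubspace L" "closed L" using neg by (auto simp: negative_subspace_def)
  show "norm (x - krein_proj_neg x) < norm (krein_proj_neg x)" if "x \<in> L" "x \<noteq> 0" for x
    using neg that by (auto simp: negative_subspace_def Re_kip_self_neg_iff krein_proj_pos_eq)
  show "L' = L" if "csubspace L'" "closed L'" "L \<subseteq> L'"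
    "\<And>x. x \<in> L' \<Longrightarrow> x \<noteq> 0 \<Longrightarrow> norm (x - krein_proj_neg x) < norm (krein_proj_neg x)" for L'
    using that by (intro max) (auto simp: negative_subspace_def Re_kip_self_neg_iff krein_proj_pos_eq)
qed

locale J_orthogonal_pair =
  fixes Lp Ln :: "'a::krein_space set"
  assumes max_pos: "maximal_positive Lp" and max_neg: "maximal_negative Ln"
    and J_orth: "J_orthogonal Lp Ln"
begin

lemma subspace_pos: "csubspace Lp" and subspace_neg: "csubspace Ln"
  using max_pos max_neg
  by (auto simp: maximal_positive_def maximal_negative_def positive_subspace_def negative_subspace_def)

lemma pos_lt: "x \<in> Lp \<Longrightarrow> x \<noteq> 0 \<Longrightarrow> norm (krein_proj_neg x) < norm (krein_proj_pos x)"
  using max_pos by (auto simp: maximal_positive_def positive_subspace_def Re_kip_self_pos_iff)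

lemma neg_lt: "x \<in> Ln \<Longrightarrow> x \<noteq> 0 \<Longrightarrow> norm (krein_proj_pos x) < norm (krein_proj_neg x)"
  using max_neg by (auto simp: maximal_negative_def negative_subspace_def Re_kip_self_neg_iff)

lemma pos_le: "x \<in> Lp \<Longrightarrow> norm (krein_proj_neg x) \<le> norm (krein_proj_pos x)"
  using pos_lt by (cases "x = 0") (auto intro: less_imp_le)

lemma neg_le: "x \<in> Ln \<Longrightarrow> norm (krein_proj_pos x) \<le> norm (krein_proj_neg x)"
  using neg_lt by (cases "x = 0") (auto intro: less_imp_le)

text \<open>With \<open>Lp\<close> the graph of an angular operator K, this is the projection onto
  \<open>krein_pos\<close> followed by I + K: the point of \<open>Lp\<close> lying over the positive
  component of x.\<close>

definition lift_pos :: "'a \<Rightarrow> 'a"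
  where "lift_pos x = (SOME a. a \<in> Lp \<and> krein_proj_pos a = krein_proj_pos x)"

definition lift_neg :: "'a \<Rightarrow> 'a"
  where "lift_neg x = (SOME b. b \<in> Ln \<and> krein_proj_neg b = krein_proj_neg x)"

lemma lift_pos: "lift_pos x \<in> Lp" "krein_proj_pos (lift_pos x) = krein_proj_pos x"
proof -
  have "krein_proj_pos x \<in> krein_proj_pos ` Lp" using maximal_positive_proj[OF max_pos] by blast
  then have "\<exists>a. a \<in> Lp \<and> krein_proj_pos a = krein_proj_pos x" by (metis imageE)
  from someI_ex[OF this]
  show "lift_pos x \<in> Lp" "krein_proj_pos (lift_pos x) = krein_proj_pos x"
    unfolding lift_pos_def by auto
qed

lemma lift_neg: "lift_neg x \<in> Ln" "krein_proj_neg (lift_neg x) = krein_proj_neg x"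
proof -
  have "krein_proj_neg x \<in> krein_proj_neg ` Ln" using maximal_negative_proj[OF max_neg] by blast
  then have "\<exists>a. a \<in> Ln \<and> krein_proj_neg a = krein_proj_neg x" by (metis imageE)
  from someI_ex[OF this]
  show "lift_neg x \<in> Ln" "krein_proj_neg (lift_neg x) = krein_proj_neg x"
    unfolding lift_neg_def by auto
qed

text \<open>Two candidates differ by a vector of \<open>Lp\<close> without positive component, which
  the strict inequality allows only if it is 0.\<close>

lemma lift_pos_eqI:
  assumes "a \<in> Lp" "krein_proj_pos a = krein_proj_pos x"
  shows "lift_pos x = a"
proof (rule ccontr)
  assume "lift_pos x \<noteq> a"
  moreover have "lift_pos x - a \<in> Lp"
    using cvec.subspace_diff[OF subspace_pos lift_pos(1) assms(1)] .
  ultimately have "norm (krein_proj_neg (lift_pos x - a)) < norm (krein_proj_pos (lift_pos x - a))"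
    by (intro pos_lt) auto
  then show False using assms(2) lift_pos(2)[of x] by (simp add: pos.diff)
qed

lemma lift_neg_eqI:
  assumes "b \<in> Ln" "krein_proj_neg b = krein_proj_neg x"
  shows "lift_neg x = b"
proof (rule ccontr)
  assume "lift_neg x \<noteq> b"
  moreover have "lift_neg x - b \<in> Ln"
    using cvec.subspace_diff[OF subspace_neg lift_neg(1) assms(1)] .
  ultimately have "norm (krein_proj_pos (lift_neg x - b)) < norm (krein_proj_neg (lift_neg x - b))"
    by (intro neg_lt) auto
  then show False using assms(2) lift_neg(2)[of x] by (simp add: neg.diff)
qed

lemma lift_add: "lift_pos (x + y) = lift_pos x + lift_pos y" "lift_neg (x + y) = lift_neg x + lift_neg y"
  by (rule lift_pos_eqI lift_neg_eqI;
      simp add: lift_pos lift_neg pos.add neg.add cvec.subspace_add subspace_pos subspace_neg)+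

lemma lift_scaleC: "lift_pos (c *\<^sub>C x) = c *\<^sub>C lift_pos x" "lift_neg (c *\<^sub>C x) = c *\<^sub>C lift_neg x"
  by (rule lift_pos_eqI lift_neg_eqI;
      simp add: lift_pos lift_neg pos.scale neg.scale cvec.subspace_scale subspace_pos subspace_neg)+

text \<open>
  If \<open>Lp\<close> and \<open>Ln\<close> are the graphs of \<open>K\<close> and of its adjoint over the fundamental
  decomposition, this is \<open>(I + T) / 2\<close> for the self-adjoint \<open>T\<close> with off-diagonal
  entries \<open>K\<close> and \<open>K\<^sup>*\<close>.
\<close>

definition half_lift :: "'a \<Rightarrow> 'a"
  where "half_lift x = (1 / 2) *\<^sub>R (lift_pos x + lift_neg x)"

lemma two_half_lift: "2 *\<^sub>R half_lift x = lift_pos x + lift_neg x"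
  by (simp add: half_lift_def)

text \<open>The diagonal parts of both sides agree, and \<open>J_orthogonal\<close> says precisely
  that the two off-diagonal parts are adjoint to each other.\<close>

lemma hip_lift_self_adjoint:
  "hip (lift_pos x + lift_neg x) y = hip x (lift_pos y + lift_neg y)"
proof -
  have 1: "hip (krein_proj_pos x) (krein_proj_pos (lift_neg y)) = hip (krein_proj_neg (lift_pos x)) (krein_proj_neg y)"
    for x y
    using J_orth lift_pos(1)[of x] lift_neg(1)[of y]
    by (auto simp: J_orthogonal_def kip_krein_decomp lift_pos(2) lift_neg(2))
  have 2: "hip (krein_proj_pos (lift_neg x)) (krein_proj_pos y) = hip (krein_proj_neg x) (krein_proj_neg (lift_pos y))"
    using 1[of y x] hip_commute by metis
  show ?thesis
    unfolding hip_add_left hip_add_right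
    by (subst (1 2 3 4) hip_krein_decomp) (simp add: lift_pos(2) lift_neg(2) 1 2)
qed

text \<open>For \<open>T = 2 S - I\<close> the left side is the modulus of (T x, x), so this encodes
  both 0 \<le> S and S \<le> I. Only the off-diagonal entries contribute, each at most
  \<open>?p * ?n\<close>, and 2 p n \<le> p^2 + n^2.\<close>

lemma half_lift_form:
  "\<bar>Re (hip (lift_pos x + lift_neg x) x) - (norm x)\<^sup>2\<bar> \<le> (norm x)\<^sup>2"
proof -
  let ?p = "norm (krein_proj_pos x)" and ?n = "norm (krein_proj_neg x)"
  have "hip (lift_pos x + lift_neg x) x = hip x x
      + hip (krein_proj_neg (lift_pos x)) (krein_proj_neg x) + hip (krein_proj_pos (lift_neg x)) (krein_proj_pos x)"
    unfolding hip_add_left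
    by (subst (1 2 3) hip_krein_decomp) (simp add: lift_pos(2) lift_neg(2))
  then have "Re (hip (lift_pos x + lift_neg x) x) - (norm x)\<^sup>2
      = Re (hip (krein_proj_neg (lift_pos x)) (krein_proj_neg x)) + Re (hip (krein_proj_pos (lift_neg x)) (krein_proj_pos x))"
    by (simp add: norm_sq_eq_hip)
  moreover have "\<bar>Re (hip (krein_proj_neg (lift_pos x)) (krein_proj_neg x))\<bar> \<le> ?p * ?n"
  proof -
    have "\<bar>Re (hip (krein_proj_neg (lift_pos x)) (krein_proj_neg x))\<bar> \<le> norm (krein_proj_neg (lift_pos x)) * ?n"
      using abs_Re_le_cmod hip_Cauchy_Schwarz order.trans by blast
    also have "\<dots> \<le> ?p * ?n"
      using pos_le[OF lift_pos(1)[of x]] by (intro mult_right_mono) (simp_all add: lift_pos(2))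
    finally show ?thesis .
  qed
  moreover have "\<bar>Re (hip (krein_proj_pos (lift_neg x)) (krein_proj_pos x))\<bar> \<le> ?n * ?p"
  proof -
    have "\<bar>Re (hip (krein_proj_pos (lift_neg x)) (krein_proj_pos x))\<bar> \<le> norm (krein_proj_pos (lift_neg x)) * ?p"
      using abs_Re_le_cmod hip_Cauchy_Schwarz order.trans by blast
    also have "\<dots> \<le> ?n * ?p"
      using neg_le[OF lift_neg(1)[of x]] by (intro mult_right_mono) (simp_all add: lift_neg(2))
    finally show ?thesis .
  qed
  moreover have "2 * ?p * ?n \<le> (norm x)\<^sup>2"
    using sum_squares_bound[of ?p ?n] norm_krein_decomp[of x] by simp
  ultimately show ?thesis by (simp add: mult.commute abs_le_iff)
qed

lemma fund_sym_lift:
  "fund_sym (lift_pos x) = 2 *\<^sub>R krein_proj_pos x - lift_pos x"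
  "fund_sym (lift_neg x) = lift_neg x - 2 *\<^sub>R krein_proj_neg x"
  using lift_pos(2)[of x] lift_neg(2)[of x]
  by (simp_all add: fund_sym_eq_proj krein_proj_neg_eq[of "lift_pos x"] krein_proj_pos_eq[of "lift_neg x"] scaleR_2)

lemma lift_fund_sym: "lift_pos (fund_sym x) = lift_pos x" "lift_neg (fund_sym x) = - lift_neg x"
  by (rule lift_pos_eqI lift_neg_eqI;
      simp add: lift_pos lift_neg krein_proj_fund_sym neg.neg cvec.subspace_neg subspace_neg)+

sublocale fund_sym_contraction half_lift
proof
  fix x y c
  show "half_lift (x + y) = half_lift x + half_lift y"
    by (simp add: half_lift_def lift_add algebra_simps)
  show "half_lift (c *\<^sub>C x) = c *\<^sub>C half_lift x"
    by (simp add: half_lift_def lift_scaleC scaleR_scaleC scaleC_scaleC mult.commute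
        flip: scaleC_add_right)
  show "hip (half_lift x) y = hip x (half_lift y)"
    by (simp add: half_lift_def hip_scaleR_left hip_scaleR_right hip_lift_self_adjoint del: scaleR_add_right)
  have "Re (hip (half_lift x) x) = Re (hip (lift_pos x + lift_neg x) x) / 2"
    by (simp add: half_lift_def hip_scaleR_left del: scaleR_add_right)
  then show "0 \<le> Re (hip (half_lift x) x)" "Re (hip (half_lift x) x) \<le> (norm x)\<^sup>2"
    using half_lift_form[of x] by (simp_all add: abs_le_iff)
  have "2 *\<^sub>R half_lift (fund_sym x) = 2 *\<^sub>R fund_sym (x - half_lift x)"
  proof -
    have scale: "2 *\<^sub>R fund_sym z = fund_sym (2 *\<^sub>R z)" for z
      by (simp add: scaleR_scaleC fund_sym_scaleC)
    have "2 *\<^sub>R fund_sym (x - half_lift x) = 2 *\<^sub>R fund_sym x - (fund_sym (lift_pos x) + fund_sym (lift_neg x))"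
      by (simp add: scale scaleR_diff_right two_half_lift fund_sym_diff fund_sym_additive)
    also have "\<dots> = lift_pos x - lift_neg x"
      unfolding fund_sym_lift fund_sym_eq_proj[of x] by (simp add: scaleR_diff_right)
    finally show ?thesis by (simp add: two_half_lift lift_fund_sym)
  qed
  then show "half_lift (fund_sym x) = fund_sym (x - half_lift x)" by simp
qed

text \<open>A vector killed by \<open>S\<close> has opposite lifts, so \<open>J_orthogonal\<close>
  makes its positive lift neutral, and a neutral vector of \<open>Lp\<close> is 0. Hence 0 is not an
  eigenvalue; the reflection by \<open>J\<close> rules out the eigenvalue 1 as well.\<close>

lemma half_lift_eq_0: "half_lift w = 0 \<Longrightarrow> w = 0"
proof -
  assume "half_lift w = 0"
  then have sum: "lift_pos w + lift_neg w = 0" using two_half_lift[of w] by simp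
  then have eq: "lift_neg w = - lift_pos w" by (simp add: eq_neg_iff_add_eq_0 add.commute)
  have "kip (lift_pos w) (lift_neg w) = 0"
    using J_orth lift_pos(1) lift_neg(1) by (auto simp: J_orthogonal_def)
  then have "kip (lift_pos w) (lift_pos w) = 0" using eq by simp
  then have "lift_pos w = 0" using pos_lt[OF lift_pos(1)[of w]] Re_kip_self_pos_iff[of "lift_pos w"] by auto
  then have "krein_proj_pos w = 0" "krein_proj_neg w = 0"
    using lift_pos(2)[of w] lift_neg(2)[of w] eq by simp_all
  then show "w = 0" using krein_proj_add[of w] by simp
qed

lemma half_lift_eq_self: "half_lift w = w \<Longrightarrow> w = 0"
proof -
  assume "half_lift w = w"
  then have "half_lift (fund_sym w) = 0" by (simp add: S_fund_sym)
  then have "fund_sym w = 0" by (rule half_lift_eq_0)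
  then show "w = 0" using fund_sym_idem[of w] by simp
qed

text \<open>Each vector of \<open>Lp\<close> or \<open>Ln\<close> is recovered by \<open>2 S\<close>
  from its own component. Applied to the frame vectors, this is what puts them into the domain of
  \<open>exp (Q / 2)\<close>.\<close>

lemma two_half_lift_proj:
  "a \<in> Lp \<Longrightarrow> 2 *\<^sub>R half_lift (krein_proj_pos a) = a"
  "b \<in> Ln \<Longrightarrow> 2 *\<^sub>R half_lift (krein_proj_neg b) = b"
proof -
  show "2 *\<^sub>R half_lift (krein_proj_pos a) = a" if "a \<in> Lp"
  proof -
    have "lift_pos (krein_proj_pos a) = a" by (rule lift_pos_eqI) (use that in simp_all)
    moreover have "lift_neg (krein_proj_pos a) = 0"
      by (rule lift_neg_eqI) (simp_all add: cvec.subspace_0 subspace_neg)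
    ultimately show ?thesis by (simp add: two_half_lift)
  qed
  show "2 *\<^sub>R half_lift (krein_proj_neg b) = b" if "b \<in> Ln"
  proof -
    have "lift_neg (krein_proj_neg b) = b" by (rule lift_neg_eqI) (use that in simp_all)
    moreover have "lift_pos (krein_proj_neg b) = 0"
      by (rule lift_pos_eqI) (simp_all add: cvec.subspace_0 subspace_pos)
    ultimately show ?thesis by (simp add: two_half_lift)
  qed
qed

end

section \<open>Extending frame inequalities from a dense subspace\<close>

lemma frame_bounds_closure:
  fixes g :: "nat \<Rightarrow> 'a::krein_space"
  assumes B: "0 \<le> B" and A: "0 \<le> A"
    and diff: "\<And>v w. v \<in> V \<Longrightarrow> w \<in> V \<Longrightarrow> v - w \<in> V"
    and summable: "\<And>v. v \<in> V \<Longrightarrow> (\<lambda>n. (cmod (hip v (g n)))\<^sup>2) summable_on N"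
    and lower: "\<And>v. v \<in> V \<Longrightarrow> A * (norm v)\<^sup>2 \<le> (\<Sum>\<^sub>\<infinity>n\<in>N. (cmod (hip v (g n)))\<^sup>2)"
    and upper: "\<And>v. v \<in> V \<Longrightarrow> (\<Sum>\<^sub>\<infinity>n\<in>N. (cmod (hip v (g n)))\<^sup>2) \<le> B * (norm v)\<^sup>2"
    and x: "x \<in> closure V"
  shows "(\<lambda>n. (cmod (hip x (g n)))\<^sup>2) summable_on N"
    and "A * (norm x)\<^sup>2 \<le> (\<Sum>\<^sub>\<infinity>n\<in>N. (cmod (hip x (g n)))\<^sup>2)"
    and "(\<Sum>\<^sub>\<infinity>n\<in>N. (cmod (hip x (g n)))\<^sup>2) \<le> B * (norm x)\<^sup>2"
proof -
  \<comment> \<open>Finite sums are continuous in the vector, so the upper bound passes to limits.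
    It is kept general in \<open>y\<close> because it is applied to \<open>x\<close> and also to
    \<open>W k - x\<close>.\<close>
  have finite_upper: "(\<Sum>n\<in>F. (cmod (hip y (g n)))\<^sup>2) \<le> B * (norm y)\<^sup>2"
    if "W \<longlonglongrightarrow> y" "\<And>k. W k \<in> V" "finite F" "F \<subseteq> N" for W y F
  proof (rule LIMSEQ_le)
    show "(\<lambda>k. \<Sum>n\<in>F. (cmod (hip (W k) (g n)))\<^sup>2) \<longlonglongrightarrow> (\<Sum>n\<in>F. (cmod (hip y (g n)))\<^sup>2)"
      by (rule tendsto_sum, rule tendsto_power, rule tendsto_norm, rule tendsto_hip[OF that(1) tendsto_const])
    show "(\<lambda>k. B * (norm (W k))\<^sup>2) \<longlonglongrightarrow> B * (norm y)\<^sup>2"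
      by (rule tendsto_mult_left, rule tendsto_power, rule tendsto_norm, rule that(1))
    have "(\<Sum>n\<in>F. (cmod (hip (W k) (g n)))\<^sup>2) \<le> B * (norm (W k))\<^sup>2" for k
      using finite_sum_le_infsum[OF summable[OF that(2)] that(3,4), of k] upper[OF that(2), of k] by simp
    then show "\<exists>K. \<forall>k\<ge>K. (\<Sum>n\<in>F. (cmod (hip (W k) (g n)))\<^sup>2) \<le> B * (norm (W k))\<^sup>2" by blast
  qed
  obtain W where W: "\<And>k. W k \<in> V" "W \<longlonglongrightarrow> x" using x unfolding closure_sequential by blast
  show sx: "(\<lambda>n. (cmod (hip x (g n)))\<^sup>2) summable_on N"
    by (rule nonneg_bdd_above_summable_on)
       (auto intro!: bdd_aboveI2[where M = "B * (norm x)\<^sup>2"] finite_upper[OF W(2,1)])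
  show "(\<Sum>\<^sub>\<infinity>n\<in>N. (cmod (hip x (g n)))\<^sup>2) \<le> B * (norm x)\<^sup>2"
    by (rule infsum_le_finite_sums[OF sx finite_upper[OF W(2,1)]])
  define I where "I = (\<Sum>\<^sub>\<infinity>n\<in>N. (cmod (hip x (g n)))\<^sup>2)"
  have "I \<ge> 0" unfolding I_def by (rule infsum_nonneg) simp
  \<comment> \<open>An infinite sum need not be continuous in the vector, so the lower bound goes
    through the triangle inequality for square-summable sequences; the error term is controlled by
    the upper bound at \<open>W k - x\<close>.\<close>
  have W_bound: "A * (norm (W k))\<^sup>2 \<le> (sqrt I + sqrt B * norm (W k - x))\<^sup>2" for k
  proof -
    have "(\<Sum>n\<in>F. (cmod (hip (W k) (g n)))\<^sup>2) \<le> (sqrt I + sqrt B * norm (W k - x))\<^sup>2"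
      if F: "finite F" "F \<subseteq> N" for F
    proof -
      have d: "(\<Sum>n\<in>F. (cmod (hip (W k - x) (g n)))\<^sup>2) \<le> B * (norm (W k - x))\<^sup>2"
        by (rule finite_upper[OF tendsto_diff[OF tendsto_const W(2)] diff[OF W(1) W(1)] F])
      have "L2_set (\<lambda>n. cmod (hip (W k) (g n))) F
          \<le> L2_set (\<lambda>n. cmod (hip x (g n)) + cmod (hip (W k - x) (g n))) F"
        using norm_triangle_ineq[of "hip x (g n)" "hip (W k - x) (g n)" for n]
        by (intro L2_set_mono) (simp_all add: hip_diff_left)
      also have "\<dots> \<le> L2_set (\<lambda>n. cmod (hip x (g n))) F + L2_set (\<lambda>n. cmod (hip (W k - x) (g n))) F"
        by (rule L2_set_triangle_ineq)
      also have "\<dots> \<le> sqrt I + sqrt (B * (norm (W k - x))\<^sup>2)"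
        unfolding L2_set_def I_def
        using d finite_sum_le_infsum[OF sx F] by (intro add_mono real_sqrt_le_mono) auto
      also have "\<dots> = sqrt I + sqrt B * norm (W k - x)" by (simp add: real_sqrt_mult)
      finally have "(L2_set (\<lambda>n. cmod (hip (W k) (g n))) F)\<^sup>2 \<le> (sqrt I + sqrt B * norm (W k - x))\<^sup>2"
        by (intro power_mono) (auto simp: L2_set_nonneg)
      then show ?thesis by (simp add: L2_set_def sum_nonneg)
    qed
    then have "(\<Sum>\<^sub>\<infinity>n\<in>N. (cmod (hip (W k) (g n)))\<^sup>2) \<le> (sqrt I + sqrt B * norm (W k - x))\<^sup>2"
      by (rule infsum_le_finite_sums[OF summable[OF W(1)]])
    then show ?thesis using lower[OF W(1), of k] by linarith
  qed
  have "A * (norm x)\<^sup>2 \<le> (sqrt I + sqrt B * 0)\<^sup>2"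
  proof (rule LIMSEQ_le)
    show "(\<lambda>k. A * (norm (W k))\<^sup>2) \<longlonglongrightarrow> A * (norm x)\<^sup>2"
      by (rule tendsto_mult_left, rule tendsto_power, rule tendsto_norm, rule W(2))
    show "(\<lambda>k. (sqrt I + sqrt B * norm (W k - x))\<^sup>2) \<longlonglongrightarrow> (sqrt I + sqrt B * 0)\<^sup>2"
      by (rule tendsto_power, rule tendsto_add[OF tendsto_const],
          rule tendsto_mult_left[OF tendsto_norm_diff[OF W(2)]])
  qed (use W_bound in blast)
  then show "A * (norm x)\<^sup>2 \<le> (\<Sum>\<^sub>\<infinity>n\<in>N. (cmod (hip x (g n)))\<^sup>2)"
    using \<open>I \<ge> 0\<close> by (simp add: I_def)
qed

text \<open>
  The logarithm of \<open>(1 - t) / t\<close>; for \<open>t = (1 + s) / 2\<close> it is \<open>-2 artanh s\<close>. The value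
  \<open>0\<close> outside the open unit interval keeps it odd under \<open>t \<mapsto> 1 - t\<close>.
\<close>

definition log_odds :: "real \<Rightarrow> real"
  where "log_odds t = (if 0 < t \<and> t < 1 then ln ((1 - t) / t) else 0)"

lemma borel_measurable_log_odds [measurable]: "log_odds \<in> borel_measurable borel"
  unfolding log_odds_def[abs_def] by measurable

lemma log_odds_reflect: "log_odds (1 - t) = - log_odds t"
  by (auto simp: log_odds_def ln_div)

text \<open>For t = (1 + s) / 2 this is sqrt (1 - s^2), so the operator obtained from it is the
  square root of I - T^2.\<close>

definition gram_weight :: "real \<Rightarrow> real"
  where "gram_weight t = 2 * sqrt (t * (1 - t))"

lemma borel_measurable_gram_weight [measurable]: "gram_weight \<in> borel_measurable borel"
  unfolding gram_weight_def[abs_def] by measurable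

lemma gram_weight_bounded:
  assumes "0 \<le> t" "t \<le> 1"
  shows "\<bar>gram_weight t\<bar> \<le> 2"
proof -
  have "t * (1 - t) \<le> 1" using assms mult_mono[of t 1 "1 - t" 1] by simp
  then show ?thesis using assms by (simp add: gram_weight_def)
qed

lemma gram_weight_eq_exp:
  assumes "0 < t" "t < 1"
  shows "exp (log_odds t / 2) * (2 * t) = gram_weight t"
proof -
  have "exp (log_odds t / 2) = sqrt (exp (log_odds t))"
    by (rule real_sqrt_unique[symmetric]) (simp_all add: power2_eq_square flip: exp_add)
  also have "exp (log_odds t) = (1 - t) / t" using assms by (simp add: log_odds_def)
  finally have "exp (log_odds t / 2) * t = sqrt ((1 - t) / t) * sqrt (t\<^sup>2)" using assms by simp
  also have "\<dots> = sqrt (t * (1 - t))"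
    using assms by (simp only: real_sqrt_mult[symmetric]) (simp add: power2_eq_square)
  finally show ?thesis by (simp add: gram_weight_def)
qed

section \<open>The square root of the Gram operator and the transformed frame inequality\<close>

context J_orthogonal_pair
begin

text \<open>The spectral projection at the point c produces a vector with S w = c w. Such a vector
  is 0 at either endpoint, and its squared norm is the mass of c.\<close>

lemma mu_endpoint_null: "c = 0 \<or> c = 1 \<Longrightarrow> AE t in mu x. t \<noteq> c"
proof -
  assume c: "c = 0 \<or> c = 1"
  have sq: "square_integrable (mu x) (indicator {c})" by simp
  define w where "w = sop (indicator {c}) x"
  have "half_lift w = op_poly [:0, 1:] w" by simp
  also have "\<dots> = sop (\<lambda>t. poly [:0, 1:] t * indicator {c} t) x"
    unfolding w_def by (rule op_poly_sop[OF sq])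
  also have "(\<lambda>t. poly [:0, 1:] t * indicator {c} t) = (\<lambda>t. c * indicator {c} t :: real)"
    by (auto simp: indicator_def)
  also have "sop (\<lambda>t. c * indicator {c} t) x = c *\<^sub>R w"
    unfolding w_def by (rule sop_cmult[OF sq])
  finally have "w = 0"
    using c half_lift_eq_0 half_lift_eq_self by auto
  then have "(LINT t|mu x. (indicator {c} t)\<^sup>2) = (0 :: real)"
    using norm_sop_sq[OF sq] by (simp add: w_def)
  moreover have "(\<lambda>t. (indicator {c} t)\<^sup>2 :: real) = indicator {c}" by (auto simp: indicator_def)
  ultimately have "measure (mu x) {c} = 0" by simp
  then have "emeasure (mu x) {c} = 0" by (simp add: mu.emeasure_eq_measure)
  then have "AE t in mu x. t \<notin> {c}" by (intro AE_not_in null_setsI) auto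
  then show ?thesis by simp
qed

lemma AE_mu_open_unit: "AE t in mu x. 0 < t \<and> t < 1"
proof -
  have "AE t in mu x. t \<noteq> 0" "AE t in mu x. t \<noteq> 1" by (simp_all add: mu_endpoint_null)
  with mu.AE_unit show ?thesis by eventually_elim auto
qed

definition gram_root :: "'a \<Rightarrow> 'a"
  where "gram_root = sop gram_weight"

lemma square_integrable_gram_weight [simp]: "square_integrable (mu x) gram_weight"
  by (rule mu.square_integrable_bounded[of _ 2]) (simp_all add: gram_weight_bounded)

lemma gram_root_diff: "gram_root (x - y) = gram_root x - gram_root y"
  unfolding gram_root_def by (rule square_integrable_vec_diff) simp_all

lemma gram_root_scaleC: "gram_root (c *\<^sub>C x) = c *\<^sub>C gram_root x"
  unfolding gram_root_def by (rule sop_vec_scaleC) simp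

lemma gram_root_add: "gram_root (x + y) = gram_root x + gram_root y"
  unfolding gram_root_def by (rule sop_vec_add) simp_all

lemma gram_root_fund_sym: "gram_root (fund_sym x) = fund_sym (gram_root x)"
proof -
  have "(\<lambda>t. gram_weight (1 - t)) = gram_weight" by (simp add: gram_weight_def fun_eq_iff mult.commute)
  then show ?thesis unfolding gram_root_def using sop_fund_sym(2)[of gram_weight x] by simp
qed

lemma gram_root_krein_proj: "gram_root (krein_proj_pos x) = krein_proj_pos (gram_root x)" "gram_root (krein_proj_neg x) = krein_proj_neg (gram_root x)"
  by (simp_all add: krein_proj_pos_def krein_proj_neg_def scaleR_scaleC gram_root_scaleC gram_root_add gram_root_diff gram_root_fund_sym
      del: scaleR_add_right scaleR_diff_right)

lemma norm_gram_root_le: "norm (gram_root x) \<le> 2 * norm x"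
proof -
  have "(norm (gram_root x))\<^sup>2 \<le> (LINT t|mu x. 4)"
    unfolding gram_root_def norm_sop_sq[OF square_integrable_gram_weight]
  proof (rule integral_mono_AE)
    show "AE t in mu x. (gram_weight t)\<^sup>2 \<le> 4"
      using mu.AE_unit
    proof eventually_elim
      case (elim t)
      then have "\<bar>gram_weight t\<bar> \<le> \<bar>2\<bar>" using gram_weight_bounded by simp
      then show ?case unfolding abs_le_square_iff by simp
    qed
  qed (simp_all add: mu.square_integrable_imp_integrable_square)
  also have "\<dots> = (2 * norm x)\<^sup>2"
    using integral_poly_mu[of x 1] by (simp add: norm_sq_eq_hip power_mult_distrib)
  finally show ?thesis by (rule power2_le_imp_le) simp
qed

lemma continuous_on_gram_root: "continuous_on D gram_root"
proof (rule continuous_on_subset)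
  show "continuous_on UNIV gram_root"
    unfolding continuous_on_iff dist_norm
  proof (intro ballI allI impI)
    fix x :: 'a and e :: real assume "e > 0"
    have "norm (gram_root y - gram_root x) < e" if "norm (y - x) < e / 2" for y
      using norm_gram_root_le[of "y - x"] that by (simp add: gram_root_diff)
    then show "\<exists>d>0. \<forall>y\<in>UNIV. norm (y - x) < d \<longrightarrow> norm (gram_root y - gram_root x) < e"
      using \<open>e > 0\<close> by (intro exI[of _ "e / 2"]) auto
  qed
qed simp

text \<open>Moving \<open>J\<close> past \<open>S\<close> turns that factor into I - S, so the
  indefinite form pulled back by \<open>2 S\<close> is the Hilbert form of 4 S (I - S), up to the
  \<open>J\<close> in front of u. Distributing the square root over both arguments gives the right
  side.\<close>

lemma kip_two_half_lift:
  "kip (2 *\<^sub>R half_lift u) (2 *\<^sub>R half_lift v) = hip (gram_root (fund_sym u)) (gram_root v)"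
proof -
  let ?w = "fund_sym u"
  have sq: "square_integrable (mu ?w) (\<lambda>t. gram_weight t * gram_weight t)"
    by (rule mu.square_integrable_mult_bounded[of _ _ _ 2]) (simp_all add: gram_weight_bounded)
  have J: "fund_sym (half_lift u) = ?w - half_lift ?w"
    by (simp add: S_fund_sym fund_sym_diff)
  have "hip (gram_root ?w) (gram_root v) = hip (gram_root (gram_root ?w)) v"
    unfolding gram_root_def by (rule sop_self_adjoint[symmetric]) simp_all
  also have "gram_root (gram_root ?w) = sop (\<lambda>t. gram_weight t * gram_weight t) ?w"
    unfolding gram_root_def by (rule sop_sop(2)) (use sq in simp_all)
  \<comment> \<open>The polynomial is 4 t (1 - t), which equals the squared weight on
    [0, 1].\<close>
  also have "\<dots> = sop (poly [:0, 4, -4:]) ?w"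
  proof (rule sop_cong[OF sq])
    fix t :: real assume "0 \<le> t" "t \<le> 1"
    then have "gram_weight t * gram_weight t = 4 * (t * (1 - t))" by (simp add: gram_weight_def)
    then show "gram_weight t * gram_weight t = poly [:0, 4, -4:] t" by (simp add: algebra_simps)
  qed simp
  also have "\<dots> = 4 *\<^sub>R half_lift (?w - half_lift ?w)"
    by (simp add: sop_poly S_diff S_add S_scaleR scaleR_diff_right)
  also have "hip \<dots> v = 4 * hip (?w - half_lift ?w) (half_lift v)"
    by (simp add: hip_scaleR_left S_self_adjoint)
  also have "\<dots> = kip (2 *\<^sub>R half_lift u) (2 *\<^sub>R half_lift v)"
    using J fund_sym_scaleC[of 2 "half_lift u"]
    by (simp add: kip_eq_hip hip_scaleR_right hip_scaleC_left scaleR_scaleC[of _ "half_lift u"])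
  finally show ?thesis by simp
qed

text \<open>Where the weight is at least 1 / (n + 1) its reciprocal is bounded, so the corresponding
  spectral cut-off of any x lies in the range. The weight vanishes within [0, 1] only at the
  endpoints, which are null, so the cut-offs converge to x.\<close>

lemma gram_root_dense: "closure (range gram_root) = UNIV"
proof -
  have "x \<in> closure (range gram_root)" for x
  proof -
    define \<iota> where "\<iota> n = (indicator {t. 1 / real (Suc n) \<le> gram_weight t} :: real \<Rightarrow> real)" for n
    have [measurable]: "{t. 1 / real (Suc n) \<le> gram_weight t} \<in> sets borel" for n by measurable
    have [measurable]: "\<iota> n \<in> borel_measurable borel" for n unfolding \<iota>_def by simp
    have sq: "square_integrable (mu x) (\<iota> n)" for n unfolding \<iota>_def by simp
    have "sop (\<iota> n) x \<in> range gram_root" for n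
    proof -
      have bound: "\<bar>\<iota> n t / gram_weight t\<bar> \<le> real (Suc n)" for t
      proof (cases "1 / real (Suc n) \<le> gram_weight t")
        case True
        have "0 < 1 / real (Suc n)" by simp
        with True have "0 < gram_weight t" by linarith
        then show ?thesis using True by (simp add: \<iota>_def field_simps)
      qed (simp add: \<iota>_def)
      have eq: "(\<lambda>t. gram_weight t * (\<iota> n t / gram_weight t)) = \<iota> n"
      proof
        fix t
        have "0 < 1 / real (Suc n)" by simp
        then have "gram_weight t \<noteq> 0" if "1 / real (Suc n) \<le> gram_weight t" using that by linarith
        then show "gram_weight t * (\<iota> n t / gram_weight t) = \<iota> n t" by (auto simp: \<iota>_def indicator_def)
      qed
      have "square_integrable (mu x) (\<lambda>t. \<iota> n t / gram_weight t)"
        by (rule mu.square_integrable_bounded[of _ "real (Suc n)"]) (use bound in simp_all)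
      from sop_sop(2)[OF this, of gram_weight]
      have "sop (\<iota> n) x = gram_root (sop (\<lambda>t. \<iota> n t / gram_weight t) x)" by (simp only: eq sq gram_root_def borel_measurable_gram_weight)
      then show ?thesis by simp
    qed
    moreover have "(\<lambda>n. sop (\<iota> n) x) \<longlonglongrightarrow> x"
    proof -
      let ?\<psi> = "indicator {t. 0 < gram_weight t} :: real \<Rightarrow> real"
      have [measurable]: "{t. 0 < gram_weight t} \<in> sets borel" by measurable
      have "(\<lambda>n. sop (\<iota> n) x) \<longlonglongrightarrow> sop ?\<psi> x"
      proof (rule sop_tendsto[OF sq])
        show "(\<lambda>n. LINT t|mu x. (\<iota> n t - ?\<psi> t)\<^sup>2) \<longlonglongrightarrow> 0"
        proof (rule mu.integral_square_diff_tendsto_0[where w = "\<lambda>_. 1" and \<phi> = \<iota> and \<psi> = ?\<psi>])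
          fix t :: real
          show "(\<lambda>n. \<iota> n t) \<longlonglongrightarrow> ?\<psi> t"
          proof (cases "0 < gram_weight t")
            case True
            have "(\<lambda>n. 1 / real (Suc n)) \<longlonglongrightarrow> 0" by (rule LIMSEQ_Suc[OF lim_1_over_n])
            then have "\<forall>\<^sub>F n in sequentially. 1 / real (Suc n) < gram_weight t"
              using True by (rule order_tendstoD(2))
            then have "\<forall>\<^sub>F n in sequentially. \<iota> n t = ?\<psi> t"
              by eventually_elim (use True in \<open>auto simp: \<iota>_def\<close>)
            then show ?thesis by (rule tendsto_eventually)
          next
            case False
            have "\<iota> n t = 0" for n
            proof -
              have "0 < 1 / real (Suc n)" by simp
              then have "\<not> 1 / real (Suc n) \<le> gram_weight t" using False by linarith
              then show ?thesis by (simp add: \<iota>_def)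
            qed
            then show ?thesis using False by simp
          qed
        qed (auto simp: \<iota>_def indicator_le_1 intro: mu.square_integrable_bounded[of _ 1])
      qed simp
      also have "sop ?\<psi> x = sop (poly 1) x"
      proof (rule sop_cong_AE)
        show "AE t in mu x. ?\<psi> t = poly 1 t"
          using AE_mu_open_unit[of x] by eventually_elim (auto simp: gram_weight_def)
      qed simp_all
      also have "\<dots> = x" by (simp add: sop_poly)
      finally show ?thesis .
    qed
    ultimately show ?thesis
      unfolding closure_sequential by (intro exI[of _ "\<lambda>n. sop (\<iota> n) x"] conjI allI)
  qed
  then show ?thesis by auto
qed

text \<open>\<open>P\<close> stands for either fundamental projection. Since
  \<open>y = 2 S (P y)\<close> on \<open>L\<close>, the indefinite products of the hypothesis become
  Hilbert products of \<open>gram_root (P y)\<close> and \<open>gram_root (P (f n))\<close>, up to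
  the sign with which \<open>J\<close> acts on the range of \<open>P\<close>; the assumption
  \<open>sign\<close> discards it under the modulus.\<close>

lemma frame_half:
  fixes f :: "nat \<Rightarrow> 'a"
  assumes P: "orth_proj P" and gram_root_P: "\<And>x. gram_root (P x) = P (gram_root x)"
    and L: "closure (cspan (f ` N)) = L" "P ` L = range P" "\<forall>a\<in>L. 2 *\<^sub>R half_lift (P a) = a"
    and sign: "\<And>x y. cmod (hip (gram_root (fund_sym (P x))) y) = cmod (hip (gram_root (P x)) y)"
    and AB: "0 < A" "A \<le> B"
    and frame: "\<forall>x\<in>cspan (f ` N).
      (\<lambda>n. (cmod (kip x (f n)))\<^sup>2) summable_on N \<and>
      A * cmod (kip x x) \<le> (\<Sum>\<^sub>\<infinity>n\<in>N. (cmod (kip x (f n)))\<^sup>2) \<and>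
      (\<Sum>\<^sub>\<infinity>n\<in>N. (cmod (kip x (f n)))\<^sup>2) \<le> B * cmod (kip x x)"
  shows "(\<lambda>n. (cmod (hip (P x) (gram_root (P (f n)))))\<^sup>2) summable_on N"
    and "A * (norm (P x))\<^sup>2 \<le> (\<Sum>\<^sub>\<infinity>n\<in>N. (cmod (hip (P x) (gram_root (P (f n)))))\<^sup>2)"
    and "(\<Sum>\<^sub>\<infinity>n\<in>N. (cmod (hip (P x) (gram_root (P (f n)))))\<^sup>2) \<le> B * (norm (P x))\<^sup>2"
proof -
  interpret P: orth_proj P by fact
  let ?V = "(\<lambda>y. gram_root (P y)) ` cspan (f ` N)"
  have span_L: "y \<in> L" if "y \<in> cspan (f ` N)" for y using that L(1) closure_subset by blast
  have f_L: "f n \<in> L" if "n \<in> N" for n using that by (intro span_L cvec.span_base) simp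
  have kip_gram_root: "cmod (kip y z) = cmod (hip (gram_root (P y)) (gram_root (P z)))" if "y \<in> L" "z \<in> L" for y z
    using kip_two_half_lift[of "P y" "P z"] bspec[OF L(3) that(1)] bspec[OF L(3) that(2)] sign by simp
  have kip_f: "(cmod (kip y (f n)))\<^sup>2 = (cmod (hip (gram_root (P y)) (gram_root (P (f n)))))\<^sup>2"
    if "y \<in> cspan (f ` N)" "n \<in> N" for y n
    using kip_gram_root[OF span_L[OF that(1)] f_L[OF that(2)]] by simp
  have kip_self: "cmod (kip y y) = (norm (gram_root (P y)))\<^sup>2" if "y \<in> cspan (f ` N)" for y
    using kip_gram_root[OF span_L[OF that] span_L[OF that]] by (simp add: hip_self norm_power)
  have V: "(\<lambda>n. (cmod (hip v (gram_root (P (f n)))))\<^sup>2) summable_on N"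
    "A * (norm v)\<^sup>2 \<le> (\<Sum>\<^sub>\<infinity>n\<in>N. (cmod (hip v (gram_root (P (f n)))))\<^sup>2)"
    "(\<Sum>\<^sub>\<infinity>n\<in>N. (cmod (hip v (gram_root (P (f n)))))\<^sup>2) \<le> B * (norm v)\<^sup>2" if v: "v \<in> ?V" for v
  proof -
    obtain y where y: "y \<in> cspan (f ` N)" "v = gram_root (P y)" using v by blast
    have sum: "(\<Sum>\<^sub>\<infinity>n\<in>N. (cmod (kip y (f n)))\<^sup>2) = (\<Sum>\<^sub>\<infinity>n\<in>N. (cmod (hip v (gram_root (P (f n)))))\<^sup>2)"
      by (rule infsum_cong) (simp add: kip_f[OF y(1)] y(2))
    have "(\<lambda>n. (cmod (kip y (f n)))\<^sup>2) summable_on N \<longleftrightarrow> (\<lambda>n. (cmod (hip v (gram_root (P (f n)))))\<^sup>2) summable_on N"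
      by (rule summable_on_cong) (simp add: kip_f[OF y(1)] y(2))
    with bspec[OF frame y(1)] show "(\<lambda>n. (cmod (hip v (gram_root (P (f n)))))\<^sup>2) summable_on N"
      "A * (norm v)\<^sup>2 \<le> (\<Sum>\<^sub>\<infinity>n\<in>N. (cmod (hip v (gram_root (P (f n)))))\<^sup>2)"
      "(\<Sum>\<^sub>\<infinity>n\<in>N. (cmod (hip v (gram_root (P (f n)))))\<^sup>2) \<le> B * (norm v)\<^sup>2"
      unfolding sum kip_self[OF y(1)] y(2)[symmetric] by auto
  qed
  have cont_P: "continuous_on D P" for D
    unfolding continuous_on_def using P.tendsto_proj tendsto_ident_at by blast
  have cont_gram_root_P: "continuous_on D (\<lambda>y. gram_root (P y))" for D
    by (rule continuous_on_compose2[OF continuous_on_gram_root[of UNIV] cont_P]) simp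
  \<comment> \<open>By continuity the closure of \<open>?V\<close> contains the image of
    \<open>L\<close>, hence, as \<open>L\<close> projects onto the range,
    \<open>gram_root (P y)\<close> for every y. Commutation rewrites this as
    \<open>P (gram_root y)\<close>, and \<open>gram_root\<close> has dense range.\<close>
  have "range P \<subseteq> closure ?V"
  proof -
    have "(\<lambda>y. gram_root (P y)) ` L \<subseteq> closure ?V"
      unfolding L(1)[symmetric] by (rule image_closure_subset[OF cont_gram_root_P]) (auto intro: closure_subset[THEN subsetD])
    then have "gram_root (P y) \<in> closure ?V" for y
      using L(2) by (metis (no_types, lifting) image_eqI image_iff rangeI subsetD)
    then have "P ` closure (range gram_root) \<subseteq> closure ?V"
      by (intro image_closure_subset[OF cont_P]) (auto simp: gram_root_P[symmetric])
    then show ?thesis by (simp add: gram_root_dense)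
  qed
  then have x: "P x \<in> closure ?V" by blast
  have diff: "v - w \<in> ?V" if vw: "v \<in> ?V" "w \<in> ?V" for v w
  proof -
    obtain y z where "y \<in> cspan (f ` N)" "z \<in> cspan (f ` N)" "v = gram_root (P y)" "w = gram_root (P z)" using vw by blast
    then show ?thesis by (intro image_eqI[of _ _ "y - z"]) (simp_all add: P.diff gram_root_diff cvec.span_diff)
  qed
  have "0 \<le> B" "0 \<le> A" using AB by simp_all
  note bounds = frame_bounds_closure[of B A ?V "\<lambda>n. gram_root (P (f n))" N "P x", OF this diff V x]
  show "(\<lambda>n. (cmod (hip (P x) (gram_root (P (f n)))))\<^sup>2) summable_on N"
    "A * (norm (P x))\<^sup>2 \<le> (\<Sum>\<^sub>\<infinity>n\<in>N. (cmod (hip (P x) (gram_root (P (f n)))))\<^sup>2)"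
    "(\<Sum>\<^sub>\<infinity>n\<in>N. (cmod (hip (P x) (gram_root (P (f n)))))\<^sup>2) \<le> B * (norm (P x))\<^sup>2"
    using bounds by blast+
qed

text \<open>The exponential is unbounded near 0, but multiplied by 2 t it equals the bounded
  \<open>gram_weight\<close> on the open interval. At the endpoints \<open>log_odds\<close> is 0 and
  the product is 2 t, still at most 2; these points are null, so the two functions give the same
  operator.\<close>

lemma exp_log_odds_half_lift:
  "square_integrable (mu (2 *\<^sub>R half_lift x)) (\<lambda>t. exp (log_odds t / 2))"
  "sop (\<lambda>t. exp (log_odds t / 2)) (2 *\<^sub>R half_lift x) = gram_root x"
proof -
  let ?\<psi> = "\<lambda>t. exp (log_odds t / 2)"
  have \<phi>: "square_integrable (mu x) (poly [:0, 2:])" by simp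
  have eq: "sop (poly [:0, 2:]) x = 2 *\<^sub>R half_lift x" by (simp add: sop_poly S_scaleR)
  have bound: "\<bar>?\<psi> t * poly [:0, 2:] t\<bar> \<le> 2" if "0 \<le> t" "t \<le> 1" for t
  proof (cases "0 < t \<and> t < 1")
    case True
    then show ?thesis using gram_weight_eq_exp[of t] gram_weight_bounded[of t] by (simp add: mult.commute)
  next
    case False
    then show ?thesis using that by (auto simp: log_odds_def)
  qed
  have sq: "square_integrable (mu x) (\<lambda>t. ?\<psi> t * poly [:0, 2:] t)"
    by (rule mu.square_integrable_bounded[OF _ bound]) simp_all
  have "sop (\<lambda>t. ?\<psi> t * poly [:0, 2:] t) x = gram_root x"
    unfolding gram_root_def
  proof (rule sop_cong_AE[OF sq])
    show "AE t in mu x. ?\<psi> t * poly [:0, 2:] t = gram_weight t"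
      using AE_mu_open_unit[of x]
    proof eventually_elim
      case (elim t)
      then show ?case using gram_weight_eq_exp[of t] by (simp add: mult_ac)
    qed
  qed simp
  with sop_sop[OF \<phi> sq]
  show "square_integrable (mu (2 *\<^sub>R half_lift x)) ?\<psi>" "sop ?\<psi> (2 *\<^sub>R half_lift x) = gram_root x"
    unfolding eq by simp_all
qed

end

section \<open>The logarithm and the union of the two half frames\<close>

theorem proposition3p7:
  fixes f :: "nat \<Rightarrow> 'a::krein_space" and A B :: real
  assumes "J_frame f A B"
    and "J_orthogonal (M_plus f) (M_minus f)"
  shows "\<exists>Q R :: 'a \<rightharpoonup> 'a.
    self_adjoint_operator Q \<and> anticommutes_fund_sym Q \<and>
    functional_calculus Q (\<lambda>t. exp (t / 2)) R \<and>
    (\<forall>n. f n \<in> dom R) \<and> hilbert_frame (\<lambda>n. the (R (f n))) A B"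
proof -
  interpret J_orthogonal_pair "M_plus f" "M_minus f"
    by unfold_locales (use assms in \<open>auto simp: J_frame_def\<close>)
  have AB: "0 < A" "A \<le> B"
    and frame_pos: "\<forall>x\<in>cspan (f ` N_plus f).
      (\<lambda>n. (cmod (kip x (f n)))\<^sup>2) summable_on N_plus f \<and>
      A * cmod (kip x x) \<le> (\<Sum>\<^sub>\<infinity>n\<in>N_plus f. (cmod (kip x (f n)))\<^sup>2) \<and>
      (\<Sum>\<^sub>\<infinity>n\<in>N_plus f. (cmod (kip x (f n)))\<^sup>2) \<le> B * cmod (kip x x)"
    and frame_neg: "\<forall>x\<in>cspan (f ` N_minus f).
      (\<lambda>n. (cmod (kip x (f n)))\<^sup>2) summable_on N_minus f \<and>
      A * cmod (kip x x) \<le> (\<Sum>\<^sub>\<infinity>n\<in>N_minus f. (cmod (kip x (f n)))\<^sup>2) \<and>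
      (\<Sum>\<^sub>\<infinity>n\<in>N_minus f. (cmod (kip x (f n)))\<^sup>2) \<le> B * cmod (kip x x)"
    using assms(1) by (auto simp: J_frame_def)
  let ?\<psi> = "\<lambda>t. exp (log_odds t / 2)"
  define Q where "Q = sop_operator log_odds"
  define R where "R = sop_operator ?\<psi>"
  have self_adjoint: "self_adjoint_operator Q"
    unfolding Q_def by (rule self_adjoint_sop_operator) simp
  have anticommutes: "anticommutes_fund_sym Q"
    unfolding Q_def by (rule anticommutes_sop_operator) (simp_all add: log_odds_reflect)
  \<comment> \<open>One spectral measure serves both operators: integrating the identity against it
    gives \<open>Q\<close>, and integrating exp (t / 2) gives \<open>R\<close>.\<close>
  have calculus: "functional_calculus Q (\<lambda>t. exp (t / 2)) R"
    unfolding functional_calculus_def Q_def R_def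
    by (rule exI[of _ "spectral_family log_odds"])
       (simp add: spectral_measure_spectral_family spectral_integral_spectral_family)
  have R_f: "f n \<in> dom R \<and> the (R (f n)) = gram_root (P (f n))"
    if "2 *\<^sub>R half_lift (P (f n)) = f n" for P n
    using exp_log_odds_half_lift[of "P (f n)"] that
    by (simp add: R_def dom_sop_operator the_sop_operator)
  have mem_pos: "f n \<in> M_plus f" if "n \<in> N_plus f" for n
    unfolding M_plus_def by (rule closure_subset[THEN subsetD], rule cvec.span_base, rule imageI, fact)
  have mem_neg: "f n \<in> M_minus f" if "n \<in> N_minus f" for n
    unfolding M_minus_def by (rule closure_subset[THEN subsetD], rule cvec.span_base, rule imageI, fact)
  have R_pos: "f n \<in> dom R" "the (R (f n)) = gram_root (krein_proj_pos (f n))" if "n \<in> N_plus f" for n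
    using R_f[of krein_proj_pos n] two_half_lift_proj(1)[OF mem_pos[OF that]] by simp_all
  have R_neg: "f n \<in> dom R" "the (R (f n)) = gram_root (krein_proj_neg (f n))" if "n \<in> N_minus f" for n
    using R_f[of krein_proj_neg n] two_half_lift_proj(2)[OF mem_neg[OF that]] by simp_all
  have N: "N_plus f \<union> N_minus f = UNIV" "N_plus f \<inter> N_minus f = {}"
    by (auto simp: N_plus_def N_minus_def)
  have dom_R: "\<forall>n. f n \<in> dom R" using N(1) R_pos(1) R_neg(1) by blast
  have "hilbert_frame (\<lambda>n. the (R (f n))) A B"
    unfolding hilbert_frame_def
  proof (intro conjI allI)
    fix x
    let ?s = "\<lambda>n. (cmod (hip x (the (R (f n)))))\<^sup>2"
    \<comment> \<open>\<open>gram_root\<close> commutes with the projections, so the transformed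
      vector stays in \<open>krein_pos\<close> and sees only the positive component of x. The two
      index sets therefore decouple, and the squared norms of the components add up to that of
      x.\<close>
    have s_pos: "?s n = (cmod (hip (krein_proj_pos x) (gram_root (krein_proj_pos (f n)))))\<^sup>2" if "n \<in> N_plus f" for n
      by (simp add: R_pos(2)[OF that] pos.self_adjoint gram_root_krein_proj)
    have s_neg: "?s n = (cmod (hip (krein_proj_neg x) (gram_root (krein_proj_neg (f n)))))\<^sup>2" if "n \<in> N_minus f" for n
      by (simp add: R_neg(2)[OF that] neg.self_adjoint gram_root_krein_proj)
    have sign_pos: "cmod (hip (gram_root (fund_sym (krein_proj_pos x))) y) = cmod (hip (gram_root (krein_proj_pos x)) y)" for x y
      by (simp add: fund_sym_krein_pos)
    have sign_neg: "cmod (hip (gram_root (fund_sym (krein_proj_neg x))) y) = cmod (hip (gram_root (krein_proj_neg x)) y)" for x y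
      using gram_root_scaleC[of "-1" "krein_proj_neg x"] by (simp add: fund_sym_krein_neg)
    have lift: "\<forall>a\<in>M_plus f. 2 *\<^sub>R half_lift (krein_proj_pos a) = a"
      "\<forall>a\<in>M_minus f. 2 *\<^sub>R half_lift (krein_proj_neg a) = a"
      using two_half_lift_proj by simp_all
    note pos_half = frame_half[OF pos.orth_proj_axioms gram_root_krein_proj(1) M_plus_def[symmetric]
        maximal_positive_proj[OF max_pos] lift(1) sign_pos AB frame_pos, of x]
    note neg_half = frame_half[OF neg.orth_proj_axioms gram_root_krein_proj(2) M_minus_def[symmetric]
        maximal_negative_proj[OF max_neg] lift(2) sign_neg AB frame_neg, of x]
    have summable: "?s summable_on N_plus f" "?s summable_on N_minus f"
      using summable_on_cong[THEN iffD2, OF s_pos pos_half(1)]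
        summable_on_cong[THEN iffD2, OF s_neg neg_half(1)] by simp_all
    have sum_pos: "infsum ?s (N_plus f) = (\<Sum>\<^sub>\<infinity>n\<in>N_plus f. (cmod (hip (krein_proj_pos x) (gram_root (krein_proj_pos (f n)))))\<^sup>2)"
      by (rule infsum_cong) (rule s_pos)
    have sum_neg: "infsum ?s (N_minus f) = (\<Sum>\<^sub>\<infinity>n\<in>N_minus f. (cmod (hip (krein_proj_neg x) (gram_root (krein_proj_neg (f n)))))\<^sup>2)"
      by (rule infsum_cong) (rule s_neg)
    show "?s summable_on UNIV"
      using summable_on_Un_disjoint[OF summable N(2)] N(1) by simp
    have sum: "infsum ?s UNIV = infsum ?s (N_plus f) + infsum ?s (N_minus f)"
      using infsum_Un_disjoint[OF summable N(2)] N(1) by simp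
    show "A * (norm x)\<^sup>2 \<le> infsum ?s UNIV"
      unfolding sum sum_pos sum_neg norm_krein_decomp[of x]
      using pos_half(2) neg_half(2) by (simp add: distrib_left)
    show "infsum ?s UNIV \<le> B * (norm x)\<^sup>2"
      unfolding sum sum_pos sum_neg norm_krein_decomp[of x]
      using pos_half(3) neg_half(3) by (simp add: distrib_left)
  qed (use AB in auto)
  with self_adjoint anticommutes calculus dom_R show ?thesis by blast
qed

end
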